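(* Let $\alpha\in\mathbb R$, $\alpha\ne0$, and $1<p,q<\infty$. Let $\{a_k\}_{k\in\mathbb Z}$ be a lacunary sequence of positive numbers with $a_{k+1}/a_k\ge a>1$ for all $k\in\mathbb Z$. If the norms $\|f\|_{\dot F_{pq}^{\alpha,\{\Phi_k\}_{k\in\mathbb Z}}(\mathbb R^n)}$ and $\|f\|_{\dot F_{pq}^{\alpha,\{\Psi_k\}_{k\in\mathbb Z}}(\mathbb R^n)}$ are equivalent for any two partitions of unity $\{\Phi_k\}_{k\in\mathbb Z}$ and $\{\Psi_k\}_{k\in\mathbb Z}$ adapted to $\{a_k\}_{k\in\mathbb Z}$, then there exists $C_0>a$ such that $$\frac{a_{k+1}}{a_k}\le C_0\qquad(k\in\mathbb Z),$$ and, in this case, for a partition of unity $\{\Phi_k\}_{k\in\mathbb Z}$ adapted to $\{a_k\}_{k\in\mathbb Z}$, the norm $\|f\|_{\dot F_{pq}^{\alpha,\{\Phi_k\}_{k\in\mathbb Z}}(\mathbb R^n)}$ is equivalent to the usual homogeneous Triebel-Lizorkin norm $\|f\|_{\dot F_{pq}^{\alpha}(\mathbb R^n)}$.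
   Context: A sequence $\{\Phi_k\}_{k\in\mathbb Z}$ of $C^\infty(\mathbb R^n)$-functions is a partition of unity adapted to $\{a_k\}_{k\in\mathbb Z}$ if $\operatorname{supp}\widehat{\Phi_k}\subset\{\xi\in\mathbb R^n: a_{k-1}\le|\xi|\le a_{k+1}\}$ for all $k\in\mathbb Z$, $\sum_{k\in\mathbb Z}\widehat{\Phi_k}(\xi)=1$ for $\xi\in\mathbb R^n\setminus\{0\}$, and for every multi-index $\beta$ there is a constant $C_\beta$ (independent of $k$ and $\xi$) with $|\xi^\beta\partial^\beta\widehat{\Phi_k}(\xi)|\le C_\beta$. Let $\mathcal P$ be the set of all polynomials on $\mathbb R^n$. For $f\in\mathcal S'(\mathbb R^n)/\mathcal P$ set $$\|f\|_{\dot F_{pq}^{\alpha,\{\Phi_k\}_{k\in\mathbb Z}}(\mathbb R^n)}=\Bigl\|\Bigl(\sum_{k\in\mathbb Z}a_k^{\alpha q}|\Phi_k*f|^q\Bigr)^{1/q}\Bigr\|_{L^p(\mathbb R^n)}.$$ The usual homogeneous Triebel-Lizorkin norm is $\|f\|_{\dot F^\alpha_{pq}}=\bigl\|\bigl(\sum_{j\in\mathbb Z}|2^{\alpha j}\mathcal F^{-1}(\varphi_0(2^{-j}\cdot)\mathcal F f)|^q\bigr)^{1/q}\bigr\|_{L^p}$, where $\varphi_0$ is a smooth function supported in an annulus away from $0$ with $\sum_j\varphi_0(2^{-j}\xi)=1$ for $\xi\neq0$ (different choices, and replacing $2$ by another base $>1$, give equivalent norms). Two norms are equivalent if each is bounded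 by a constant times the other, with constants independent of $f$. *)

theory Defs
  imports "HOL-Analysis.Analysis"
begin

section \<open>Multi-indices and smooth functions\<close>

text \<open>A multi-index is given by a list of coordinates: its exponent in direction \<open>i\<close> is the number
  of occurrences of \<open>i\<close> in the list and its order is the length. Every multi-index arises in this
  way, and on smooth functions the order of the entries is irrelevant since partial derivatives
  commute.\<close>

type_synonym 'n multi_index = "'n list"

definition monom_at :: "'n::finite multi_index \<Rightarrow> real ^ 'n \<Rightarrow> real" where
  "monom_at \<beta> x = prod_list (map (\<lambda>i. x $ i) \<beta>)"

definition partial :: "'n::finite \<Rightarrow> (real ^ 'n \<Rightarrow> complex) \<Rightarrow> real ^ 'n \<Rightarrow> complex" where
  "partial i f x = frechet_derivative f (at x) (axis i 1)"

primrec partials :: "'n::finite multi_index \<Rightarrow> (real ^ 'n \<Rightarrow> complex) \<Rightarrow> real ^ 'n \<Rightarrow> complex" where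
  "partials [] f = f"
| "partials (i # \<beta>) f = partial i (partials \<beta> f)"

definition smooth :: "(real ^ 'n::finite \<Rightarrow> complex) \<Rightarrow> bool" where
  "smooth f \<longleftrightarrow> (\<forall>\<beta>. partials \<beta> f differentiable_on UNIV)"

section \<open>Schwartz functions and the Fourier transform\<close>

definition schwartz :: "(real ^ 'n::finite \<Rightarrow> complex) \<Rightarrow> bool" where
  "schwartz \<phi> \<longleftrightarrow> smooth \<phi> \<and> (\<forall>\<beta> \<gamma>. bounded (range (\<lambda>x. monom_at \<beta> x *\<^sub>R partials \<gamma> \<phi> x)))"

definition schwartz_norm :: "nat \<Rightarrow> (real ^ 'n::finite \<Rightarrow> complex) \<Rightarrow> real" where
  "schwartz_norm N \<phi> = (\<Sum>\<beta> | length \<beta> \<le> N. \<Sum>\<gamma> | length \<gamma> \<le> N.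
     (SUP x. norm (monom_at \<beta> x *\<^sub>R partials \<gamma> \<phi> x)))"

definition fourier :: "(real ^ 'n::finite \<Rightarrow> complex) \<Rightarrow> real ^ 'n \<Rightarrow> complex" where
  "fourier \<phi> \<xi> = (LINT x|lborel. cis (- 2 * pi * (x \<bullet> \<xi>)) * \<phi> x)"

definition inv_fourier :: "(real ^ 'n::finite \<Rightarrow> complex) \<Rightarrow> real ^ 'n \<Rightarrow> complex" where
  "inv_fourier \<phi> x = (LINT \<xi>|lborel. cis (2 * pi * (x \<bullet> \<xi>)) * \<phi> \<xi>)"

section \<open>Tempered distributions\<close>

text \<open>A tempered distribution is a functional on functions of which only the values on Schwartz
  functions matter.\<close>

type_synonym 'n functional = "(real ^ 'n \<Rightarrow> complex) \<Rightarrow> complex"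

definition tempered :: "'n::finite functional \<Rightarrow> bool" where
  "tempered u \<longleftrightarrow>
     (\<forall>\<phi> \<psi>. schwartz \<phi> \<longrightarrow> schwartz \<psi> \<longrightarrow> u (\<lambda>x. \<phi> x + \<psi> x) = u \<phi> + u \<psi>) \<and>
     (\<forall>c \<phi>. schwartz \<phi> \<longrightarrow> u (\<lambda>x. c * \<phi> x) = c * u \<phi>) \<and>
     (\<exists>C N. \<forall>\<phi>. schwartz \<phi> \<longrightarrow> norm (u \<phi>) \<le> C * schwartz_norm N \<phi>)"

text \<open>Tempered distributions modulo polynomials. Two functionals that agree on all Schwartz
  functions lie in the same class (take the zero polynomial).\<close>

definition equal_mod_poly :: "('n::finite functional \<times> 'n functional) set" where
  "equal_mod_poly = {(u, v). tempered u \<and> tempered v \<and>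
     (\<exists>P :: real ^ 'n \<Rightarrow> complex. polynomial_function P \<and>
        (\<forall>\<psi>. schwartz \<psi> \<longrightarrow> u \<psi> - v \<psi> = (LINT x|lborel. P x * \<psi> x)))}"

definition tempered_mod_poly :: "'n::finite functional set set" where
  "tempered_mod_poly = {u. tempered u} // equal_mod_poly"

definition convol :: "(real ^ 'n::finite \<Rightarrow> complex) \<Rightarrow> 'n functional \<Rightarrow> real ^ 'n \<Rightarrow> complex" where
  "convol \<Phi> u x = u (\<lambda>y. \<Phi> (x - y))"

definition dist_fourier :: "'n::finite functional \<Rightarrow> 'n functional" where
  "dist_fourier u = (\<lambda>\<psi>. u (fourier \<psi>))"

definition dist_inv_fourier :: "'n::finite functional \<Rightarrow> 'n functional" where
  "dist_inv_fourier u = (\<lambda>\<psi>. u (inv_fourier \<psi>))"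

definition dist_mult :: "(real ^ 'n::finite \<Rightarrow> complex) \<Rightarrow> 'n functional \<Rightarrow> 'n functional" where
  "dist_mult m u = (\<lambda>\<psi>. u (\<lambda>x. m x * \<psi> x))"

text \<open>The continuous function representing a distribution, when there is one. Distributions whose
  Fourier transform has compact support are represented by smooth functions of polynomial growth.\<close>

definition represented_by :: "'n::finite functional \<Rightarrow> (real ^ 'n \<Rightarrow> complex) \<Rightarrow> bool" where
  "represented_by u g \<longleftrightarrow> continuous_on UNIV g \<and>
     (\<forall>\<psi>. schwartz \<psi> \<longrightarrow> integrable lborel (\<lambda>x. g x * \<psi> x) \<and> u \<psi> = (LINT x|lborel. g x * \<psi> x))"

definition function_of :: "'n::finite functional \<Rightarrow> real ^ 'n \<Rightarrow> complex" where
  "function_of u = (THE g. represented_by u g)"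

section \<open>Partitions of unity\<close>

definition annulus :: "real \<Rightarrow> real \<Rightarrow> (real ^ 'n::finite) set" where
  "annulus r R = {\<xi>. r \<le> norm \<xi> \<and> norm \<xi> \<le> R}"

text \<open>A tempered smooth function whose Fourier transform is smooth with compact support is a Schwartz
  function. Requiring \<open>\<Phi> k\<close> to be Schwartz from the start loses no partition of unity and
  guarantees that the integral defining \<open>fourier (\<Phi> k)\<close> is its true Fourier transform.\<close>

definition adapted_partition :: "(int \<Rightarrow> real) \<Rightarrow> (int \<Rightarrow> real ^ 'n::finite \<Rightarrow> complex) \<Rightarrow> bool" where
  "adapted_partition a \<Phi> \<longleftrightarrow>
     (\<forall>k. schwartz (\<Phi> k)) \<and>
     (\<forall>k. closure (support_on UNIV (fourier (\<Phi> k))) \<subseteq> annulus (a (k - 1)) (a (k + 1))) \<and>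
     (\<forall>\<xi>. \<xi> \<noteq> 0 \<longrightarrow> ((\<lambda>k. fourier (\<Phi> k) \<xi>) has_sum 1) UNIV) \<and>
     (\<forall>\<beta>. \<exists>C. \<forall>k \<xi>. norm (monom_at \<beta> \<xi> *\<^sub>R partials \<beta> (fourier (\<Phi> k)) \<xi>) \<le> C)"

definition dyadic_generator :: "(real ^ 'n::finite \<Rightarrow> complex) \<Rightarrow> bool" where
  "dyadic_generator \<phi>\<^sub>0 \<longleftrightarrow> smooth \<phi>\<^sub>0 \<and>
     (\<exists>r R. 0 < r \<and> r < R \<and> closure (support_on UNIV \<phi>\<^sub>0) \<subseteq> annulus r R) \<and>
     (\<forall>\<xi>. \<xi> \<noteq> 0 \<longrightarrow> ((\<lambda>j. \<phi>\<^sub>0 ((2 powi (- j)) *\<^sub>R \<xi>)) has_sum 1) (UNIV :: int set))"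

section \<open>Homogeneous Triebel--Lizorkin norms\<close>

text \<open>Real powers on \<open>[0, \<infinity>]\<close>; only used with positive exponents.\<close>

definition ennpowr :: "ennreal \<Rightarrow> real \<Rightarrow> ennreal" where
  "ennpowr x s = (if x = \<infinity> then \<infinity> else ennreal (enn2real x powr s))"

definition Lp_norm :: "real \<Rightarrow> (real ^ 'n::finite \<Rightarrow> ennreal) \<Rightarrow> ennreal" where
  "Lp_norm p h = ennpowr (\<integral>\<^sup>+ x. ennpowr (h x) p \<partial>lborel) (1 / p)"

definition adapted_TL_dist_norm :: "real \<Rightarrow> real \<Rightarrow> real \<Rightarrow> (int \<Rightarrow> real) \<Rightarrow>
    (int \<Rightarrow> real ^ 'n::finite \<Rightarrow> complex) \<Rightarrow> 'n functional \<Rightarrow> ennreal" where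
  "adapted_TL_dist_norm \<alpha> p q a \<Phi> u =
     Lp_norm p (\<lambda>x. ennpowr
       (\<Sum>\<^sub>\<infinity>k. ennreal (a k powr (\<alpha> * q) * norm (convol (\<Phi> k) u x) powr q)) (1 / q))"

definition TL_dist_norm :: "real \<Rightarrow> real \<Rightarrow> real \<Rightarrow>
    (real ^ 'n::finite \<Rightarrow> complex) \<Rightarrow> 'n functional \<Rightarrow> ennreal" where
  "TL_dist_norm \<alpha> p q \<phi>\<^sub>0 u =
     Lp_norm p (\<lambda>x. ennpowr
       (\<Sum>\<^sub>\<infinity>j. ennreal (norm ((2 powr (\<alpha> * real_of_int j)) *\<^sub>R
          function_of (dist_inv_fourier (dist_mult (\<lambda>\<xi>. \<phi>\<^sub>0 ((2 powi (- j)) *\<^sub>R \<xi>)) (dist_fourier u))) x)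
            powr q)) (1 / q))"

text \<open>Both expressions are invariant under adding a polynomial, because \<open>fourier (\<Phi> k)\<close> and the
  dilates of \<open>\<phi>\<^sub>0\<close> vanish near the origin. The norms of a class are therefore evaluated at any
  representative.\<close>

definition adapted_TL_norm :: "real \<Rightarrow> real \<Rightarrow> real \<Rightarrow> (int \<Rightarrow> real) \<Rightarrow>
    (int \<Rightarrow> real ^ 'n::finite \<Rightarrow> complex) \<Rightarrow> 'n functional set \<Rightarrow> ennreal" where
  "adapted_TL_norm \<alpha> p q a \<Phi> f = adapted_TL_dist_norm \<alpha> p q a \<Phi> (SOME u. u \<in> f)"

definition TL_norm :: "real \<Rightarrow> real \<Rightarrow> real \<Rightarrow>
    (real ^ 'n::finite \<Rightarrow> complex) \<Rightarrow> 'n functional set \<Rightarrow> ennreal" where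
  "TL_norm \<alpha> p q \<phi>\<^sub>0 f = TL_dist_norm \<alpha> p q \<phi>\<^sub>0 (SOME u. u \<in> f)"

definition equivalent_norms :: "'f set \<Rightarrow> ('f \<Rightarrow> ennreal) \<Rightarrow> ('f \<Rightarrow> ennreal) \<Rightarrow> bool" where
  "equivalent_norms X N\<^sub>1 N\<^sub>2 \<longleftrightarrow>
     (\<exists>C>0. \<forall>f\<in>X. N\<^sub>1 f \<le> ennreal C * N\<^sub>2 f) \<and> (\<exists>C>0. \<forall>f\<in>X. N\<^sub>2 f \<le> ennreal C * N\<^sub>1 f)"

end

theory Submission
  imports Defs "HOL-Probability.Characteristic_Functions"
begin

text \<open>The first claim follows by comparing two partitions of unity whose transitions between neighbouring functions
  take place at opposite ends of the intervals \<open>[a k, a (k + 1)]\<close>: if such an interval is long, a function with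
  frequencies in its middle belongs to the level \<open>a k\<close> of one partition and to the level \<open>a (k + 1)\<close> of the other,
  and since \<open>\<alpha> \<noteq> 0\<close> the two norms differ by a large factor.

  For the second claim the equivalence of all adapted norms allows us to replace a given partition by one that is built from
  dilates of a single cutoff, although the derivative bounds of a general partition are only of Marcinkiewicz type.
  The convolution kernels of that partition, as those of the dyadic one, are dominated by dilates of
  \<open>(1 + |x|) powr (- n - 1)\<close>, and every function of one of the two decompositions is a sum of boundedly many
  convolutions of such kernels with functions of the other. So the norms are equivalent by the vector-valued inequality
  for these positive kernels, which is deduced from the Hardy--Littlewood maximal theorem.\<close>

section \<open>Smooth functions\<close>

text \<open>Nothing has to be summed in a space of distributions. A multiplier of either system
  lives in one annulus, where the partition of unity of the other system reduces to a finite sum, so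
  the reproducing formula \<open>m k \<xi> = (\<Sum>j\<in>J k. m k \<xi> * \<nu> j \<xi>)\<close> is
  exact and finite. To use it, convolutions with a tempered distribution must be honest functions
  that compose like their multipliers; this is the purpose of Fourier inversion on test functions
  and of the exchange of a distribution with an integral. Lacunarity bounds the number of indices
  \<open>j\<close> in that formula. The upper bound on the ratios keeps every annulus, and every
  kernel, within a bounded factor of a single scale. In the first claim the transition zones of the
  two partitions leave no common frequency window if the ratio is at most \<open>b\<^sup>2\<close>;
  but such a ratio is bounded anyway. Polynomials disappear because the integral of a polynomial
  against a kernel is a combination of derivatives of the multiplier at 0, and all multipliers
  vanish near 0.\<close>

lemma partials_append: "partials (\<beta> @ \<gamma>) f = partials \<beta> (partials \<gamma> f)"
  by (induction \<beta>) auto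

lemma partial_eqI: "(f has_derivative f') (at x) \<Longrightarrow> partial i f x = f' (axis i 1)"
  unfolding partial_def by (metis frechet_derivative_at)

lemma partials_coinduct_aux:
  assumes "P f" and "\<And>f. P f \<Longrightarrow> (\<forall>i. P (partial i f))"
  shows "P (partials \<beta> f)"
  using assms by (induction \<beta>) auto

text \<open>Smoothness proofs below never compute a higher derivative: it is enough to find a class
  of differentiable functions that is stable under every \<open>partial i\<close>.\<close>

lemma smooth_coinduct:
  assumes "P f" and "\<And>f. P f \<Longrightarrow> f differentiable_on UNIV \<and> (\<forall>i. P (partial i f))"
  shows "smooth f"
  unfolding smooth_def using partials_coinduct_aux[of P f] assms by blast

lemma smooth_partials: "smooth f \<Longrightarrow> smooth (partials \<beta> f)"
  unfolding smooth_def by (metis partials_append)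

lemma smooth_partial: "smooth f \<Longrightarrow> smooth (partial i f)"
  using smooth_partials[of f "[i]"] by simp

lemma smooth_differentiable: "smooth f \<Longrightarrow> f differentiable (at x)"
  unfolding smooth_def using partials.simps(1) by (metis UNIV_I differentiable_on_def)

lemma linear_sum_axis:
  fixes L :: "real ^ 'n::finite \<Rightarrow> complex"
  assumes "linear L"
  shows "L h = (\<Sum>i\<in>UNIV. (h $ i) *\<^sub>R L (axis i 1))"
proof -
  have "h = (\<Sum>i\<in>UNIV. (h $ i) *\<^sub>R axis i 1)"
    using basis_expansion[of h] by (simp add: scalar_mult_eq_scaleR)
  then have "L h = L (\<Sum>i\<in>UNIV. (h $ i) *\<^sub>R axis i 1)" by simp
  then show ?thesis
    by (simp add: linear_sum[OF assms] linear_cmul[OF assms])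
qed

lemma differentiable_has_derivative_partial:
  fixes f :: "real ^ 'n::finite \<Rightarrow> complex"
  assumes "f differentiable (at x)"
  shows "(f has_derivative (\<lambda>h. \<Sum>i\<in>UNIV. (h $ i) *\<^sub>R partial i f x)) (at x)"
proof -
  have d: "(f has_derivative frechet_derivative f (at x)) (at x)"
    using assms frechet_derivative_works by blast
  have "frechet_derivative f (at x) = (\<lambda>h. \<Sum>i\<in>UNIV. (h $ i) *\<^sub>R partial i f x)"
    unfolding partial_def by (rule ext, rule linear_sum_axis[OF has_derivative_linear[OF d]])
  with d show ?thesis by simp
qed

lemma smooth_has_derivative:
  fixes f :: "real ^ 'n::finite \<Rightarrow> complex"
  assumes "smooth f"
  shows "(f has_derivative (\<lambda>h. \<Sum>i\<in>UNIV. (h $ i) *\<^sub>R partial i f x)) (at x)"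
  using differentiable_has_derivative_partial smooth_differentiable[OF assms] by blast

lemma smooth_continuous_on: "smooth f \<Longrightarrow> continuous_on A f"
  by (intro continuous_at_imp_continuous_on ballI differentiable_imp_continuous_within smooth_differentiable)

lemma smooth_borel_measurable: "smooth f \<Longrightarrow> f \<in> borel_measurable borel"
  by (simp add: borel_measurable_continuous_onI smooth_continuous_on)

lemma partial_add:
  assumes "f differentiable (at x)" "g differentiable (at x)"
  shows "partial i (\<lambda>x. f x + g x) x = partial i f x + partial i g x"
  using partial_eqI[OF has_derivative_add[OF differentiable_has_derivative_partial[OF assms(1)]
        differentiable_has_derivative_partial[OF assms(2)]], of i]
    partial_eqI[OF differentiable_has_derivative_partial[OF assms(1)], of i]
    partial_eqI[OF differentiable_has_derivative_partial[OF assms(2)], of i] by simp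

lemma partial_mult:
  assumes "f differentiable (at x)" "g differentiable (at x)"
  shows "partial i (\<lambda>x. f x * g x) x = f x * partial i g x + partial i f x * g x"
  using partial_eqI[OF has_derivative_mult[OF differentiable_has_derivative_partial[OF assms(1)]
        differentiable_has_derivative_partial[OF assms(2)]], of i]
    partial_eqI[OF differentiable_has_derivative_partial[OF assms(1)], of i]
    partial_eqI[OF differentiable_has_derivative_partial[OF assms(2)], of i] by simp

lemma partial_const: "partial i (\<lambda>x. c) = (\<lambda>x. 0)"
  using partial_eqI[OF has_derivative_const] by fastforce

lemma smooth_const: "smooth (\<lambda>x. c)"
  by (rule smooth_coinduct[where P="\<lambda>f. \<exists>c. f = (\<lambda>x. c)"]) (auto simp: partial_const)

lemma has_derivative_coord: "((\<lambda>x. complex_of_real (x $ i)) has_derivative (\<lambda>h. of_real (h $ i))) (at x)"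
  by (intro has_derivative_of_real bounded_linear.has_derivative[OF bounded_linear_vec_nth] has_derivative_ident)

lemma partial_coord: "partial j (\<lambda>x. complex_of_real (x $ i)) = (\<lambda>x. if i = j then 1 else 0)"
  using partial_eqI[OF has_derivative_coord, of j i] by (auto simp: axis_def fun_eq_iff)

lemma smooth_coord: "smooth (\<lambda>x. complex_of_real (x $ i))"
proof (rule smooth_coinduct[where P="\<lambda>f. smooth f \<or> f = (\<lambda>x. complex_of_real (x $ i))"], goal_cases)
  case (2 f)
  have "(\<lambda>x. complex_of_real (x $ i)) differentiable_on UNIV"
    using has_derivative_coord by (metis differentiable_def differentiable_on_def has_derivative_at_withinI)
  moreover have "smooth (partial j (\<lambda>x. complex_of_real (x $ i)))" for j
    by (simp add: partial_coord smooth_const)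
  ultimately show ?case using 2 smooth_partial smooth_differentiable differentiable_at_imp_differentiable_on by metis
qed auto

text \<open>The Leibniz rule turns one product into a sum of two, so products alone are not stable
  under \<open>partial i\<close>; their finite sums are.\<close>

inductive sum_of_products :: "(real ^ 'n::finite \<Rightarrow> complex) \<Rightarrow> bool" where
  mult: "smooth f \<Longrightarrow> smooth g \<Longrightarrow> sum_of_products (\<lambda>x. f x * g x)"
| add: "sum_of_products f \<Longrightarrow> sum_of_products g \<Longrightarrow> sum_of_products (\<lambda>x. f x + g x)"

lemma sum_of_products_smooth: "sum_of_products f \<Longrightarrow> smooth f"
proof (erule smooth_coinduct)
  fix f assume "sum_of_products f"
  then show "f differentiable_on UNIV \<and> (\<forall>i. sum_of_products (partial i f))"
  proof induction
    case (mult f g)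
    have "partial i (\<lambda>x. f x * g x) = (\<lambda>x. f x * partial i g x + partial i f x * g x)" for i
      using partial_mult smooth_differentiable mult by blast
    moreover have "(\<lambda>x. f x * g x) differentiable_on UNIV"
      using mult by (intro differentiable_at_imp_differentiable_on differentiable_mult smooth_differentiable)
    ultimately show ?case
      using mult by (simp add: sum_of_products.intros smooth_partial)
  next
    case (add f g)
    then have "partial i (\<lambda>x. f x + g x) = (\<lambda>x. partial i f x + partial i g x)" for i
      by (auto intro!: ext partial_add simp: differentiable_on_def)
    then show ?case using add by (auto intro!: sum_of_products.intros differentiable_on_add)
  qed
qed

lemma smooth_mult: "smooth f \<Longrightarrow> smooth g \<Longrightarrow> smooth (\<lambda>x. f x * g x)"
  using sum_of_products.mult sum_of_products_smooth by blast

lemma smooth_add: "smooth f \<Longrightarrow> smooth g \<Longrightarrow> smooth (\<lambda>x. f x + g x)"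
  using sum_of_products_smooth[OF sum_of_products.add[OF sum_of_products.mult[OF _ smooth_const[of 1], of f]
        sum_of_products.mult[OF _ smooth_const[of 1], of g]]] by simp

lemma smooth_cmult: "smooth f \<Longrightarrow> smooth (\<lambda>x. c * f x)"
  using smooth_mult smooth_const by blast

lemma smooth_diff: "smooth f \<Longrightarrow> smooth g \<Longrightarrow> smooth (\<lambda>x. f x - g x)"
  using smooth_add[of f "\<lambda>x. (-1) * g x"] smooth_cmult[of g "-1"] by simp

lemma smooth_sum: "(\<And>i. i \<in> A \<Longrightarrow> smooth (f i)) \<Longrightarrow> smooth (\<lambda>x. \<Sum>i\<in>A. f i x)"
  by (induction A rule: infinite_finite_induct) (auto intro: smooth_const smooth_add)

lemma has_derivative_affine_comp:
  fixes f :: "real ^ 'n::finite \<Rightarrow> complex"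
  assumes "smooth f"
  shows "((\<lambda>x. f (c *\<^sub>R x + v)) has_derivative
    (\<lambda>h. \<Sum>i\<in>UNIV. (h $ i) *\<^sub>R (c *\<^sub>R partial i f (c *\<^sub>R x + v)))) (at x)"
proof -
  have 1: "((\<lambda>x. c *\<^sub>R x + v) has_derivative (\<lambda>h. c *\<^sub>R h)) (at x)"
    by (auto intro!: derivative_eq_intros)
  show ?thesis
    using has_derivative_compose[OF 1 smooth_has_derivative[OF assms]]
    by (simp add: algebra_simps scaleR_scaleR)
qed

lemma partial_affine_comp:
  assumes "smooth f"
  shows "partial i (\<lambda>x. f (c *\<^sub>R x + v)) = (\<lambda>x. of_real c * partial i f (c *\<^sub>R x + v))"
proof
  fix x
  have "(\<Sum>j\<in>UNIV. (axis i 1 $ j) *\<^sub>R (c *\<^sub>R partial j f (c *\<^sub>R x + v))) =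
        (\<Sum>j\<in>UNIV. if j = i then (c *\<^sub>R partial j f (c *\<^sub>R x + v)) else 0)"
    by (rule sum.cong) (auto simp: axis_def)
  then show "partial i (\<lambda>x. f (c *\<^sub>R x + v)) x = of_real c * partial i f (c *\<^sub>R x + v)"
    using partial_eqI[OF has_derivative_affine_comp[OF assms], of i c v x]
    by (simp add: scaleR_conv_of_real)
qed

lemma smooth_affine_comp:
  assumes "smooth f" shows "smooth (\<lambda>x. f (c *\<^sub>R x + v))"
\<comment> \<open>Every differentiation produces a factor \<open>c\<close> by the chain rule; the
  constant \<open>d\<close> absorbs it.\<close>
proof (rule smooth_coinduct[where P="\<lambda>g. \<exists>f d. smooth f \<and> g = (\<lambda>x. d * f (c *\<^sub>R x + v))"], goal_cases)
  case 1
  show ?case using assms by (intro exI[of _ f] exI[of _ 1]) auto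
next
  case (2 g)
  then obtain f d where f: "smooth f" and g: "g = (\<lambda>x. d * f (c *\<^sub>R x + v))" by blast
  have dd: "(\<lambda>x. f (c *\<^sub>R x + v)) differentiable (at x)" for x
    using has_derivative_affine_comp[OF f] differentiable_def by blast
  have "partial i g = (\<lambda>x. (d * of_real c) * partial i f (c *\<^sub>R x + v))" for i
    unfolding g using partial_mult[OF differentiable_const dd]
    by (auto simp: partial_affine_comp[OF f] partial_const fun_eq_iff)
  moreover have "g differentiable_on UNIV"
    unfolding g by (intro differentiable_at_imp_differentiable_on differentiable_mult differentiable_const dd)
  ultimately show ?case using smooth_partial[OF f] by blast
qed

lemma partial_cmult: "smooth f \<Longrightarrow> partial i (\<lambda>x. c * f x) = (\<lambda>x. c * partial i f x)"
  using partial_mult[OF differentiable_const smooth_differentiable] by (fastforce simp: partial_const)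

lemma partials_cmult: "smooth f \<Longrightarrow> partials \<beta> (\<lambda>x. c * f x) = (\<lambda>x. c * partials \<beta> f x)"
  by (induction \<beta>) (auto simp: partial_cmult smooth_partials)

lemma partials_affine_comp:
  "smooth f \<Longrightarrow> partials \<beta> (\<lambda>x. f (c *\<^sub>R x + v)) = (\<lambda>x. of_real c ^ length \<beta> * partials \<beta> f (c *\<^sub>R x + v))"
  by (induction \<beta>) (auto simp: partial_cmult smooth_partials smooth_affine_comp partial_affine_comp mult_ac)

lemma partials_add:
  "smooth f \<Longrightarrow> smooth g \<Longrightarrow> partials \<beta> (\<lambda>x. f x + g x) = (\<lambda>x. partials \<beta> f x + partials \<beta> g x)"
  by (induction \<beta>) (auto simp: partial_add smooth_partials smooth_differentiable)

lemma partials_diff: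
  assumes "smooth f" "smooth g"
  shows "partials \<beta> (\<lambda>x. f x - g x) = (\<lambda>x. partials \<beta> f x - partials \<beta> g x)"
  using partials_add[OF assms(1) smooth_cmult[OF assms(2), of "-1"], of \<beta>] partials_cmult[OF assms(2), of \<beta> "-1"]
  by simp

text \<open>The stable class consists of the quotients \<open>g x * inverse (h x) ^ k\<close>:
  differentiating raises the power by one and replaces the numerator by another smooth
  function.\<close>

lemma smooth_inverse:
  fixes h :: "real ^ 'n::finite \<Rightarrow> complex"
  assumes h: "smooth h" and nz: "\<And>x. h x \<noteq> 0"
  shows "smooth (\<lambda>x. inverse (h x))"
proof (rule smooth_coinduct[where P="\<lambda>f. \<exists>g k. smooth g \<and> f = (\<lambda>x. g x * inverse (h x) ^ k)"], goal_cases)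
  case 1
  show ?case by (intro exI[of _ "\<lambda>_. 1"] exI[of _ 1]) (auto simp: smooth_const)
next
  case (2 f)
  then obtain g k where g: "smooth g" and f: "f = (\<lambda>x. g x * inverse (h x) ^ k)" by blast
  let ?D = "\<lambda>f x h. \<Sum>i\<in>UNIV. (h $ i) *\<^sub>R partial i f x"
  have D: "(f has_derivative (\<lambda>y. g x * (of_nat k * (- (inverse (h x) * ?D h x y * inverse (h x))) * inverse (h x) ^ (k - 1))
     + ?D g x y * inverse (h x) ^ k)) (at x)" for x
    unfolding f
    by (rule has_derivative_mult[OF smooth_has_derivative[OF g]
          has_derivative_power[OF Deriv.has_derivative_inverse[OF nz smooth_has_derivative[OF h]]]])
  have S: "?D f x (axis i 1) = partial i f x" if "smooth f" for f :: "real ^ 'n \<Rightarrow> complex" and i x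
    using partial_eqI[OF smooth_has_derivative[OF that], of i x] by simp
  have "partial i f = (\<lambda>x. (partial i g x * h x - of_nat k * (g x * partial i h x)) * inverse (h x) ^ Suc k)" for i
  proof
    fix x
    have "partial i f x = g x * (of_nat k * (- (inverse (h x) * partial i h x * inverse (h x))) * inverse (h x) ^ (k - 1))
     + partial i g x * inverse (h x) ^ k"
      using partial_eqI[OF D, of i x] by (simp only: S[OF h] S[OF g])
    \<comment> \<open>The exponent \<open>k - 1\<close> is truncated at \<open>k = 0\<close>, but
      there the factor \<open>of_nat k\<close> removes the term.\<close>
    also have "\<dots> = (partial i g x * h x - of_nat k * (g x * partial i h x)) * inverse (h x) ^ Suc k"
      using nz[of x] by (cases k) (auto simp: field_simps)
    finally show "partial i f x = \<dots>" .
  qed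
  moreover have "smooth (\<lambda>x. partial i g x * h x - of_nat k * (g x * partial i h x))" for i
    by (intro smooth_diff smooth_mult smooth_const smooth_partial h g)
  moreover have "f differentiable_on UNIV"
    using D by (meson differentiable_at_imp_differentiable_on differentiable_def)
  ultimately show ?case by blast
qed

text \<open>The linear span of these functions is closed under differentiation.\<close>

definition flat_exp :: "nat \<Rightarrow> real \<Rightarrow> real" where
  "flat_exp k x = (if x \<le> 0 then 0 else inverse x ^ k * exp (- inverse x))"

lemma flat_exp_nonneg: "0 \<le> flat_exp k x"
  by (simp add: flat_exp_def)

lemma flat_exp_pos: "0 < x \<Longrightarrow> 0 < flat_exp k x"
  by (simp add: flat_exp_def)

text \<open>With \<open>y = inverse x\<close> this is the decay of \<open>y ^ k * exp (- y)\<close>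
  at infinity.\<close>

lemma flat_exp_at_right: "((\<lambda>x. inverse x ^ k * exp (- inverse x)) \<longlongrightarrow> 0) (at_right (0::real))"
proof -
  have "((\<lambda>y. y ^ k * exp (- y)) \<longlongrightarrow> 0) (at_top :: real filter)"
    using tendsto_power_div_exp_0[of k] by (simp add: exp_minus field_simps)
  then show ?thesis
    by (rule filterlim_compose[OF _ filterlim_inverse_at_top_right])
qed

lemma flat_exp_has_derivative:
  "(flat_exp k has_real_derivative (- real k * flat_exp (k + 1) x + flat_exp (k + 2) x)) (at x)"
proof (cases x "0::real" rule: linorder_cases)
  case less
  have "((\<lambda>x. 0) has_real_derivative 0) (at x)" by simp
  then have "(flat_exp k has_real_derivative 0) (at x)"
    by (rule has_field_derivative_transform_within_open[of _ _ _ "{..<0}"]) (use less in \<open>auto simp: flat_exp_def\<close>)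
  then show ?thesis using less by (simp add: flat_exp_def)
next
  case greater
  have "((\<lambda>y. inverse y ^ k * exp (- inverse y)) has_real_derivative
      (real k * (inverse x ^ (k - 1) * - (inverse x ^ 2)) * exp (- inverse x)
        + (inverse x ^ k) * (exp (- inverse x) * inverse x ^ 2))) (at x)"
    using greater by (auto intro!: derivative_eq_intros simp: power2_eq_square)
  moreover have "real k * (inverse x ^ (k - 1) * - (inverse x ^ 2)) * exp (- inverse x)
        + (inverse x ^ k) * (exp (- inverse x) * inverse x ^ 2) =
      - real k * flat_exp (k + 1) x + flat_exp (k + 2) x"
    using greater by (cases k) (auto simp: flat_exp_def power2_eq_square algebra_simps)
  ultimately have "((\<lambda>y. inverse y ^ k * exp (- inverse y)) has_real_derivative
      (- real k * flat_exp (k + 1) x + flat_exp (k + 2) x)) (at x)"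
    by simp
  then show ?thesis
    by (rule has_field_derivative_transform_within_open[of _ _ _ "{0<..}"])
       (use greater in \<open>auto simp: flat_exp_def\<close>)
next
  case equal
  \<comment> \<open>From the right the difference quotient at 0 is \<open>flat_exp (Suc k)\<close>,
    so the limit of the next order gives the derivative; from the left it is identically 0.\<close>
  have "((\<lambda>y. flat_exp k y / y) \<longlongrightarrow> 0) (at_right 0)"
    by (rule Lim_transform_eventually[OF flat_exp_at_right[of "Suc k"]])
       (auto simp: flat_exp_def eventually_at_filter field_simps)
  moreover have "((\<lambda>y. flat_exp k y / y) \<longlongrightarrow> 0) (at_left 0)"
    by (rule Lim_transform_eventually[OF tendsto_const]) (auto simp: flat_exp_def eventually_at_filter)
  ultimately have "((\<lambda>y. flat_exp k y / y) \<longlongrightarrow> 0) (at 0)"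
    by (simp add: filterlim_split_at)
  then show ?thesis using equal by (simp add: has_field_derivative_iff flat_exp_def)
qed

text \<open>The coefficient \<open>g\<close> collects the inner derivatives of \<open>r\<close>,
  while the order \<open>k\<close> moves to \<open>k + 1\<close> and \<open>k + 2\<close>; finite
  sums over varying \<open>k\<close> therefore form a stable class.\<close>

inductive flat_exp_combination :: "(real ^ 'n::finite \<Rightarrow> real) \<Rightarrow> (real ^ 'n \<Rightarrow> complex) \<Rightarrow> bool"
  for r :: "real ^ 'n \<Rightarrow> real" where
  base: "smooth g \<Longrightarrow> flat_exp_combination r (\<lambda>x. g x * of_real (flat_exp k (r x)))"
| add: "flat_exp_combination r f \<Longrightarrow> flat_exp_combination r g \<Longrightarrow> flat_exp_combination r (\<lambda>x. f x + g x)"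

lemma smooth_flat_exp_comp:
  fixes r :: "real ^ 'n::finite \<Rightarrow> real"
  assumes r: "smooth (\<lambda>x. of_real (r x))"
  shows "smooth (\<lambda>x. of_real (flat_exp k (r x)))"
proof (rule smooth_coinduct[where P="flat_exp_combination r"])
  show "flat_exp_combination r (\<lambda>x. of_real (flat_exp k (r x)))"
    using flat_exp_combination.base[OF smooth_const[of 1], of r k] by simp
  fix f assume "flat_exp_combination r f"
  then show "f differentiable_on UNIV \<and> (\<forall>i. flat_exp_combination r (partial i f))"
  proof induction
    case (base g k)
    let ?D = "\<lambda>f x h. \<Sum>i\<in>UNIV. (h $ i) *\<^sub>R partial i f x"
    let ?r = "\<lambda>x. complex_of_real (r x)"
    let ?F = "\<lambda>x. complex_of_real (flat_exp k (r x))"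
    let ?d = "\<lambda>x. - real k * flat_exp (k + 1) (r x) + flat_exp (k + 2) (r x)"
    have S: "?D f x (axis i 1) = partial i f x" if "smooth f" for f :: "real ^ 'n \<Rightarrow> complex" and i x
      using partial_eqI[OF smooth_has_derivative[OF that], of i x] by simp
    have 1: "(r has_derivative (\<lambda>h. Re (?D ?r x h))) (at x)" for x
      using bounded_linear.has_derivative[OF bounded_linear_Re smooth_has_derivative[OF r]] by simp
    have 2: "((\<lambda>x. flat_exp k (r x)) has_derivative (\<lambda>h. ?d x * Re (?D ?r x h))) (at x)" for x
      using has_derivative_compose[OF 1 flat_exp_has_derivative[unfolded has_field_derivative_def]] by simp
    have 3: "(?F has_derivative (\<lambda>h. of_real (?d x * Re (?D ?r x h)))) (at x)" for x
      using bounded_linear.has_derivative[OF bounded_linear_of_real 2] .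
    \<comment> \<open>\<open>partial\<close> acts on complex functions, so \<open>r\<close> is
      differentiated through its embedding; its partial derivatives are real because the derivative
      of the embedding is the embedding of a real derivative.\<close>
    have re: "of_real (Re (partial i ?r x)) = partial i ?r x" for i x
    proof -
      have "((\<lambda>x. ?r x) has_derivative (\<lambda>h. of_real (Re (?D ?r x h)))) (at x)"
        using bounded_linear.has_derivative[OF bounded_linear_of_real 1] .
      from partial_eqI[OF this, of i] show ?thesis by (simp only: S[OF r])
    qed
    have F: "(\<lambda>x. ?F x) differentiable (at x)" for x
      using 3 differentiable_def by blast
    have pF: "partial i ?F x = of_real (?d x) * partial i ?r x" for i x
      using partial_eqI[OF 3, of i x] by (simp only: S[OF r] of_real_mult re)
    have "partial i (\<lambda>x. g x * ?F x) = (\<lambda>x. ((g x * partial i ?r x * of_real (- real k)) * of_real (flat_exp (k + 1) (r x))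
        + (g x * partial i ?r x) * of_real (flat_exp (k + 2) (r x))) + partial i g x * ?F x)" for i
      using partial_mult[OF smooth_differentiable[OF base] F] pF by (auto simp: fun_eq_iff algebra_simps)
    moreover have "flat_exp_combination r (\<lambda>x. ((g x * partial i ?r x * of_real (- real k)) * of_real (flat_exp (k + 1) (r x))
        + (g x * partial i ?r x) * of_real (flat_exp (k + 2) (r x))) + partial i g x * ?F x)" for i
      by (intro flat_exp_combination.intros smooth_mult smooth_partial base r smooth_const)
    moreover have "(\<lambda>x. g x * ?F x) differentiable_on UNIV"
      by (intro differentiable_at_imp_differentiable_on differentiable_mult smooth_differentiable base F)
    ultimately show ?case by simp
  next
    case (add f g)
    then have "partial i (\<lambda>x. f x + g x) = (\<lambda>x. partial i f x + partial i g x)" for i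
      by (auto intro!: ext partial_add simp: differentiable_on_def)
    then show ?case using add by (auto intro!: flat_exp_combination.intros differentiable_on_add)
  qed
qed

lemma smooth_norm_squared: "smooth (\<lambda>x::real ^ 'n::finite. of_real ((norm x)\<^sup>2))"
proof -
  have "(\<lambda>x::real ^ 'n. complex_of_real ((norm x)\<^sup>2)) = (\<lambda>x. \<Sum>i\<in>UNIV. of_real (x $ i) * of_real (x $ i))"
    by (auto simp: fun_eq_iff norm_vec_def L2_set_def sum_nonneg power2_eq_square)
  then show ?thesis
    using smooth_sum[OF smooth_mult[OF smooth_coord smooth_coord], where A=UNIV] by simp
qed

text \<open>For \<open>1 < b\<close> a plateau function: 1 on the closed unit ball and 0 from radius
  \<open>b\<close> on. It is written in the squared norm because the norm itself is not smooth at
  the origin.\<close>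

definition cutoff :: "real \<Rightarrow> real ^ 'n::finite \<Rightarrow> real" where
  "cutoff b x = flat_exp 0 (b\<^sup>2 - (norm x)\<^sup>2) / (flat_exp 0 (b\<^sup>2 - (norm x)\<^sup>2) + flat_exp 0 ((norm x)\<^sup>2 - 1))"

lemma cutoff_nonneg: "0 \<le> cutoff b x"
  by (simp add: cutoff_def flat_exp_nonneg)

lemma cutoff_denominator_pos:
  assumes "1 < b" shows "0 < flat_exp 0 (b\<^sup>2 - (norm x)\<^sup>2) + flat_exp 0 ((norm x)\<^sup>2 - 1)"
proof (cases "norm x > 1")
  case True
  then have "0 < flat_exp 0 ((norm x)\<^sup>2 - 1)" by (simp add: flat_exp_pos one_less_power)
  then show ?thesis by (simp add: flat_exp_nonneg add_nonneg_pos)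
next
  case False
  then have "(norm x)\<^sup>2 < b\<^sup>2" using assms by (intro power_strict_mono) auto
  then show ?thesis by (simp add: flat_exp_pos flat_exp_nonneg add_pos_nonneg)
qed

lemma cutoff_eq_1: "1 < b \<Longrightarrow> norm x \<le> 1 \<Longrightarrow> cutoff b x = 1"
  using cutoff_denominator_pos[of b x] power_le_one[of "norm x" 2] by (simp add: cutoff_def flat_exp_def)

lemma cutoff_eq_0: "0 \<le> b \<Longrightarrow> b \<le> norm x \<Longrightarrow> cutoff b x = 0"
  using power_mono[of b "norm x" 2] by (simp add: cutoff_def flat_exp_def)

lemma smooth_cutoff:
  assumes "1 < b" shows "smooth (\<lambda>x. complex_of_real (cutoff b x))"
proof -
  have 1: "smooth (\<lambda>x. complex_of_real (b\<^sup>2 - (norm x)\<^sup>2))"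
    unfolding of_real_diff by (intro smooth_diff smooth_const smooth_norm_squared)
  have 2: "smooth (\<lambda>x. complex_of_real ((norm x)\<^sup>2 - 1))"
    unfolding of_real_diff by (intro smooth_diff smooth_const smooth_norm_squared)
  have "smooth (\<lambda>x. complex_of_real (flat_exp 0 (b\<^sup>2 - (norm x)\<^sup>2)) *
      inverse (complex_of_real (flat_exp 0 (b\<^sup>2 - (norm x)\<^sup>2)) + complex_of_real (flat_exp 0 ((norm x)\<^sup>2 - 1))))"
    by (intro smooth_mult smooth_inverse smooth_add smooth_flat_exp_comp 1 2)
       (metis cutoff_denominator_pos[OF assms] of_real_add of_real_eq_0_iff less_irrefl)
  then show ?thesis by (simp add: cutoff_def divide_inverse)
qed

section \<open>The maximal function and vector-valued inequalities\<close>

lemma ennreal_realE: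
  assumes "x \<noteq> top" obtains r where "x = ennreal r" "0 \<le> r"
  using assms by (cases x) auto

lemma ennpowr_ennreal: "0 \<le> r \<Longrightarrow> ennpowr (ennreal r) s = ennreal (r powr s)"
  by (simp add: ennpowr_def)

lemma ennpowr_top [simp]: "ennpowr \<infinity> s = \<infinity>" "ennpowr top s = top"
  by (simp_all add: ennpowr_def)

lemma ennpowr_0 [simp]: "ennpowr 0 s = 0"
  by (simp add: ennpowr_def)

lemma ennpowr_1 [simp]: "ennpowr 1 s = 1"
  by (simp add: ennpowr_def)

lemma ennpowr_one_right [simp]: "ennpowr x 1 = x"
  by (cases x) (simp_all add: ennpowr_def)

lemma ennpowr_mono:
  assumes "0 \<le> s" "x \<le> y" shows "ennpowr x s \<le> ennpowr y s"
  using assms by (cases x; cases y) (auto simp: ennpowr_def top_unique intro!: ennreal_leI powr_mono2)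

lemma ennpowr_mult: "0 < s \<Longrightarrow> ennpowr (x * y) s = ennpowr x s * ennpowr y s"
proof (cases "x = 0 \<or> y = 0")
  case False
  assume "0 < s"
  with False show ?thesis
    by (cases x; cases y)
       (auto simp: ennpowr_ennreal ennreal_mult[symmetric] powr_mult ennreal_mult_top ennreal_top_mult ennpowr_def)
qed auto

lemma ennpowr_ennpowr: "ennpowr (ennpowr x s) t = ennpowr x (s * t)"
  by (cases x) (auto simp: ennpowr_ennreal powr_powr)

lemma ennpowr_add: "0 < s \<Longrightarrow> 0 < t \<Longrightarrow> ennpowr x (s + t) = ennpowr x s * ennpowr x t"
  by (cases x) (auto simp: ennpowr_ennreal powr_add ennreal_mult ennreal_top_mult)

lemma ennpowr_eq_0_iff: "ennpowr x s = 0 \<longleftrightarrow> x = 0"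
  by (cases x) (auto simp: ennpowr_ennreal powr_eq_0_iff)

lemma ennpowr_eq_top_iff: "ennpowr x s = top \<longleftrightarrow> x = top"
  by (cases x) (auto simp: ennpowr_ennreal)

lemma ennpowr_measurable [measurable]:
  assumes [measurable]: "f \<in> borel_measurable M" shows "(\<lambda>x. ennpowr (f x) s) \<in> borel_measurable M"
  unfolding ennpowr_def by measurable

text \<open>A positive power is an order isomorphism with inverse the power \<open>1 / s\<close>,
  hence it commutes with suprema.\<close>

lemma ennpowr_SUP:
  fixes f :: "'i \<Rightarrow> ennreal"
  assumes s: "0 < s"
  shows "ennpowr (SUP i\<in>I. f i) s = (SUP i\<in>I. ennpowr (f i) s)"
proof (rule antisym)
  have "f i \<le> ennpowr (SUP i\<in>I. ennpowr (f i) s) (1 / s)" if "i \<in> I" for i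
  proof -
    have "ennpowr (ennpowr (f i) s) (1 / s) \<le> ennpowr (SUP i\<in>I. ennpowr (f i) s) (1 / s)"
      using s that by (intro ennpowr_mono SUP_upper) auto
    then show ?thesis using s by (simp add: ennpowr_ennpowr)
  qed
  then have "(SUP i\<in>I. f i) \<le> ennpowr (SUP i\<in>I. ennpowr (f i) s) (1 / s)"
    by (rule SUP_least)
  then have "ennpowr (SUP i\<in>I. f i) s \<le> ennpowr (ennpowr (SUP i\<in>I. ennpowr (f i) s) (1 / s)) s"
    using s by (intro ennpowr_mono) auto
  then show "ennpowr (SUP i\<in>I. f i) s \<le> (SUP i\<in>I. ennpowr (f i) s)"
    using s by (simp add: ennpowr_ennpowr)
  show "(SUP i\<in>I. ennpowr (f i) s) \<le> ennpowr (SUP i\<in>I. f i) s"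
    using s by (intro SUP_least ennpowr_mono SUP_upper) auto
qed

text \<open>Comparing the sum with \<open>card A\<close> times its largest term treats exponents
  below and above 1 alike, without a convexity argument.\<close>

lemma ennpowr_sum_le:
  assumes s: "0 < s" and A: "finite A"
  shows "ennpowr (\<Sum>i\<in>A. f i) s \<le> ennreal (real (card A) powr s) * (\<Sum>i\<in>A. ennpowr (f i) s)"
proof (cases "A = {}")
  case False
  define m where "m = Max (f ` A)"
  have "m \<in> f ` A" unfolding m_def using A False by (intro Max_in) auto
  then obtain i where i: "i \<in> A" "f i = m" by auto
  have "(\<Sum>i\<in>A. f i) \<le> of_nat (card A) * m"
    unfolding m_def using A by (intro sum_bounded_above) auto
  then have "ennpowr (\<Sum>i\<in>A. f i) s \<le> ennpowr (ennreal (real (card A)) * m) s"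
    using s by (intro ennpowr_mono) (auto simp: ennreal_of_nat_eq_real_of_nat)
  also have "\<dots> = ennreal (real (card A) powr s) * ennpowr (f i) s"
    using s i by (simp add: ennpowr_mult ennpowr_ennreal)
  also have "\<dots> \<le> ennreal (real (card A) powr s) * (\<Sum>i\<in>A. ennpowr (f i) s)"
    using i A by (intro mult_left_mono member_le_sum) auto
  finally show ?thesis .
qed auto

text \<open>A weighted geometric mean lies below the maximum.\<close>

lemma ennpowr_mult_le_add:
  assumes "0 < \<theta>" "\<theta> < 1"
  shows "ennpowr x (1 - \<theta>) * ennpowr y \<theta> \<le> x + y"
proof -
  have "ennpowr x (1 - \<theta>) * ennpowr y \<theta> \<le> ennpowr (max x y) (1 - \<theta>) * ennpowr (max x y) \<theta>"
    using assms by (intro mult_mono ennpowr_mono) auto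
  also have "\<dots> = max x y"
    using assms ennpowr_add[of "1 - \<theta>" \<theta> "max x y"] by simp
  also have "\<dots> \<le> x + y" by (auto simp: max_def)
  finally show ?thesis .
qed

text \<open>Young's inequality with a free weight. Either \<open>y\<close> is below \<open>c\<close>
  times \<open>ennpowr x (p - 1)\<close> and the first term suffices, or \<open>x\<close> is
  controlled by a power of \<open>y\<close> and the second one does. The weight \<open>c\<close>
  will be chosen so that the dual term can be absorbed.\<close>

lemma ennpowr_young:
  assumes p: "1 < p" and c: "0 < c"
  shows "x * y \<le> ennreal c * ennpowr x p + ennreal (c powr (- 1 / (p - 1))) * ennpowr y (p / (p - 1))"
proof (cases "y \<le> ennreal c * ennpowr x (p - 1)")
  case True
  have "x * y \<le> x * (ennreal c * ennpowr x (p - 1))" by (intro mult_left_mono True) auto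
  also have "\<dots> = ennreal c * ennpowr x p"
    using p ennpowr_add[of 1 "p - 1" x] by (simp add: mult_ac)
  finally show ?thesis by (simp add: add_increasing2)
next
  case False
  let ?s = "1 / (p - 1)"
  have "ennpowr (ennreal c * ennpowr x (p - 1)) ?s \<le> ennpowr y ?s"
    using False p by (intro ennpowr_mono) auto
  moreover have "ennpowr (ennreal c * ennpowr x (p - 1)) ?s = ennreal (c powr ?s) * x"
    using c p by (simp add: ennpowr_mult ennpowr_ennreal ennpowr_ennpowr)
  ultimately have "ennreal (c powr (- ?s)) * (ennreal (c powr ?s) * x) \<le> ennreal (c powr (- ?s)) * ennpowr y ?s"
    by (intro mult_left_mono) auto
  moreover have "ennreal (c powr (- ?s)) * (ennreal (c powr ?s) * x) = x"
    using c by (simp add: mult.assoc[symmetric] ennreal_mult[symmetric] powr_add[symmetric])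
  ultimately have "x * y \<le> ennreal (c powr (- ?s)) * ennpowr y ?s * y"
    by (intro mult_right_mono) auto
  also have "\<dots> = ennreal (c powr (- ?s)) * ennpowr y (p / (p - 1))"
  proof -
    have "?s + 1 = p / (p - 1)" using p by (simp add: field_simps)
    then show ?thesis using p ennpowr_add[of ?s 1 y] by (simp add: mult.assoc)
  qed
  finally show ?thesis by (simp add: add_increasing)
qed

text \<open>Hoelder's inequality with exponents \<open>1 / (1 - \<theta>)\<close> and
  \<open>1 / \<theta>\<close>, in a form where both functions stand to the first power under their
  own integrals.\<close>

lemma nn_integral_ennpowr_mult_le:
  assumes [measurable]: "f \<in> borel_measurable M" "g \<in> borel_measurable M" and \<theta>: "0 < \<theta>" "\<theta> < 1"
  shows "(\<integral>\<^sup>+x. ennpowr (f x) (1 - \<theta>) * ennpowr (g x) \<theta> \<partial>M)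
    \<le> ennpowr (\<integral>\<^sup>+x. f x \<partial>M) (1 - \<theta>) * ennpowr (\<integral>\<^sup>+x. g x \<partial>M) \<theta>"
proof -
  let ?A = "\<integral>\<^sup>+x. f x \<partial>M" and ?B = "\<integral>\<^sup>+x. g x \<partial>M"
  consider "?A = 0 \<or> ?B = 0" | "?A \<noteq> 0" "?B \<noteq> 0" "?A = top \<or> ?B = top"
    | "?A \<noteq> 0" "?B \<noteq> 0" "?A \<noteq> top" "?B \<noteq> top" by blast
  then show ?thesis
  proof cases
    case 1
    then have "AE x in M. f x = 0 \<or> g x = 0"
      using nn_integral_0_iff_AE[of f M] nn_integral_0_iff_AE[of g M] by auto
    then have "(\<integral>\<^sup>+x. ennpowr (f x) (1 - \<theta>) * ennpowr (g x) \<theta> \<partial>M) = (\<integral>\<^sup>+x. 0 \<partial>M)"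
      by (intro nn_integral_cong_AE) auto
    then show ?thesis by simp
  next
    case 2
    then show ?thesis
      by (auto simp: ennreal_top_mult ennreal_mult_top ennpowr_eq_0_iff)
  next
    case 3
    then obtain A B where A: "?A = ennreal A" "0 < A" and B: "?B = ennreal B" "0 < B"
      by (metis ennreal_cases ennreal_0 ennreal_eq_0_iff not_less top_neq_ennreal linorder_not_le)
    \<comment> \<open>Weighted arithmetic-geometric mean inequality for the normalised functions
      \<open>f x / A\<close> and \<open>g x / B\<close>; after integration the bracket becomes
      \<open>(1 - \<theta>) + \<theta> = 1\<close>.\<close>
    have "ennpowr (f x) (1 - \<theta>) * ennpowr (g x) \<theta>
      \<le> ennreal (A powr (1 - \<theta>) * B powr \<theta>) * (ennreal ((1 - \<theta>) / A) * f x + ennreal (\<theta> / B) * g x)" for x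
    proof (cases "f x = top \<or> g x = top")
      case True
      moreover have "\<not> (1 - \<theta>) / A \<le> 0" "\<not> \<theta> / B \<le> 0" using A B \<theta> by (simp_all add: not_le)
      ultimately show ?thesis using A B \<theta>
        by (auto simp: ennreal_mult_top ennreal_top_mult ennreal_eq_0_iff mult_le_0_iff
            simp del: zero_less_divide_iff divide_le_0_iff)
    next
      case False
      then obtain u v where u: "f x = ennreal u" "0 \<le> u" and v: "g x = ennreal v" "0 \<le> v"
        by (metis ennreal_cases)
      have "u powr (1 - \<theta>) * v powr \<theta> \<le> A powr (1 - \<theta>) * B powr \<theta> * ((1 - \<theta>) / A * u + \<theta> / B * v)"
      proof -
        have "(u / A) powr (1 - \<theta>) * (v / B) powr \<theta> \<le> (1 - \<theta>) * (u / A) + \<theta> * (v / B)"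
          using Youngs_inequality_0[of "1 - \<theta>" \<theta> "u / A" "v / B"] \<theta> u v A B
          by (cases "u = 0 \<or> v = 0") auto
        then have "A powr (1 - \<theta>) * B powr \<theta> * ((u / A) powr (1 - \<theta>) * (v / B) powr \<theta>) \<le>
          A powr (1 - \<theta>) * B powr \<theta> * ((1 - \<theta>) * (u / A) + \<theta> * (v / B))"
          by (intro mult_left_mono) auto
        moreover have "A powr (1 - \<theta>) * B powr \<theta> * ((u / A) powr (1 - \<theta>) * (v / B) powr \<theta>)
           = u powr (1 - \<theta>) * v powr \<theta>"
          using A B u v by (simp add: powr_divide)
        ultimately show ?thesis by simp
      qed
      then show ?thesis
        using u v \<theta> A B by (simp add: ennpowr_ennreal ennreal_mult[symmetric] ennreal_plus[symmetric]
            del: ennreal_plus)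
    qed
    then have "(\<integral>\<^sup>+x. ennpowr (f x) (1 - \<theta>) * ennpowr (g x) \<theta> \<partial>M) \<le>
      (\<integral>\<^sup>+x. ennreal (A powr (1 - \<theta>) * B powr \<theta>) * (ennreal ((1 - \<theta>) / A) * f x + ennreal (\<theta> / B) * g x) \<partial>M)"
      by (intro nn_integral_mono)
    also have "\<dots> = ennreal (A powr (1 - \<theta>) * B powr \<theta>) * (ennreal ((1 - \<theta>) / A) * ennreal A + ennreal (\<theta> / B) * ennreal B)"
      by (simp add: nn_integral_cmult nn_integral_add A B)
    also have "\<dots> = ennreal (A powr (1 - \<theta>) * B powr \<theta>)"
      using A B \<theta> by (simp add: ennreal_mult[symmetric] ennreal_plus[symmetric] del: ennreal_plus)
    finally show ?thesis using A B by (simp add: ennpowr_ennreal ennreal_mult)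
  qed
qed

section \<open>The Hardy--Littlewood maximal theorem\<close>

definition maximal :: "('a::euclidean_space \<Rightarrow> ennreal) \<Rightarrow> 'a \<Rightarrow> ennreal" where
  "maximal w x = (SUP j::int. ennreal (2 powr (- (real_of_int j * DIM('a)))) *
     (\<integral>\<^sup>+y. w y * indicator (cball x (2 powr j)) y \<partial>lborel))"

lemma indicator_cball_measurable [measurable]:
  "(\<lambda>(x :: 'a::euclidean_space, y). indicator (cball x r) y :: ennreal) \<in> borel_measurable (borel \<Otimes>\<^sub>M borel)"
proof -
  have *: "(\<lambda>(x :: 'a, y). indicator (cball x r) y :: ennreal) = (\<lambda>p. if dist (fst p) (snd p) \<le> r then 1 else 0)"
    by (auto simp: fun_eq_iff indicator_def)
  have "continuous_on UNIV (\<lambda>p::'a \<times> 'a. dist (fst p) (snd p))" by (intro continuous_intros)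
  then have [measurable]: "(\<lambda>p::'a \<times> 'a. dist (fst p) (snd p)) \<in> borel_measurable (borel \<Otimes>\<^sub>M borel)"
    unfolding borel_prod by (rule borel_measurable_continuous_onI)
  show ?thesis unfolding * by measurable
qed

text \<open>Only the countably many dyadic radii enter. Compared with all radii this costs a
  constant factor, and it makes measurability immediate.\<close>

lemma maximal_measurable [measurable]:
  fixes w :: "'a::euclidean_space \<Rightarrow> ennreal"
  assumes [measurable]: "w \<in> borel_measurable borel"
  shows "maximal w \<in> borel_measurable borel"
  unfolding maximal_def by measurable

lemma maximal_mono: "(\<And>y. v y \<le> w y) \<Longrightarrow> maximal v x \<le> maximal w x"
  unfolding maximal_def
  by (intro SUP_mono') (auto intro!: mult_left_mono nn_integral_mono mult_right_mono)

lemma emeasure_cball_scale: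
  fixes c :: "'a::euclidean_space"
  assumes "0 \<le> r"
  shows "emeasure lborel (cball c r) = ennreal (unit_ball_vol DIM('a) * r ^ DIM('a))"
  using emeasure_cball[OF assms, of c] by simp

text \<open>Every point of the superlevel set is the centre of a ball, of some radius
  \<open>r\<close>, whose \<open>w\<close>-mass is at least \<open>l * r ^ DIM('a)\<close>. Vitali's
  covering lemma selects countably many disjoint ones whose fivefold enlargements cover the set;
  hence the factor \<open>5 ^ DIM('a)\<close>.\<close>

lemma maximal_weak_type:
  fixes w :: "'a::euclidean_space \<Rightarrow> ennreal"
  assumes [measurable]: "w \<in> borel_measurable borel" and l: "0 < l"
  shows "ennreal l * emeasure lborel {x. ennreal l < maximal w x}
    \<le> ennreal (unit_ball_vol DIM('a) * 5 ^ DIM('a)) * (\<integral>\<^sup>+y. w y \<partial>lborel)"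
proof (cases "(\<integral>\<^sup>+y. w y \<partial>lborel) = top")
  case True
  have "\<not> unit_ball_vol (real DIM('a)) * 5 ^ DIM('a) \<le> 0" by (simp add: not_le)
  then show ?thesis using True by (simp add: ennreal_mult_top ennreal_eq_0_iff del: mult_eq_0_iff)
next
  case False
  then obtain I where I: "(\<integral>\<^sup>+y. w y \<partial>lborel) = ennreal I" "0 \<le> I" by (metis ennreal_cases)
  let ?n = "DIM('a)"
  let ?v = "unit_ball_vol (real DIM('a))"
  define S where "S = {x. ennreal l < maximal w x}"
  have "\<exists>j::int. ennreal l < ennreal (2 powr (- (real_of_int j * DIM('a)))) *
     (\<integral>\<^sup>+y. w y * indicator (cball x (2 powr j)) y \<partial>lborel)" if "x \<in> S" for x
    using that unfolding S_def maximal_def less_SUP_iff by auto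
  then obtain j :: "'a \<Rightarrow> int" where j: "\<And>x. x \<in> S \<Longrightarrow> ennreal l < ennreal (2 powr (- (real_of_int (j x) * DIM('a)))) *
     (\<integral>\<^sup>+y. w y * indicator (cball x (2 powr (j x))) y \<partial>lborel)"
    by metis
  define r where "r x = 2 powr real_of_int (j x)" for x
  have r0: "0 < r x" for x by (simp add: r_def)
  have rn: "2 powr (- (real_of_int (j x) * DIM('a))) = inverse (r x ^ ?n)" for x
    by (simp add: r_def powr_minus powr_realpow[symmetric] powr_powr)
  have lr: "ennreal (l * r x ^ ?n) \<le> (\<integral>\<^sup>+y. w y * indicator (cball x (r x)) y \<partial>lborel)" if "x \<in> S" for x
  proof -
    have "ennreal (r x ^ ?n) * ennreal l \<le> ennreal (r x ^ ?n) * (ennreal (inverse (r x ^ ?n)) * (\<integral>\<^sup>+y. w y * indicator (cball x (r x)) y \<partial>lborel))"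
      using j[OF that] unfolding rn r_def[symmetric] by (intro mult_left_mono) auto
    then show ?thesis using r0[of x] l
      by (simp add: mult.assoc[symmetric] ennreal_mult[symmetric] mult.commute)
  qed
  \<comment> \<open>The covering lemma needs bounded radii. A ball of radius
    \<open>r x \<ge> 1\<close> carries mass at least \<open>l * r x\<close>, which cannot exceed the
    total mass \<open>I\<close>.\<close>
  have rB: "r x \<le> max 1 (I / l)" if "x \<in> S" for x
  proof -
    have "ennreal (l * r x ^ ?n) \<le> ennreal I"
      unfolding I(1)[symmetric] by (rule order.trans[OF lr[OF that]], rule nn_integral_mono) (auto simp: indicator_def)
    then have "r x ^ ?n \<le> I / l" using l I by (simp add: field_simps)
    moreover have "r x \<le> r x ^ ?n" if "1 \<le> r x" using that DIM_positive self_le_power by blast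
    ultimately show ?thesis by fastforce
  qed
  have cov: "S \<subseteq> (\<Union>i\<in>S. cball i (r i))"
  proof
    fix x assume "x \<in> S"
    then show "x \<in> (\<Union>i\<in>S. cball i (r i))"
      by (rule UN_I) (simp add: less_imp_le[OF r0])
  qed
  have rad: "0 < r i \<and> r i \<le> max 1 (I / l)" if "i \<in> S" for i using r0 rB[OF that] by simp
  obtain C where C: "countable C" "C \<subseteq> S" "pairwise (\<lambda>i j. disjnt (cball i (r i)) (cball j (r j))) C"
    "S \<subseteq> (\<Union>i\<in>C. cball i (5 * r i))"
  proof (rule Vitali_covering_lemma_cballs[where S=S and K=S and a="\<lambda>x. x" and r=r, OF cov rad])
  qed (assumption, rule that)
  have "emeasure lborel S \<le> (\<integral>\<^sup>+x. (\<integral>\<^sup>+i. indicator (cball i (5 * r i)) x \<partial>count_space C) \<partial>lborel)"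
  proof -
    have "emeasure lborel S = (\<integral>\<^sup>+x. indicator S x \<partial>lborel)"
      unfolding S_def by (intro nn_integral_indicator[symmetric]) measurable
    also have "\<dots> \<le> (\<integral>\<^sup>+x. (\<integral>\<^sup>+i. indicator (cball i (5 * r i)) x \<partial>count_space C) \<partial>lborel)"
    proof (rule nn_integral_mono)
      fix x
      show "indicator S x \<le> (\<integral>\<^sup>+i. indicator (cball i (5 * r i)) x \<partial>count_space C)"
      proof (cases "x \<in> S")
        case True
        then obtain i where "i \<in> C" "x \<in> cball i (5 * r i)" using C by auto
        then show ?thesis
          using nn_integral_ge_point[of i C "\<lambda>i. indicator (cball i (5 * r i)) x"] True by (simp add: indicator_def)
      qed auto
    qed
    finally show ?thesis .
  qed
  also have "\<dots> = (\<integral>\<^sup>+i. emeasure lborel (cball i (5 * r i)) \<partial>count_space C)"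
    using C by (subst nn_integral_count_space_nn_integral) auto
  finally have "ennreal l * emeasure lborel S \<le> ennreal l * (\<integral>\<^sup>+i. emeasure lborel (cball i (5 * r i)) \<partial>count_space C)"
    by (intro mult_left_mono) auto
  also have "\<dots> = (\<integral>\<^sup>+i. ennreal (?v * 5 ^ ?n) * ennreal (l * r i ^ ?n) \<partial>count_space C)"
    using l r0 by (subst nn_integral_cmult[symmetric])
      (auto intro!: nn_integral_cong simp: emeasure_cball_scale less_imp_le ennreal_mult[symmetric] power_mult_distrib mult_ac)
  also have "\<dots> \<le> (\<integral>\<^sup>+i. ennreal (?v * 5 ^ ?n) * (\<integral>\<^sup>+y. w y * indicator (cball i (r i)) y \<partial>lborel) \<partial>count_space C)"
    using lr C(2) by (intro nn_integral_mono mult_left_mono) auto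
  also have "\<dots> = ennreal (?v * 5 ^ ?n) * (\<integral>\<^sup>+i. (\<integral>\<^sup>+y. w y * indicator (cball i (r i)) y \<partial>lborel) \<partial>count_space C)"
    by (simp add: nn_integral_cmult)
  also have "(\<integral>\<^sup>+i. (\<integral>\<^sup>+y. w y * indicator (cball i (r i)) y \<partial>lborel) \<partial>count_space C)
     = (\<integral>\<^sup>+i. emeasure (density lborel w) (cball i (r i)) \<partial>count_space C)"
    by (simp add: emeasure_density)
  \<comment> \<open>The selected balls are disjoint, so their masses, read as values of the measure
    with density \<open>w\<close>, add up to at most the total mass.\<close>
  also have "\<dots> = emeasure (density lborel w) (\<Union>i\<in>C. cball i (r i))"
    using C by (subst emeasure_UN_countable) (auto simp: disjoint_family_on_def pairwise_def disjnt_def)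
  also have "\<dots> \<le> emeasure (density lborel w) (space (density lborel w))"
    by (rule emeasure_space)
  also have "\<dots> = (\<integral>\<^sup>+y. w y \<partial>lborel)" by (simp add: emeasure_density)
  finally show ?thesis unfolding S_def by (simp add: mult_left_mono)
qed

lemma maximal_add_le:
  fixes u w :: "'a::euclidean_space \<Rightarrow> ennreal"
  assumes [measurable]: "u \<in> borel_measurable borel" "w \<in> borel_measurable borel"
  shows "maximal (\<lambda>y. u y + w y) x \<le> maximal u x + maximal w x"
  unfolding maximal_def[of "\<lambda>y. u y + w y"]
proof (rule SUP_least)
  fix j :: int
  have "ennreal (2 powr (- (real_of_int j * DIM('a)))) * (\<integral>\<^sup>+y. (u y + w y) * indicator (cball x (2 powr j)) y \<partial>lborel)
    = ennreal (2 powr (- (real_of_int j * DIM('a)))) * (\<integral>\<^sup>+y. u y * indicator (cball x (2 powr j)) y \<partial>lborel)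
    + ennreal (2 powr (- (real_of_int j * DIM('a)))) * (\<integral>\<^sup>+y. w y * indicator (cball x (2 powr j)) y \<partial>lborel)"
    by (simp add: distrib_right distrib_left nn_integral_add)
  also have "\<dots> \<le> maximal u x + maximal w x"
    unfolding maximal_def by (intro add_mono SUP_upper) auto
  finally show "ennreal (2 powr (- (real_of_int j * DIM('a)))) * (\<integral>\<^sup>+y. (u y + w y) * indicator (cball x (2 powr j)) y \<partial>lborel)
    \<le> maximal u x + maximal w x" .
qed

text \<open>The averages are normalised by a power of the radius and not by the volume of the ball;
  this is why the volume of the unit ball appears.\<close>

lemma maximal_const:
  "maximal (\<lambda>y::'a::euclidean_space. c) x = c * ennreal (unit_ball_vol DIM('a))"
proof -
  have "ennreal (2 powr (- (real_of_int j * DIM('a)))) * (\<integral>\<^sup>+y. c * indicator (cball x (2 powr j)) y \<partial>lborel)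
    = c * ennreal (unit_ball_vol DIM('a))" for j :: int
  proof -
    have "2 powr (- (real_of_int j * DIM('a))) * (2 powr j) ^ DIM('a) = 1"
      by (simp add: powr_realpow[symmetric] powr_powr powr_add[symmetric])
    then have "ennreal (2 powr (- (real_of_int j * DIM('a)))) * ennreal (unit_ball_vol DIM('a) * (2 powr j) ^ DIM('a))
       = ennreal (unit_ball_vol DIM('a))"
      by (simp add: ennreal_mult[symmetric] mult_ac)
    then show ?thesis
      by (simp add: nn_integral_cmult emeasure_cball_scale mult_ac)
  qed
  then show ?thesis unfolding maximal_def by simp
qed

text \<open>The strict inequality stands on the left, so the integers \<open>i\<close> with
  \<open>2 powr i < r\<close> are exactly those up to the \<open>k\<close> obtained here.\<close>

lemma dyadic_floor:
  fixes r :: real assumes "0 < r"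
  obtains k :: int where "2 powr k < r" "r \<le> 2 powr (k + 1)"
proof
  let ?k = "\<lceil>log 2 r\<rceil> - 1"
  have "2 powr ?k < 2 powr (log 2 r)" by (rule powr_less_mono) linarith+
  then show "2 powr ?k < r" using assms by simp
  have "2 powr (log 2 r) \<le> 2 powr (?k + 1)" by (rule powr_mono) linarith+
  then show "r \<le> 2 powr (?k + 1)" using assms by simp
qed

text \<open>A discrete substitute for the layer-cake formula: for finite nonzero \<open>y\<close>
  the term of the highest level suffices, the offset 1 in the exponent making up for
  \<open>y\<close> lying above that level by a factor of up to 2. For infinite \<open>y\<close> all
  levels are present and the terms are unbounded.\<close>

lemma ennpowr_le_dyadic_sum:
  assumes p: "0 < p"
  shows "ennpowr y p \<le> (\<integral>\<^sup>+k. ennreal (2 powr ((real_of_int k + 1) * p)) *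
    indicator {k. ennreal (2 powr real_of_int k) < y} k \<partial>count_space UNIV)" (is "_ \<le> ?R")
proof (cases y)
  case (real r)
  show ?thesis
  proof (cases "r = 0")
    case False
    then obtain k :: int where k: "2 powr k < r" "r \<le> 2 powr (k + 1)"
      using dyadic_floor[of r] real by auto
    have ky: "ennreal (2 powr real_of_int k) < y" using k real by (simp add: ennreal_less_iff)
    have "ennpowr y p = ennreal (r powr p)" using real by (simp add: ennpowr_ennreal)
    also have "\<dots> \<le> ennreal (2 powr ((real_of_int k + 1) * p))"
      using powr_mono2[of p r "2 powr (real_of_int k + 1)"] k p real by (auto intro!: ennreal_leI simp: powr_powr)
    also have "\<dots> = ennreal (2 powr ((real_of_int k + 1) * p)) * indicator {k. ennreal (2 powr real_of_int k) < y} k"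
      using ky by simp
    also have "\<dots> \<le> ?R" by (rule nn_integral_ge_point) simp
    finally show ?thesis .
  qed (use real in simp)
next
  case top
  have "?R = top"
  proof (rule ccontr)
    assume "?R \<noteq> top"
    then obtain B where B: "?R = ennreal B" "0 \<le> B" by (rule ennreal_realE)
    obtain m :: nat where m: "log 2 (B + 1) / p < m" using reals_Archimedean2 by blast
    have "B + 1 = 2 powr (log 2 (B + 1))" using B by simp
    also have "\<dots> \<le> 2 powr ((real_of_int (int m) + 1) * p)"
      using m p by (intro powr_mono) (auto simp: field_simps)
    finally have "ennreal (B + 1) \<le> ennreal (2 powr ((real_of_int (int m) + 1) * p))
      * indicator {k. ennreal (2 powr real_of_int k) < y} (int m)"
      using top by (simp add: ennreal_leI)
    also have "\<dots> \<le> ?R" by (rule nn_integral_ge_point) simp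
    finally show False using B by (simp add: ennreal_le_iff2)
  qed
  then show ?thesis by simp
qed

text \<open>The levels below \<open>z\<close> form a geometric series of ratio
  \<open>2 powr (- s)\<close>, descending from the highest one.\<close>

lemma dyadic_sum_le_ennpowr:
  assumes s: "0 < s"
  shows "(\<integral>\<^sup>+k. ennreal (2 powr (real_of_int k * s)) *
    indicator {k. ennreal (2 powr real_of_int k) < z} k \<partial>count_space UNIV) \<le> ennreal (1 / (1 - 2 powr (- s))) * ennpowr z s"
    (is "?L \<le> ennreal ?c * _")
proof (cases z)
  case (real r)
  have c: "2 powr (- s) < 1" "0 < ?c" using s powr_less_one[of 2 "- s"] by auto
  show ?thesis
  proof (cases "r = 0")
    case False
    then obtain K :: int where K: "2 powr K < r" "r \<le> 2 powr (K + 1)"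
      using dyadic_floor[of r] real by auto
    have S: "{k. ennreal (2 powr real_of_int k) < z} = {..K}"
    proof (intro set_eqI iffI CollectI; simp)
      fix k :: int assume "ennreal (2 powr real_of_int k) < z"
      then have "2 powr real_of_int k < r" using real by (simp add: ennreal_less_iff)
      then have "2 powr real_of_int k < 2 powr real_of_int (K + 1)" using K by linarith
      then show "k \<le> K" by simp
    next
      fix k assume "k \<le> K"
      then have "2 powr real_of_int k \<le> 2 powr real_of_int K" by (intro powr_mono) auto
      then have "2 powr real_of_int k < r" using K by linarith
      then show "ennreal (2 powr real_of_int k) < z" using real by (simp add: ennreal_less_iff)
    qed
    have "?L = (\<integral>\<^sup>+k. ennreal (2 powr (real_of_int k * s)) \<partial>count_space {..K})"
      unfolding S by (subst nn_integral_count_space_indicator) auto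
    also have "\<dots> = (\<integral>\<^sup>+i. ennreal (2 powr (real_of_int (K - int i) * s)) \<partial>count_space UNIV)"
      by (rule nn_integral_bij_count_space[symmetric], rule bij_betwI[where g="\<lambda>k. nat (K - k)"]) auto
    also have "\<dots> = (\<Sum>i. ennreal (2 powr (real_of_int K * s) * (2 powr (- s)) ^ i))"
      by (simp add: nn_integral_count_space_nat powr_realpow[symmetric] powr_powr powr_add[symmetric] algebra_simps)
    also have "\<dots> = ennreal (2 powr (real_of_int K * s) * ?c)"
      using c by (intro suminf_ennreal_eq sums_mult geometric_sums) auto
    also have "\<dots> \<le> ennreal (r powr s * ?c)"
      using c K s powr_mono2[of s "2 powr real_of_int K" r]
      by (intro ennreal_leI mult_right_mono) (auto simp: powr_powr)
    also have "\<dots> = ennreal ?c * ennpowr z s"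
      using real c by (simp add: ennpowr_ennreal ennreal_mult[symmetric] mult.commute)
    finally show ?thesis .
  qed (use real in simp)
next
  case top
  have "\<not> ?c \<le> 0" using s powr_less_one[of 2 "- s"] by auto
  then show ?thesis using top by (simp add: ennreal_mult_top ennreal_eq_0_iff del: divide_le_0_iff)
qed

text \<open>Marcinkiewicz interpolation: at each level the part of \<open>w\<close> below a fixed
  multiple of the level is discarded, because its maximal function stays below half the level, and
  the weak-type estimate is applied to the rest.\<close>

theorem maximal_strong_type:
  assumes p: "1 < p"
  obtains C where "0 \<le> C" "\<And>w :: 'a::euclidean_space \<Rightarrow> ennreal. w \<in> borel_measurable borel \<Longrightarrow>
    (\<integral>\<^sup>+x. ennpowr (maximal w x) p \<partial>lborel) \<le> ennreal C * (\<integral>\<^sup>+x. ennpowr (w x) p \<partial>lborel)"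
proof -
  define v where "v = unit_ball_vol (real DIM('a))"
  have v: "0 < v" unfolding v_def by simp
  define A where "A = v * 5 ^ DIM('a)"
  have A: "0 \<le> A" using v by (simp add: A_def)
  define c where "c = 1 / (1 - 2 powr (- (p - 1)))"
  have c: "0 \<le> c" using p powr_less_one[of 2 "- (p - 1)"] by (simp add: c_def)
  define C where "C = A * 2 powr (p + 1) * c * (2 * v) powr (p - 1)"
  have "0 \<le> C" using A c by (simp add: C_def)
  moreover have "(\<integral>\<^sup>+x. ennpowr (maximal w x) p \<partial>lborel) \<le> ennreal C * (\<integral>\<^sup>+x. ennpowr (w x) p \<partial>lborel)"
    if [measurable]: "w \<in> borel_measurable borel" for w :: "'a \<Rightarrow> ennreal"
  proof -
    define S where "S k = {y. ennreal (2 powr real_of_int k) < ennreal (2 * v) * w y}" for k :: int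
    have [measurable]: "S k \<in> sets borel" for k unfolding S_def by measurable
    have weak: "ennreal (2 powr ((real_of_int k + 1) * p)) * emeasure lborel {x. ennreal (2 powr real_of_int k) < maximal w x}
      \<le> ennreal (A * 2 powr (p + 1)) * (\<integral>\<^sup>+y. ennreal (2 powr (real_of_int k * (p - 1))) * (w y * indicator (S k) y) \<partial>lborel)" (is "?l \<le> ?r") for k :: int
    proof -
      \<comment> \<open>Half of the level. The discarded part of \<open>w\<close> is at most
        \<open>l / v\<close>, so by \<open>maximal_const\<close> its maximal function is at most
        \<open>l\<close>, and the part on \<open>S k\<close> has to exceed the remaining
        \<open>l\<close>.\<close>
      define l where "l = 2 powr real_of_int k / 2"
      have l: "0 < l" by (simp add: l_def)
      have sub: "{x. ennreal (2 powr real_of_int k) < maximal w x} \<subseteq> {x. ennreal l < maximal (\<lambda>y. w y * indicator (S k) y) x}"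
      proof clarify
        fix x assume x: "ennreal (2 powr real_of_int k) < maximal w x"
        have "w y \<le> w y * indicator (S k) y + ennreal (l / v)" for y
        proof (cases "y \<in> S k")
          case False
          then have "ennreal (2 * v) * w y \<le> ennreal (2 powr real_of_int k)" by (simp add: S_def)
          then have "ennreal (1 / (2 * v)) * (ennreal (2 * v) * w y) \<le> ennreal (1 / (2 * v)) * ennreal (2 powr real_of_int k)"
            by (intro mult_left_mono) auto
          moreover have "ennreal (1 / (2 * v)) * (ennreal (2 * v) * w y) = w y"
            using v by (simp add: mult.assoc[symmetric] ennreal_mult[symmetric])
          moreover have "ennreal (1 / (2 * v)) * ennreal (2 powr real_of_int k) = ennreal (l / v)"
            using v by (simp add: ennreal_mult[symmetric] l_def)
          ultimately show ?thesis using False by simp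
        qed auto
        then have "maximal w x \<le> maximal (\<lambda>y. w y * indicator (S k) y + ennreal (l / v)) x"
          by (rule maximal_mono)
        also have "\<dots> \<le> maximal (\<lambda>y. w y * indicator (S k) y) x + maximal (\<lambda>y. ennreal (l / v)) x"
          by (rule maximal_add_le) auto
        also have "maximal (\<lambda>y. ennreal (l / v)) x = ennreal l"
          using v l by (simp add: maximal_const v_def[symmetric] ennreal_mult[symmetric])
        finally have "ennreal (2 powr real_of_int k) < maximal (\<lambda>y. w y * indicator (S k) y) x + ennreal l"
          using x by simp
        moreover have "ennreal (2 powr real_of_int k) = ennreal l + ennreal l"
          by (simp add: l_def ennreal_plus[symmetric] del: ennreal_plus)
        ultimately show "ennreal l < maximal (\<lambda>y. w y * indicator (S k) y) x"
          by (metis add.commute add_right_mono leD leI)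
      qed
      have "emeasure lborel {x. ennreal (2 powr real_of_int k) < maximal w x} \<le> emeasure lborel {x. ennreal l < maximal (\<lambda>y. w y * indicator (S k) y) x}"
        by (rule emeasure_mono[OF sub]) measurable
      then have "?l \<le> ennreal (2 powr ((real_of_int k + 1) * p)) * emeasure lborel {x. ennreal l < maximal (\<lambda>y. w y * indicator (S k) y) x}"
        by (intro mult_left_mono) auto
      also have "\<dots> = ennreal (2 powr ((real_of_int k + 1) * p) / l) * (ennreal l * emeasure lborel {x. ennreal l < maximal (\<lambda>y. w y * indicator (S k) y) x})"
        using l by (simp add: mult.assoc[symmetric] ennreal_mult[symmetric])
      also have "\<dots> \<le> ennreal (2 powr ((real_of_int k + 1) * p) / l) * (ennreal A * (\<integral>\<^sup>+y. w y * indicator (S k) y \<partial>lborel))"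
        unfolding A_def v_def by (intro mult_left_mono maximal_weak_type l) auto
      also have "\<dots> = ennreal (A * 2 powr (p + 1)) * (ennreal (2 powr (real_of_int k * (p - 1))) * (\<integral>\<^sup>+y. w y * indicator (S k) y \<partial>lborel))"
      proof -
        have "2 powr ((real_of_int k + 1) * p) / l = 2 powr (p + 1) * 2 powr (real_of_int k * (p - 1))"
          by (simp add: l_def powr_add powr_diff field_simps)
        then show ?thesis using A by (simp add: ennreal_mult mult_ac)
      qed
      also have "\<dots> = ?r" by (simp add: nn_integral_cmult)
      finally show ?thesis .
    qed
    have "(\<integral>\<^sup>+x. ennpowr (maximal w x) p \<partial>lborel) \<le>
      (\<integral>\<^sup>+x. (\<integral>\<^sup>+k. ennreal (2 powr ((real_of_int k + 1) * p)) *
        indicator {k. ennreal (2 powr real_of_int k) < maximal w x} k \<partial>count_space UNIV) \<partial>lborel)"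
      using p by (intro nn_integral_mono ennpowr_le_dyadic_sum) auto
    also have "\<dots> = (\<integral>\<^sup>+x. (\<integral>\<^sup>+k. ennreal (2 powr ((real_of_int k + 1) * p)) *
        indicator {x. ennreal (2 powr real_of_int k) < maximal w x} x \<partial>count_space UNIV) \<partial>lborel)"
      by (simp add: indicator_def)
    also have "\<dots> = (\<integral>\<^sup>+k. (\<integral>\<^sup>+x. ennreal (2 powr ((real_of_int k + 1) * p)) *
        indicator {x. ennreal (2 powr real_of_int k) < maximal w x} x \<partial>lborel) \<partial>count_space UNIV)"
      by (rule nn_integral_count_space_nn_integral) auto
    also have "\<dots> = (\<integral>\<^sup>+k. ennreal (2 powr ((real_of_int k + 1) * p)) *
        emeasure lborel {x. ennreal (2 powr real_of_int k) < maximal w x} \<partial>count_space UNIV)"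
      by (subst nn_integral_cmult_indicator) auto
    also have "\<dots> \<le> (\<integral>\<^sup>+k. ennreal (A * 2 powr (p + 1)) * (\<integral>\<^sup>+y. ennreal (2 powr (real_of_int k * (p - 1))) * (w y * indicator (S k) y) \<partial>lborel) \<partial>count_space UNIV)"
      by (intro nn_integral_mono weak)
    also have "\<dots> = ennreal (A * 2 powr (p + 1)) * (\<integral>\<^sup>+y. (\<integral>\<^sup>+k. ennreal (2 powr (real_of_int k * (p - 1))) * (w y * indicator (S k) y) \<partial>count_space UNIV) \<partial>lborel)"
      by (subst nn_integral_count_space_nn_integral) (auto simp: nn_integral_cmult)
    \<comment> \<open>For fixed \<open>y\<close> only the levels with
      \<open>2 powr k < 2 * v * w y\<close> contribute. As \<open>p - 1\<close> is positive, their
      sum is geometric and yields the power \<open>p - 1\<close> of \<open>w y\<close>, which the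
      remaining factor \<open>w y\<close> raises to \<open>p\<close>.\<close>
    also have "\<dots> \<le> ennreal (A * 2 powr (p + 1)) * (\<integral>\<^sup>+y. ennreal (c * (2 * v) powr (p - 1)) * ennpowr (w y) p \<partial>lborel)"
    proof (intro mult_left_mono nn_integral_mono)
      fix y
      have "(\<integral>\<^sup>+k. ennreal (2 powr (real_of_int k * (p - 1))) * (w y * indicator (S k) y) \<partial>count_space UNIV)
         = w y * (\<integral>\<^sup>+k. ennreal (2 powr (real_of_int k * (p - 1))) *
           indicator {k. ennreal (2 powr real_of_int k) < ennreal (2 * v) * w y} k \<partial>count_space UNIV)"
        by (subst nn_integral_cmult[symmetric]) (auto intro!: nn_integral_cong simp: S_def indicator_def mult_ac)
      also have "\<dots> \<le> w y * (ennreal c * ennpowr (ennreal (2 * v) * w y) (p - 1))"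
        unfolding c_def using p by (intro mult_left_mono dyadic_sum_le_ennpowr) auto
      also have "\<dots> = ennreal (c * (2 * v) powr (p - 1)) * (w y * ennpowr (w y) (p - 1))"
      proof -
        have "ennpowr (ennreal (2 * v) * w y) (p - 1) = ennreal ((2 * v) powr (p - 1)) * ennpowr (w y) (p - 1)"
          using p v ennpowr_mult[of "p - 1" "ennreal (2 * v)" "w y"] ennpowr_ennreal[of "2 * v" "p - 1"] by simp
        then show ?thesis using c by (simp add: ennreal_mult mult_ac)
      qed
      also have "w y * ennpowr (w y) (p - 1) = ennpowr (w y) p"
        using p ennpowr_add[of 1 "p - 1" "w y"] by simp
      finally show "(\<integral>\<^sup>+k. ennreal (2 powr (real_of_int k * (p - 1))) * (w y * indicator (S k) y) \<partial>count_space UNIV)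
        \<le> ennreal (c * (2 * v) powr (p - 1)) * ennpowr (w y) p" .
    qed auto
    also have "\<dots> = ennreal C * (\<integral>\<^sup>+x. ennpowr (w x) p \<partial>lborel)"
      using A c by (subst nn_integral_cmult) (auto simp: C_def ennreal_mult mult_ac)
    finally show ?thesis .
  qed
  ultimately show ?thesis by (rule that)
qed

section \<open>Positive kernels and their vector-valued inequality\<close>

definition decay_kernel :: "real \<Rightarrow> 'a::euclidean_space \<Rightarrow> real" where
  "decay_kernel t z = t ^ DIM('a) / (1 + t * norm z) ^ (DIM('a) + 1)"

definition kernel_op :: "real \<Rightarrow> ('a::euclidean_space \<Rightarrow> ennreal) \<Rightarrow> 'a \<Rightarrow> ennreal" where
  "kernel_op t w x = (\<integral>\<^sup>+y. ennreal (decay_kernel t (x - y)) * w y \<partial>lborel)"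

lemma decay_kernel_nonneg: "0 \<le> t \<Longrightarrow> 0 \<le> decay_kernel t z"
  by (simp add: decay_kernel_def)

lemma decay_kernel_measurable [measurable]: "decay_kernel t \<in> borel_measurable borel"
  unfolding decay_kernel_def by measurable

lemma kernel_op_measurable [measurable]:
  fixes w :: "'a::euclidean_space \<Rightarrow> ennreal"
  assumes [measurable]: "w \<in> borel_measurable borel"
  shows "kernel_op t w \<in> borel_measurable borel"
  unfolding kernel_op_def by measurable

text \<open>\<open>2 powr (k + 1)\<close> is the dyadic radius next to the width
  \<open>1 / t\<close> of the kernel. In the shell of radius \<open>2 powr (k + 1 + i)\<close> the
  kernel is bounded by the normalising factor of that ball times \<open>(1/2) ^ i\<close>, up to a
  constant; one of its \<open>DIM('a) + 1\<close> powers of decay is spent on this gain.\<close>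

lemma decay_kernel_le_dyadic:
  fixes z :: "'a::euclidean_space"
  assumes t: "0 < t" and k: "2 powr real_of_int k < 1 / t" "1 / t \<le> 2 powr (real_of_int k + 1)"
  obtains i :: nat where "norm z \<le> 2 powr real_of_int (k + 1 + int i)"
    "decay_kernel t z \<le> 2 ^ (2 * DIM('a) + 1) * (1/2) ^ i * 2 powr (- (real_of_int (k + 1 + int i) * DIM('a)))"
proof -
  let ?n = "DIM('a)"
  have tk: "t \<le> 2 * 2 powr (- real_of_int (k + 1))" "2 powr (- real_of_int (k + 1)) \<le> t"
    using k t by (simp_all add: powr_minus powr_add powr_diff divide_simps mult_ac)
  have tn: "t ^ ?n \<le> 2 ^ ?n * 2 powr (- (real_of_int (k + 1) * ?n))"
  proof -
    have "t ^ ?n \<le> (2 * 2 powr (- real_of_int (k + 1))) ^ ?n" using tk t by (intro power_mono) auto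
    then show ?thesis by (simp add: power_mult_distrib powr_realpow[symmetric] powr_powr algebra_simps)
  qed
  show ?thesis
  proof (cases "norm z \<le> 2 powr real_of_int (k + 1)")
    case True
    have "decay_kernel t z \<le> t ^ ?n / 1"
      unfolding decay_kernel_def using t by (intro divide_left_mono one_le_power) (auto simp: add_pos_nonneg)
    also have "\<dots> \<le> 2 ^ ?n * 2 powr (- (real_of_int (k + 1) * ?n))" using tn by simp
    also have "\<dots> \<le> 2 ^ (2 * ?n + 1) * 2 powr (- (real_of_int (k + 1) * ?n))"
      by (intro mult_right_mono power_increasing) auto
    finally show ?thesis using True by (intro that[of 0]) auto
  next
    case False
    then have "0 < norm z" using powr_ge_zero[of 2 "real_of_int (k + 1)"] by linarith
    then obtain m :: int where m: "2 powr m < norm z" "norm z \<le> 2 powr (m + 1)"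
      using dyadic_floor by blast
    have "2 powr real_of_int (k + 1) < 2 powr real_of_int (m + 1)" using False m by linarith
    then have km: "k + 1 \<le> m" by simp
    \<comment> \<open>Then \<open>k + 1 + i = m + 1\<close>, the smallest dyadic exponent whose ball
      contains \<open>z\<close>, and \<open>t * norm z\<close> is at least
      \<open>2 powr (i - 1)\<close>.\<close>
    define i where "i = nat (m - k)"
    have i: "int i = m - k" using km by (simp add: i_def)
    have "2 powr (real i - 1) = 2 powr (- real_of_int (k + 1)) * 2 powr real_of_int m"
    proof -
      have "real i = real_of_int (int i)" by (rule of_int_of_nat_eq[symmetric])
      then have "real i - 1 = - real_of_int (k + 1) + real_of_int m" unfolding i by simp
      then show ?thesis by (simp only: powr_add)
    qed
    also have "\<dots> \<le> t * norm z" using tk m t by (intro mult_mono) auto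
    finally have tz: "2 powr (real i - 1) \<le> 1 + t * norm z" by simp
    have "decay_kernel t z \<le> (2 ^ ?n * 2 powr (- (real_of_int (k + 1) * ?n))) / (2 powr (real i - 1)) ^ (?n + 1)"
      unfolding decay_kernel_def using tz tn t by (intro frac_le power_mono) auto
    also have "\<dots> = 2 ^ (2 * ?n + 1) * (1/2) ^ i * 2 powr (- (real_of_int (k + 1 + int i) * ?n))"
    proof -
      have "(2 powr (real i - 1)) ^ (?n + 1) = 2 powr ((real i - 1) * real (?n + 1))"
        using powr_realpow[of "2 powr (real i - 1)" "?n + 1"] by (simp only: powr_powr) simp
      moreover have "(1/2 :: real) ^ i = 2 powr (- real i)"
        by (simp add: powr_minus powr_realpow power_divide field_simps)
      ultimately show ?thesis
        by (simp only: powr_realpow[symmetric, of 2] zero_less_numeral powr_add[symmetric] powr_diff[symmetric])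
           (simp add: algebra_simps)
    qed
    finally show ?thesis using m i by (intro that[of i]) (auto simp: add.commute)
  qed
qed

text \<open>Summed over the shells, the kernel is dominated by a convergent combination of averages
  over balls; the geometric series contributes the last factor 2 of the constant.\<close>

lemma kernel_op_le_maximal:
  fixes w :: "'a::euclidean_space \<Rightarrow> ennreal"
  assumes [measurable]: "w \<in> borel_measurable borel" and t: "0 < t"
  shows "kernel_op t w x \<le> ennreal (2 ^ (2 * DIM('a) + 2)) * maximal w x"
proof -
  let ?n = "DIM('a)"
  obtain k :: int where k: "2 powr real_of_int k < 1 / t" "1 / t \<le> 2 powr (real_of_int k + 1)"
    using dyadic_floor[of "1 / t"] t by auto
  define f where "f i y = ennreal (2 ^ (2 * ?n + 1) * (1/2) ^ i) *
     (ennreal (2 powr (- (real_of_int (k + 1 + int i) * ?n))) * (w y * indicator (cball x (2 powr real_of_int (k + 1 + int i))) y))" for i :: nat and y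
  have [measurable]: "f i \<in> borel_measurable borel" for i unfolding f_def by measurable
  have "ennreal (decay_kernel t (x - y)) * w y \<le> (\<Sum>i. f i y)" for y
  proof -
    obtain i where i: "norm (x - y) \<le> 2 powr real_of_int (k + 1 + int i)"
      "decay_kernel t (x - y) \<le> 2 ^ (2 * ?n + 1) * (1/2) ^ i * 2 powr (- (real_of_int (k + 1 + int i) * ?n))"
      using decay_kernel_le_dyadic[OF t k] by blast
    have "ennreal (decay_kernel t (x - y)) * w y \<le> ennreal (2 ^ (2 * ?n + 1) * (1/2) ^ i * 2 powr (- (real_of_int (k + 1 + int i) * ?n))) * w y"
      by (intro mult_right_mono ennreal_leI i) auto
    also have "\<dots> = f i y"
      using i(1) by (simp add: f_def dist_norm ennreal_mult mult_ac)
    also have "\<dots> \<le> (\<Sum>i. f i y)"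
      using sum_le_suminf[of "\<lambda>i. f i y" "{i}"] by simp
    finally show ?thesis .
  qed
  then have "kernel_op t w x \<le> (\<integral>\<^sup>+y. (\<Sum>i. f i y) \<partial>lborel)"
    unfolding kernel_op_def by (rule nn_integral_mono)
  also have "\<dots> = (\<Sum>i. \<integral>\<^sup>+y. f i y \<partial>lborel)" by (rule nn_integral_suminf) measurable
  also have "\<dots> \<le> (\<Sum>i. ennreal (2 ^ (2 * ?n + 1) * (1/2) ^ i) * maximal w x)"
  proof (rule suminf_le)
    fix i
    show "(\<integral>\<^sup>+y. f i y \<partial>lborel) \<le> ennreal (2 ^ (2 * ?n + 1) * (1/2) ^ i) * maximal w x"
      unfolding f_def maximal_def
      by (subst nn_integral_cmult, measurable, subst nn_integral_cmult, measurable)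
         (intro mult_left_mono SUP_upper, auto)
  qed auto
  also have "\<dots> = (\<Sum>i. ennreal (2 ^ (2 * ?n + 1) * (1/2) ^ i)) * maximal w x"
    by simp
  also have "(\<Sum>i. ennreal (2 ^ (2 * ?n + 1) * (1/2) ^ i)) = ennreal (2 ^ (2 * ?n + 1) * (1 / (1 - 1/2)))"
    by (intro suminf_ennreal_eq sums_mult geometric_sums) auto
  finally show ?thesis by simp
qed

text \<open>The kernel bound with \<open>t = 1\<close>, applied to the constant function 1 with its
  finite maximal function, replaces a computation in polar coordinates.\<close>

lemma integrable_decay:
  "integrable lborel (\<lambda>x::'a::euclidean_space. 1 / (1 + norm x) ^ (DIM('a) + 1))"
proof (rule integrableI_bounded)
  have "kernel_op 1 (\<lambda>_. 1) (0::'a) < top"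
    using kernel_op_le_maximal[of "\<lambda>_. 1" 1 "0::'a"]
    by (simp add: maximal_const ennreal_mult_less_top order.strict_trans1)
  then show "(\<integral>\<^sup>+x. ennreal (norm (1 / (1 + norm (x::'a)) ^ (DIM('a) + 1))) \<partial>lborel) < \<infinity>"
    by (simp add: kernel_op_def decay_kernel_def)
qed measurable

text \<open>Tonelli's theorem; the kernel depends only on the norm, so it is symmetric in its two
  points.\<close>

lemma kernel_op_symmetric:
  fixes h w :: "'a::euclidean_space \<Rightarrow> ennreal"
  assumes [measurable]: "h \<in> borel_measurable borel" "w \<in> borel_measurable borel"
  shows "(\<integral>\<^sup>+x. kernel_op t h x * w x \<partial>lborel) = (\<integral>\<^sup>+x. h x * kernel_op t w x \<partial>lborel)"
proof -
  have "(\<integral>\<^sup>+x. kernel_op t h x * w x \<partial>lborel) =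
    (\<integral>\<^sup>+x. (\<integral>\<^sup>+y. ennreal (decay_kernel t (x - y)) * h y * w x \<partial>lborel) \<partial>lborel)"
    by (simp add: kernel_op_def nn_integral_multc)
  also have "\<dots> = (\<integral>\<^sup>+y. (\<integral>\<^sup>+x. ennreal (decay_kernel t (x - y)) * h y * w x \<partial>lborel) \<partial>lborel)"
    by (rule lborel_pair.Fubini') measurable
  also have "\<dots> = (\<integral>\<^sup>+y. (\<integral>\<^sup>+x. h y * (ennreal (decay_kernel t (y - x)) * w x) \<partial>lborel) \<partial>lborel)"
    by (intro nn_integral_cong) (simp add: decay_kernel_def norm_minus_commute mult_ac)
  also have "\<dots> = (\<integral>\<^sup>+x. h x * kernel_op t w x \<partial>lborel)"
    by (simp add: kernel_op_def nn_integral_cmult)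
  finally show ?thesis .
qed

text \<open>Truncation in height and in space makes integrals of powers finite, so that they may be
  absorbed; monotone convergence removes it again.\<close>

lemma ennpowr_truncation_SUP:
  fixes F :: "'a::euclidean_space \<Rightarrow> ennreal"
  assumes "0 < p"
  shows "(SUP m::nat. ennpowr (min (F x) (of_nat m)) p * indicator (ball 0 (real m)) x) = ennpowr (F x) p"
proof -
  have "F x \<le> (SUP m::nat. min (F x) (of_nat m) * indicator (ball 0 (real m)) x)"
    unfolding le_SUP_iff
  proof (intro allI impI)
    fix y assume y: "y < F x"
    then have "y \<noteq> top" by auto
    then obtain r where r: "y = ennreal r" "0 \<le> r" by (rule ennreal_realE)
    obtain m :: nat where m: "max r (norm x) < real m" using reals_Archimedean2 by blast
    then have "y < of_nat m" using r by (simp add: ennreal_of_nat_eq_real_of_nat ennreal_lessI)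
    then show "\<exists>m\<in>UNIV. y < min (F x) (of_nat m) * indicator (ball 0 (real m)) x"
      using y m by (intro bexI[of _ m]) auto
  qed
  moreover have "(SUP m::nat. min (F x) (of_nat m) * indicator (ball 0 (real m)) x) \<le> F x"
    by (rule SUP_least) (auto simp: indicator_def)
  ultimately have "F x = (SUP m::nat. min (F x) (of_nat m) * indicator (ball 0 (real m)) x)"
    by (rule antisym)
  then have "ennpowr (F x) p = (SUP m::nat. ennpowr (min (F x) (of_nat m) * indicator (ball 0 (real m)) x) p)"
    using ennpowr_SUP[OF assms] by metis
  also have "\<dots> = (SUP m::nat. ennpowr (min (F x) (of_nat m)) p * indicator (ball 0 (real m)) x)"
    by (intro SUP_cong) (auto simp: indicator_def)
  finally show ?thesis ..
qed

text \<open>The operators \<open>kernel_op t\<close> are self-adjoint, so the \<open>L\<^sup>p\<close> bound follows by testing against powers of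
  (truncations of) the left-hand side and the maximal inequality with the conjugate exponent.\<close>

lemma kernel_op_sum_bound:
  assumes p: "1 < p"
  obtains C where "0 \<le> C" "\<And>(K :: 'i set) t (h :: 'i \<Rightarrow> 'a::euclidean_space \<Rightarrow> ennreal).
    finite K \<Longrightarrow> (\<And>k. k \<in> K \<Longrightarrow> 0 < t k) \<Longrightarrow> (\<And>k. k \<in> K \<Longrightarrow> h k \<in> borel_measurable borel) \<Longrightarrow>
    (\<integral>\<^sup>+x. ennpowr (\<Sum>k\<in>K. kernel_op (t k) (h k) x) p \<partial>lborel)
      \<le> ennreal C * (\<integral>\<^sup>+x. ennpowr (\<Sum>k\<in>K. h k x) p \<partial>lborel)"
proof -
  define p' where "p' = p / (p - 1)"
  have p': "1 < p'" using p by (simp add: p'_def field_simps)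
  obtain B where B: "0 \<le> B" "\<And>w :: 'a \<Rightarrow> ennreal. w \<in> borel_measurable borel \<Longrightarrow>
    (\<integral>\<^sup>+x. ennpowr (maximal w x) p' \<partial>lborel) \<le> ennreal B * (\<integral>\<^sup>+x. ennpowr (w x) p' \<partial>lborel)"
    using maximal_strong_type[OF p'] by blast
  define A :: real where "A = 2 ^ (2 * DIM('a) + 2)"
  have A: "0 < A" by (simp add: A_def)
  \<comment> \<open>The weight in Young's inequality, chosen so that
    \<open>c powr (- 1 / (p - 1))\<close> equals \<open>1 / (2 * A * (B + 1))\<close> and the dual
    term receives a factor of at most \<open>1 / 2\<close>.\<close>
  define c where "c = (2 * A * (B + 1)) powr (p - 1)"
  have c: "0 < c" using A B by (simp add: c_def)
  have cB: "A * c powr (- 1 / (p - 1)) * B \<le> 1 / 2"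
  proof -
    have "c powr (- 1 / (p - 1)) = 1 / (2 * A * (B + 1))"
    proof -
      have "(p - 1) * (- 1 / (p - 1)) = - 1" using p by simp
      moreover have "0 < 2 * A * (B + 1)" using A B by simp
      ultimately show ?thesis by (simp only: c_def powr_powr powr_minus inverse_eq_divide) simp
    qed
    then have "A * c powr (- 1 / (p - 1)) * B = A * (1 / (2 * A * (B + 1))) * B" by (simp only:)
    also have "\<dots> = B / (2 * (B + 1))" using A by simp
    finally have "A * c powr (- 1 / (p - 1)) * B = B / (2 * (B + 1))" .
    then show ?thesis using B by (simp add: divide_le_eq)
  qed
  have "0 \<le> 2 * A * c" using A c by simp
  moreover have "(\<integral>\<^sup>+x. ennpowr (\<Sum>k\<in>K. kernel_op (t k) (h k) x) p \<partial>lborel)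
      \<le> ennreal (2 * A * c) * (\<integral>\<^sup>+x. ennpowr (\<Sum>k\<in>K. h k x) p \<partial>lborel)"
    if K: "finite K" and t: "\<And>k. k \<in> K \<Longrightarrow> 0 < t k" and h[measurable]: "\<And>k. k \<in> K \<Longrightarrow> h k \<in> borel_measurable borel"
    for K :: "'i set" and t and h :: "'i \<Rightarrow> 'a \<Rightarrow> ennreal"
  proof -
    define F where "F x = (\<Sum>k\<in>K. kernel_op (t k) (h k) x)" for x
    define H where "H x = (\<Sum>k\<in>K. h k x)" for x
    have [measurable]: "F \<in> borel_measurable borel" "H \<in> borel_measurable borel"
      unfolding F_def H_def using h by measurable
    define Y where "Y = (\<integral>\<^sup>+x. ennpowr (H x) p \<partial>lborel)"
    define X where "X m = (\<integral>\<^sup>+x. ennpowr (min (F x) (of_nat m)) p * indicator (ball 0 (real m)) x \<partial>lborel)" for m :: nat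
    have X: "X m \<le> ennreal (2 * A * c) * Y" for m
    proof -
      \<comment> \<open>The test function of the duality argument: the truncated \<open>F\<close> to
        the power \<open>p - 1\<close>, whose power with the conjugate exponent is the integrand of
        \<open>X m\<close> again.\<close>
      define w where "w x = ennpowr (min (F x) (of_nat m)) (p - 1) * indicator (ball 0 (real m)) x" for x
      have [measurable]: "w \<in> borel_measurable borel"
        unfolding w_def by (intro borel_measurable_times_ennreal borel_measurable_indicator) measurable
      have "X m \<le> (\<integral>\<^sup>+x. ennreal (real m powr p) * indicator (ball (0::'a) (real m)) x \<partial>lborel)"
        unfolding X_def
      proof (intro nn_integral_mono mult_right_mono)
        fix x
        have "ennpowr (min (F x) (of_nat m)) p \<le> ennpowr (ennreal (real m)) p"
          using p by (intro ennpowr_mono) (auto simp: ennreal_of_nat_eq_real_of_nat)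
        then show "ennpowr (min (F x) (of_nat m)) p \<le> ennreal (real m powr p)" by (simp add: ennpowr_ennreal)
      qed auto
      also have "\<dots> = ennreal (real m powr p) * emeasure lborel (ball (0::'a) (real m))"
        by (rule nn_integral_cmult_indicator) simp
      also have "\<dots> < top"
        using emeasure_bounded_finite[OF bounded_ball, of "0::'a" "real m"] by (simp add: ennreal_mult_less_top)
      \<comment> \<open>Finiteness is what later allows \<open>1 / 2 * X m\<close> to be subtracted
        from both sides.\<close>
      finally have fin: "X m < top" .
      have wp': "ennpowr (w x) p' = ennpowr (min (F x) (of_nat m)) p * indicator (ball 0 (real m)) x" for x
      proof -
        have "(p - 1) * p' = p" using p by (simp add: p'_def)
        then show ?thesis using p' by (simp add: w_def ennpowr_mult ennpowr_ennpowr indicator_def)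
      qed
      have "X m \<le> (\<integral>\<^sup>+x. F x * w x \<partial>lborel)"
        unfolding X_def
      proof (rule nn_integral_mono)
        fix x
        let ?m = "min (F x) (of_nat m)"
        have "ennpowr ?m p = ?m * ennpowr ?m (p - 1)" using p ennpowr_add[of 1 "p - 1" ?m] by simp
        also have "\<dots> \<le> F x * ennpowr ?m (p - 1)" by (intro mult_right_mono) auto
        finally show "ennpowr ?m p * indicator (ball 0 (real m)) x \<le> F x * w x"
          by (auto simp: w_def indicator_def)
      qed
      also have "\<dots> = (\<Sum>k\<in>K. (\<integral>\<^sup>+x. kernel_op (t k) (h k) x * w x \<partial>lborel))"
        using h by (simp add: F_def sum_distrib_right nn_integral_sum)
      also have "\<dots> = (\<Sum>k\<in>K. (\<integral>\<^sup>+x. h k x * kernel_op (t k) w x \<partial>lborel))"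
        using h by (intro sum.cong refl kernel_op_symmetric) auto
      also have "\<dots> \<le> (\<Sum>k\<in>K. (\<integral>\<^sup>+x. h k x * (ennreal A * maximal w x) \<partial>lborel))"
        unfolding A_def using t by (intro sum_mono nn_integral_mono mult_left_mono kernel_op_le_maximal) auto
      also have "\<dots> = (\<integral>\<^sup>+x. ennreal A * (H x * maximal w x) \<partial>lborel)"
        using h by (subst nn_integral_sum[symmetric]) (auto simp: H_def sum_distrib_left sum_distrib_right mult_ac)
      also have "\<dots> \<le> (\<integral>\<^sup>+x. ennreal A * (ennreal c * ennpowr (H x) p + ennreal (c powr (- 1 / (p - 1))) * ennpowr (maximal w x) p') \<partial>lborel)"
        unfolding p'_def by (intro nn_integral_mono mult_left_mono ennpowr_young p c) auto
      also have "\<dots> = ennreal A * (ennreal c * Y + ennreal (c powr (- 1 / (p - 1))) * (\<integral>\<^sup>+x. ennpowr (maximal w x) p' \<partial>lborel))"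
        by (simp add: nn_integral_cmult nn_integral_add Y_def)
      also have "\<dots> \<le> ennreal A * (ennreal c * Y + ennreal (c powr (- 1 / (p - 1))) * (ennreal B * (\<integral>\<^sup>+x. ennpowr (w x) p' \<partial>lborel)))"
        by (intro mult_left_mono add_left_mono B(2)) auto
      also have "(\<integral>\<^sup>+x. ennpowr (w x) p' \<partial>lborel) = X m"
        by (simp add: X_def wp')
      also have "ennreal A * (ennreal c * Y + ennreal (c powr (- 1 / (p - 1))) * (ennreal B * X m))
        = ennreal (A * c) * Y + ennreal (A * c powr (- 1 / (p - 1)) * B) * X m"
        using A B c by (simp add: distrib_left ennreal_mult mult.assoc)
      also have "\<dots> \<le> ennreal (A * c) * Y + ennreal (1 / 2) * X m"
        by (intro add_left_mono mult_right_mono ennreal_leI cB) auto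
      finally have main: "X m \<le> ennreal (A * c) * Y + ennreal (1 / 2) * X m" .
      show ?thesis
      proof (cases "Y = top")
        case True
        have "\<not> 2 * A * c \<le> 0" using A c by (simp add: not_le)
        then show ?thesis using True by (simp add: ennreal_mult_top ennreal_eq_0_iff del: mult_eq_0_iff)
      next
        case False
        then obtain y where y: "Y = ennreal y" "0 \<le> y" by (rule ennreal_realE)
        obtain r where r: "X m = ennreal r" "0 \<le> r" by (rule ennreal_realE[OF less_imp_neq[OF fin]])
        have "ennreal r \<le> ennreal (A * c * y + 1 / 2 * r)"
          using main A c y r by (simp only: ennreal_mult ennreal_plus mult_nonneg_nonneg less_imp_le divide_nonneg_nonneg zero_le_numeral zero_le_one)
        then have "r \<le> A * c * y + 1 / 2 * r" using A c y r by (subst (asm) ennreal_le_iff) auto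
        then have "ennreal r \<le> ennreal (2 * A * c * y)" by (intro ennreal_leI) simp
        then show ?thesis using y r A c by (simp add: ennreal_mult)
      qed
    qed
    have "(\<integral>\<^sup>+x. ennpowr (F x) p \<partial>lborel) = (\<integral>\<^sup>+x. (SUP m::nat. ennpowr (min (F x) (of_nat m)) p * indicator (ball 0 (real m)) x) \<partial>lborel)"
      using p by (simp add: ennpowr_truncation_SUP)
    also have "\<dots> = (SUP m. X m)"
      unfolding X_def
    proof (rule nn_integral_monotone_convergence_SUP)
      show "incseq (\<lambda>m x. ennpowr (min (F x) (of_nat m)) p * indicator (ball 0 (real m)) x)"
        using p by (auto simp: incseq_def le_fun_def indicator_def intro!: ennpowr_mono min.mono)
    qed (intro borel_measurable_times_ennreal borel_measurable_indicator, measurable)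
    also have "\<dots> \<le> ennreal (2 * A * c) * Y" by (intro SUP_least X)
    finally show ?thesis unfolding F_def Y_def H_def .
  qed
  ultimately show ?thesis by (rule that)
qed

text \<open>Interpolation between \<open>l\<^sup>1\<close> (by duality) and \<open>l\<^sup>\<infinity>\<close> (by the maximal function): with \<open>G\<close> the \<open>l\<^sup>q\<close>-norm of the
  \<open>g k\<close>, write \<open>g k = G powr (1 - 1 / q) * h k powr (1 / q)\<close> where the \<open>h k\<close> add up to \<open>G\<close>, and apply
  Hoelder's inequality inside each \<open>kernel_op\<close>.\<close>

theorem kernel_op_vector_bound:
  assumes p: "1 < p" and q: "1 < q"
  obtains C where "0 \<le> C" "\<And>(K :: 'i set) t (g :: 'i \<Rightarrow> 'a::euclidean_space \<Rightarrow> real).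
    finite K \<Longrightarrow> (\<And>k. k \<in> K \<Longrightarrow> 0 < t k) \<Longrightarrow> (\<And>k. k \<in> K \<Longrightarrow> g k \<in> borel_measurable borel) \<Longrightarrow>
    (\<And>k x. k \<in> K \<Longrightarrow> 0 \<le> g k x) \<Longrightarrow>
    (\<integral>\<^sup>+x. ennpowr (\<Sum>k\<in>K. ennpowr (kernel_op (t k) (\<lambda>y. ennreal (g k y)) x) q) (p / q) \<partial>lborel)
      \<le> ennreal C * (\<integral>\<^sup>+x. ennpowr (\<Sum>k\<in>K. ennreal (g k x powr q)) (p / q) \<partial>lborel)"
proof -
  obtain B where B: "0 \<le> B" "\<And>w :: 'a \<Rightarrow> ennreal. w \<in> borel_measurable borel \<Longrightarrow>
    (\<integral>\<^sup>+x. ennpowr (maximal w x) p \<partial>lborel) \<le> ennreal B * (\<integral>\<^sup>+x. ennpowr (w x) p \<partial>lborel)"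
    using maximal_strong_type[OF p] by blast
  obtain D where D: "0 \<le> D" "\<And>(K :: 'i set) t (h :: 'i \<Rightarrow> 'a::euclidean_space \<Rightarrow> ennreal).
    finite K \<Longrightarrow> (\<And>k. k \<in> K \<Longrightarrow> 0 < t k) \<Longrightarrow> (\<And>k. k \<in> K \<Longrightarrow> h k \<in> borel_measurable borel) \<Longrightarrow>
    (\<integral>\<^sup>+x. ennpowr (\<Sum>k\<in>K. kernel_op (t k) (h k) x) p \<partial>lborel)
      \<le> ennreal D * (\<integral>\<^sup>+x. ennpowr (\<Sum>k\<in>K. h k x) p \<partial>lborel)"
    using kernel_op_sum_bound[OF p] by blast
  define A :: real where "A = 2 ^ (2 * DIM('a) + 2)"
  have A: "0 < A" by (simp add: A_def)
  define \<theta> where "\<theta> = 1 / q"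
  have \<theta>: "0 < \<theta>" "\<theta> < 1" "\<theta> * q = 1" "(1 - \<theta>) * q = q - 1" using q by (auto simp: \<theta>_def field_simps)
  define C where "C = A powr p * B + D"
  have "0 \<le> C" using B D by (simp add: C_def)
  moreover have "(\<integral>\<^sup>+x. ennpowr (\<Sum>k\<in>K. ennpowr (kernel_op (t k) (\<lambda>y. ennreal (g k y)) x) q) (p / q) \<partial>lborel)
      \<le> ennreal C * (\<integral>\<^sup>+x. ennpowr (\<Sum>k\<in>K. ennreal (g k x powr q)) (p / q) \<partial>lborel)"
    if K: "finite K" and t: "\<And>k. k \<in> K \<Longrightarrow> 0 < t k" and g[measurable]: "\<And>k. k \<in> K \<Longrightarrow> g k \<in> borel_measurable borel"
      and g0: "\<And>k x. k \<in> K \<Longrightarrow> 0 \<le> g k x"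
    for K :: "'i set" and t and g :: "'i \<Rightarrow> 'a \<Rightarrow> real"
  proof -
    define S where "S x = (\<Sum>k\<in>K. g k x powr q)" for x
    define G where "G x = S x powr \<theta>" for x
    have S0: "0 \<le> S x" for x unfolding S_def by (intro sum_nonneg) auto
    have G0: "0 \<le> G x" for x by (simp add: G_def)
    have [measurable]: "S \<in> borel_measurable borel" unfolding S_def using g by measurable
    then have [measurable]: "G \<in> borel_measurable borel" unfolding G_def by measurable
    \<comment> \<open>Where \<open>S x = 0\<close> every \<open>g k x\<close> vanishes as well, so
      the value 0 agrees with both \<open>sumh\<close> and \<open>gk\<close>; elsewhere
      \<open>h k\<close> distributes \<open>G\<close> in proportion to the summands of
      \<open>S\<close>.\<close>
    define h where "h k x = (if S x = 0 then 0 else g k x powr q / S x * G x)" for k x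
    have h[measurable]: "h k \<in> borel_measurable borel" if "k \<in> K" for k unfolding h_def using g[OF that] by measurable
    have h0: "0 \<le> h k x" for k x using S0 G0 by (simp add: h_def)
    have sumh: "(\<Sum>k\<in>K. ennreal (h k x)) = ennreal (G x)" for x
    proof -
      have "(\<Sum>k\<in>K. h k x) = G x"
      proof (cases "S x = 0")
        case False
        have "(\<Sum>k\<in>K. h k x) = (\<Sum>k\<in>K. g k x powr q) / S x * G x"
          using False by (simp add: h_def sum_divide_distrib sum_distrib_right)
        then show ?thesis using False by (simp add: S_def[symmetric])
      qed (simp add: h_def G_def)
      then show ?thesis using h0 by (simp add: sum_ennreal)
    qed
    have gk: "ennreal (g k x) = ennpowr (ennreal (G x)) (1 - \<theta>) * ennpowr (ennreal (h k x)) \<theta>" if "k \<in> K" for k x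
    proof (cases "S x = 0")
      case True
      then have "g k x powr q = 0"
        using that K sum_nonneg_eq_0_iff[of K "\<lambda>k. g k x powr q"] unfolding S_def by auto
      then show ?thesis using True by (simp add: h_def)
    next
      case False
      then have S: "0 < S x" using S0[of x] by simp
      have "G x powr (1 - \<theta>) * h k x powr \<theta> = G x powr (1 - \<theta>) * G x powr \<theta> * (g k x powr (q * \<theta>) / S x powr \<theta>)"
        using S g0[OF that] G0 \<theta> by (simp add: h_def powr_mult powr_divide powr_powr)
      also have "\<dots> = g k x"
        using S g0[OF that, of x] \<theta> by (simp add: powr_add[symmetric] G_def mult.commute[of q])
      finally show ?thesis using G0 h0 by (simp add: ennpowr_ennreal ennreal_mult[symmetric])
    qed
    define E where "E x = (\<Sum>k\<in>K. kernel_op (t k) (\<lambda>y. ennreal (h k y)) x)" for x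
    have [measurable]: "E \<in> borel_measurable borel" unfolding E_def using h by measurable
    \<comment> \<open>Hoelder's inequality with the kernel as weight. Once dominated by the maximal
      function, the factor that comes from \<open>G\<close> no longer depends on \<open>k\<close>
      and leaves the sum.\<close>
    have pt: "ennpowr (kernel_op (t k) (\<lambda>y. ennreal (g k y)) x) q
        \<le> ennpowr (ennreal A * maximal G x) (q - 1) * kernel_op (t k) (\<lambda>y. ennreal (h k y)) x" if "k \<in> K" for k x
    proof -
      let ?d = "\<lambda>y. ennreal (decay_kernel (t k) (x - y))"
      have "?d y * ennreal (g k y) = ennpowr (?d y * ennreal (G y)) (1 - \<theta>) * ennpowr (?d y * ennreal (h k y)) \<theta>" for y
      proof -
        have "?d y = ennpowr (?d y) (1 - \<theta>) * ennpowr (?d y) \<theta>"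
          using \<theta> ennpowr_add[of "1 - \<theta>" \<theta> "?d y"] by simp
        then show ?thesis
          unfolding gk[OF that] using \<theta> by (simp add: ennpowr_mult mult_ac)
      qed
      then have "kernel_op (t k) (\<lambda>y. ennreal (g k y)) x \<le>
         ennpowr (kernel_op (t k) (\<lambda>y. ennreal (G y)) x) (1 - \<theta>) * ennpowr (kernel_op (t k) (\<lambda>y. ennreal (h k y)) x) \<theta>"
        unfolding kernel_op_def using h[OF that]
        by (simp only:) (rule nn_integral_ennpowr_mult_le[OF _ _ \<theta>(1,2)]; simp)
      also have "\<dots> \<le> ennpowr (ennreal A * maximal G x) (1 - \<theta>) * ennpowr (kernel_op (t k) (\<lambda>y. ennreal (h k y)) x) \<theta>"
        unfolding A_def using \<theta> t[OF that] by (intro mult_right_mono ennpowr_mono kernel_op_le_maximal) auto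
      finally have "ennpowr (kernel_op (t k) (\<lambda>y. ennreal (g k y)) x) q
        \<le> ennpowr (ennpowr (ennreal A * maximal G x) (1 - \<theta>) * ennpowr (kernel_op (t k) (\<lambda>y. ennreal (h k y)) x) \<theta>) q"
        using q by (intro ennpowr_mono[of q]) auto
      then show ?thesis using q \<theta> by (simp add: ennpowr_mult[of q] ennpowr_ennpowr)
    qed
    have "ennpowr (\<Sum>k\<in>K. ennpowr (kernel_op (t k) (\<lambda>y. ennreal (g k y)) x) q) (p / q)
        \<le> ennpowr (ennreal A * maximal G x) p + ennpowr (E x) p" for x
    proof -
      have "(\<Sum>k\<in>K. ennpowr (kernel_op (t k) (\<lambda>y. ennreal (g k y)) x) q)
        \<le> ennpowr (ennreal A * maximal G x) (q - 1) * E x"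
        unfolding E_def sum_distrib_left by (intro sum_mono pt)
      then have "ennpowr (\<Sum>k\<in>K. ennpowr (kernel_op (t k) (\<lambda>y. ennreal (g k y)) x) q) (p / q)
        \<le> ennpowr (ennpowr (ennreal A * maximal G x) (q - 1) * E x) (p / q)"
        using p q by (intro ennpowr_mono[of "p / q"]) auto
      \<comment> \<open>The exponents are regrouped into a geometric mean of two \<open>p\<close>-th
        powers. Their sum splits the claim into two scalar estimates, the maximal theorem for
        \<open>G\<close> and the duality bound for \<open>E\<close>.\<close>
      also have "\<dots> = ennpowr (ennpowr (ennreal A * maximal G x) p) (1 - \<theta>) * ennpowr (ennpowr (E x) p) \<theta>"
      proof -
        have "(q - 1) * (p / q) = p * (1 - \<theta>)" "p / q = p * \<theta>"
          using q by (simp_all add: \<theta>_def field_simps)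
        moreover have "0 < p / q" using p q by simp
        ultimately show ?thesis by (simp only: ennpowr_mult ennpowr_ennpowr)
      qed
      also have "\<dots> \<le> ennpowr (ennreal A * maximal G x) p + ennpowr (E x) p"
        by (intro ennpowr_mult_le_add \<theta>)
      finally show ?thesis .
    qed
    then have "(\<integral>\<^sup>+x. ennpowr (\<Sum>k\<in>K. ennpowr (kernel_op (t k) (\<lambda>y. ennreal (g k y)) x) q) (p / q) \<partial>lborel)
      \<le> (\<integral>\<^sup>+x. ennpowr (ennreal A * maximal G x) p + ennpowr (E x) p \<partial>lborel)"
      by (intro nn_integral_mono)
    also have "\<dots> = ennreal (A powr p) * (\<integral>\<^sup>+x. ennpowr (maximal G x) p \<partial>lborel) + (\<integral>\<^sup>+x. ennpowr (E x) p \<partial>lborel)"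
      using p A by (simp add: nn_integral_add ennpowr_mult[of p] ennpowr_ennreal[of A] nn_integral_cmult)
    also have "\<dots> \<le> ennreal (A powr p) * (ennreal B * (\<integral>\<^sup>+x. ennpowr (ennreal (G x)) p \<partial>lborel))
       + ennreal D * (\<integral>\<^sup>+x. ennpowr (\<Sum>k\<in>K. ennreal (h k x)) p \<partial>lborel)"
      unfolding E_def using h t K by (intro add_mono mult_left_mono B D) auto
    also have "\<dots> = ennreal C * (\<integral>\<^sup>+x. ennpowr (ennreal (G x)) p \<partial>lborel)"
      using B D by (simp add: sumh C_def ennreal_plus ennreal_mult distrib_right mult.assoc)
    also have "(\<lambda>x. ennpowr (ennreal (G x)) p) = (\<lambda>x. ennpowr (\<Sum>k\<in>K. ennreal (g k x powr q)) (p / q))"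
    proof
      fix x
      have "(\<Sum>k\<in>K. ennreal (g k x powr q)) = ennreal (S x)" by (simp add: S_def sum_ennreal)
      then show "ennpowr (ennreal (G x)) p = ennpowr (\<Sum>k\<in>K. ennreal (g k x powr q)) (p / q)"
        using S0 by (simp add: G_def ennpowr_ennreal powr_powr \<theta>_def)
    qed
    finally show ?thesis .
  qed
  ultimately show ?thesis by (rule that)
qed

section \<open>Fourier transforms of rapidly decreasing functions\<close>

text \<open>Integrability of all moments is what differentiation under the Fourier integral needs,
  and it survives multiplication by coordinates. So the transforms of such functions form a class
  stable under \<open>partial i\<close>.\<close>

definition rapid :: "(real ^ 'n::finite \<Rightarrow> complex) \<Rightarrow> bool" where
  "rapid g \<longleftrightarrow> g \<in> borel_measurable borel \<and> (\<forall>N. integrable lborel (\<lambda>x. (1 + norm x) ^ N * norm (g x)))"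

lemma rapid_measurable: "rapid g \<Longrightarrow> g \<in> borel_measurable borel"
  by (simp add: rapid_def)

lemma rapid_weighted_integrable: "rapid g \<Longrightarrow> integrable lborel (\<lambda>x. (1 + norm x) ^ N * norm (g x))"
  by (simp add: rapid_def)

lemma rapid_integrable_mult:
  fixes g :: "real ^ 'n::finite \<Rightarrow> complex"
  assumes g: "rapid g" and h: "h \<in> borel_measurable borel" and b: "\<And>x. norm (h x) \<le> C * (1 + norm x) ^ N"
  shows "integrable lborel (\<lambda>x. h x * g x)"
proof (rule Bochner_Integration.integrable_bound[OF integrable_mult_right[OF rapid_weighted_integrable[OF g, of N], of C]])
  show "AE x in lborel. norm (h x * g x) \<le> norm (C * ((1 + norm x) ^ N * norm (g x)))"
  proof (rule AE_I2)
    fix x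
    have "norm (h x * g x) \<le> C * (1 + norm x) ^ N * norm (g x)"
      using b[of x] by (simp add: norm_mult mult_right_mono)
    then show "norm (h x * g x) \<le> norm (C * ((1 + norm x) ^ N * norm (g x)))" by (simp add: mult.assoc)
  qed
qed (use h rapid_measurable[OF g] in measurable)

lemma rapid_integrable: "rapid g \<Longrightarrow> integrable lborel g"
  using rapid_integrable_mult[of g "\<lambda>_. 1" 1 0] by simp

lemma rapid_mult:
  fixes g :: "real ^ 'n::finite \<Rightarrow> complex"
  assumes g: "rapid g" and h: "h \<in> borel_measurable borel" and b: "\<And>x. norm (h x) \<le> C * (1 + norm x) ^ M"
  shows "rapid (\<lambda>x. h x * g x)"
  unfolding rapid_def
proof (intro conjI allI)
  show "(\<lambda>x. h x * g x) \<in> borel_measurable borel" using h rapid_measurable[OF g] by measurable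
  fix N
  have "integrable lborel (\<lambda>x. (of_real ((1 + norm x) ^ N) * h x) * g x)"
  proof (rule rapid_integrable_mult[OF g])
    show "norm (of_real ((1 + norm x) ^ N) * h x) \<le> C * (1 + norm x) ^ (N + M)" for x
      using mult_left_mono[OF b[of x], of "(1 + norm x) ^ N"] by (simp add: norm_mult power_add norm_power mult_ac del: of_real_power of_real_add)
  qed (use h in measurable)
  from integrable_norm[OF this]
  show "integrable lborel (\<lambda>x. (1 + norm x) ^ N * norm (h x * g x))"
    by (simp add: norm_mult mult.assoc norm_power del: of_real_power of_real_add)
qed

lemma rapid_cmult: "rapid g \<Longrightarrow> rapid (\<lambda>x. c * g x)"
  by (rule rapid_mult[where C="norm c" and M=0]) auto

lemma rapid_coord:
  fixes g :: "real ^ 'n::finite \<Rightarrow> complex"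
  assumes "rapid g" shows "rapid (\<lambda>x. of_real (x $ i) * g x)"
proof (rule rapid_mult[OF assms, where C=1 and M=1])
  show "norm (complex_of_real (x $ i)) \<le> 1 * (1 + norm x) ^ 1" for x :: "real ^ 'n"
    using component_le_norm_cart[of x i] by simp
qed measurable

lemma rapid_cis: "rapid g \<Longrightarrow> rapid (\<lambda>x. cis (2 * pi * (y \<bullet> x)) * g x)"
  by (rule rapid_mult[where C=1 and M=0]) (auto intro!: borel_measurable_continuous_onI continuous_intros)

text \<open>Additional decay of order \<open>DIM(real ^ 'n) + 1\<close> pays for
  integrability.\<close>

lemma rapid_decay:
  fixes g :: "real ^ 'n::finite \<Rightarrow> complex"
  assumes g: "g \<in> borel_measurable borel" and b: "\<And>N. \<exists>C. \<forall>x. (1 + norm x) ^ N * norm (g x) \<le> C"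
  shows "rapid g"
  unfolding rapid_def
proof (intro conjI allI)
  fix N
  obtain C where C: "\<And>x. (1 + norm x) ^ (N + (DIM(real ^ 'n) + 1)) * norm (g x) \<le> C"
    using b by blast
  show "integrable lborel (\<lambda>x. (1 + norm x) ^ N * norm (g x))"
  proof (rule Bochner_Integration.integrable_bound[OF integrable_mult_right[OF integrable_decay, of C]])
    show "AE x in lborel. norm ((1 + norm x) ^ N * norm (g x)) \<le> norm (C * (1 / (1 + norm x) ^ (DIM(real ^ 'n) + 1)))"
    proof (rule AE_I2)
      fix x :: "real ^ 'n"
      have p: "0 < (1 + norm x) ^ (DIM(real ^ 'n) + 1)" by (intro zero_less_power add_pos_nonneg) auto
      have "(1 + norm x) ^ N * norm (g x) \<le> C / (1 + norm x) ^ (DIM(real ^ 'n) + 1)"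
        using C[of x] unfolding pos_le_divide_eq[OF p] power_add[of _ N] by (simp add: mult_ac)
      also have "\<dots> \<le> norm (C * (1 / (1 + norm x) ^ (DIM(real ^ 'n) + 1)))"
        by (metis abs_ge_self mult.right_neutral real_norm_def times_divide_eq_right)
      finally show "norm ((1 + norm x) ^ N * norm (g x)) \<le> norm (C * (1 / (1 + norm x) ^ (DIM(real ^ 'n) + 1)))"
        by simp
    qed
  qed (use g in measurable)
qed (rule g)

lemma fourier_eq_inv_fourier: "fourier g = (\<lambda>x. inv_fourier g (- x))"
  by (simp add: fourier_def inv_fourier_def fun_eq_iff inner_commute)

lemma cis_inner_measurable [measurable]: "(\<lambda>x. cis (c * (y \<bullet> x))) \<in> borel_measurable borel"
  by (auto intro!: borel_measurable_continuous_onI continuous_intros)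

lemma norm_cis_minus_linear: "norm (cis t - 1 - \<i> * of_real t) \<le> t\<^sup>2 / 2"
  using iexp_approx1[of t 1] by (simp add: cis_conv_exp power2_eq_square algebra_simps)

text \<open>Differentiation under the integral with an explicit remainder: the error of the linear
  approximation to \<open>cis t\<close> is at most \<open>t\<^sup>2 / 2\<close>, so the increment
  deviates from its linear part by a weighted second moment of \<open>g\<close> times
  \<open>(norm h)\<^sup>2\<close>, up to a constant.\<close>

lemma inv_fourier_has_derivative:
  fixes g :: "real ^ 'n::finite \<Rightarrow> complex"
  assumes g: "rapid g"
  shows "(inv_fourier g has_derivative
    (\<lambda>h. \<Sum>i\<in>UNIV. (h $ i) *\<^sub>R inv_fourier (\<lambda>\<xi>. 2 * pi * \<i> * (of_real (\<xi> $ i) * g \<xi>)) x)) (at x)"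
    (is "(_ has_derivative ?L) _")
proof -
  let ?e = "\<lambda>\<xi>. cis (2 * pi * (x \<bullet> \<xi>))"
  define K where "K = 2 * pi\<^sup>2 * (LINT \<xi>|lborel. (1 + norm \<xi>) ^ 2 * norm (g \<xi>))"
  have int_g: "integrable lborel (\<lambda>\<xi>. cis (2 * pi * (y \<bullet> \<xi>)) * g \<xi>)" for y
    by (rule rapid_integrable[OF rapid_cis[OF g]])
  have int_i: "integrable lborel (\<lambda>\<xi>. ?e \<xi> * (2 * pi * \<i> * (of_real (\<xi> $ i) * g \<xi>)))" for i
    by (rule rapid_integrable[OF rapid_cis[OF rapid_cmult[OF rapid_coord[OF g]]]])
  have L: "?L h = (LINT \<xi>|lborel. ?e \<xi> * (\<i> * of_real (2 * pi * (h \<bullet> \<xi>))) * g \<xi>)"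
    and int_L: "integrable lborel (\<lambda>\<xi>. ?e \<xi> * (\<i> * of_real (2 * pi * (h \<bullet> \<xi>))) * g \<xi>)" for h
  proof -
    have *: "?e \<xi> * (\<i> * of_real (2 * pi * (h \<bullet> \<xi>))) * g \<xi> =
        (\<Sum>i\<in>UNIV. (h $ i) *\<^sub>R (?e \<xi> * (2 * pi * \<i> * (of_real (\<xi> $ i) * g \<xi>))))" for \<xi>
      by (simp add: inner_vec_def sum_distrib_left sum_distrib_right scaleR_conv_of_real mult_ac)
    show "integrable lborel (\<lambda>\<xi>. ?e \<xi> * (\<i> * of_real (2 * pi * (h \<bullet> \<xi>))) * g \<xi>)"
      unfolding * by (intro Bochner_Integration.integrable_sum integrable_scaleR_right int_i)
    show "?L h = (LINT \<xi>|lborel. ?e \<xi> * (\<i> * of_real (2 * pi * (h \<bullet> \<xi>))) * g \<xi>)"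
      unfolding * inv_fourier_def
      by (subst Bochner_Integration.integral_sum, intro integrable_scaleR_right int_i)
         (simp only: integral_scaleR_right)
  qed
  have bound: "norm (inv_fourier g (x + h) - inv_fourier g x - ?L h) \<le> K * (norm h)\<^sup>2" for h
  proof -
    have eq: "inv_fourier g (x + h) - inv_fourier g x - ?L h =
      (LINT \<xi>|lborel. cis (2 * pi * ((x + h) \<bullet> \<xi>)) * g \<xi> - ?e \<xi> * g \<xi> - ?e \<xi> * (\<i> * of_real (2 * pi * (h \<bullet> \<xi>))) * g \<xi>)"
      by (simp only: L) (simp only: inv_fourier_def Bochner_Integration.integral_diff
          Bochner_Integration.integrable_diff int_g int_L)
    have "norm (inv_fourier g (x + h) - inv_fourier g x - ?L h) \<le> (LINT \<xi>|lborel. 2 * pi\<^sup>2 * (norm h)\<^sup>2 * ((1 + norm \<xi>) ^ 2 * norm (g \<xi>)))"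
      unfolding eq
    proof (rule Bochner_Integration.integral_norm_bound_integral)
      fix \<xi>
      have "cis (2 * pi * ((x + h) \<bullet> \<xi>)) * g \<xi> - ?e \<xi> * g \<xi> - ?e \<xi> * (\<i> * of_real (2 * pi * (h \<bullet> \<xi>))) * g \<xi>
        = ?e \<xi> * (cis (2 * pi * (h \<bullet> \<xi>)) - 1 - \<i> * of_real (2 * pi * (h \<bullet> \<xi>))) * g \<xi>"
        by (simp add: inner_add_left distrib_left cis_mult[symmetric] algebra_simps)
      then have "norm (cis (2 * pi * ((x + h) \<bullet> \<xi>)) * g \<xi> - ?e \<xi> * g \<xi> - ?e \<xi> * (\<i> * of_real (2 * pi * (h \<bullet> \<xi>))) * g \<xi>)
        \<le> (2 * pi * (h \<bullet> \<xi>))\<^sup>2 / 2 * norm (g \<xi>)"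
        using mult_right_mono[OF norm_cis_minus_linear[of "2 * pi * (h \<bullet> \<xi>)"], of "norm (g \<xi>)"]
        by (simp add: norm_mult)
      also have "\<dots> = 2 * pi\<^sup>2 * (h \<bullet> \<xi>)\<^sup>2 * norm (g \<xi>)" by (simp add: power_mult_distrib)
      also have "\<dots> \<le> 2 * pi\<^sup>2 * ((norm h)\<^sup>2 * (1 + norm \<xi>) ^ 2) * norm (g \<xi>)"
      proof -
        have "\<bar>h \<bullet> \<xi>\<bar> \<le> norm h * (1 + norm \<xi>)"
          using Cauchy_Schwarz_ineq2[of h \<xi>] by (simp add: distrib_left add_increasing)
        then have "\<bar>h \<bullet> \<xi>\<bar>\<^sup>2 \<le> (norm h * (1 + norm \<xi>))\<^sup>2" by (intro power_mono) auto
        then show ?thesis by (intro mult_right_mono mult_left_mono) (auto simp: power_mult_distrib)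
      qed
      finally show "norm (cis (2 * pi * ((x + h) \<bullet> \<xi>)) * g \<xi> - ?e \<xi> * g \<xi> - ?e \<xi> * (\<i> * of_real (2 * pi * (h \<bullet> \<xi>))) * g \<xi>)
        \<le> 2 * pi\<^sup>2 * (norm h)\<^sup>2 * ((1 + norm \<xi>) ^ 2 * norm (g \<xi>))"
        by (simp only: mult.assoc)
    qed (rule Bochner_Integration.integrable_diff[OF Bochner_Integration.integrable_diff[OF int_g int_g] int_L],
         rule integrable_mult_right[OF rapid_weighted_integrable[OF g]])
    also have "\<dots> = K * (norm h)\<^sup>2" unfolding K_def integral_mult_right_zero by (simp only: mult_ac)
    finally show ?thesis .
  qed
  have "((\<lambda>h. norm (inv_fourier g (x + h) - inv_fourier g x - ?L h) / norm h) \<longlongrightarrow> 0) (at 0)"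
  proof (rule tendsto_sandwich[OF _ _ tendsto_const])
    show "((\<lambda>h::real ^ 'n. K * norm h) \<longlongrightarrow> 0) (at 0)" by (auto intro!: tendsto_eq_intros)
    show "\<forall>\<^sub>F h in at 0. norm (inv_fourier g (x + h) - inv_fourier g x - ?L h) / norm h \<le> K * norm h"
    proof (rule eventually_at_filter[THEN iffD2], rule always_eventually, safe)
      fix h :: "real ^ 'n" assume "h \<noteq> 0"
      then show "norm (inv_fourier g (x + h) - inv_fourier g x - ?L h) / norm h \<le> K * norm h"
        using bound[of h] by (simp add: divide_le_eq power2_eq_square mult.assoc)
    qed
  qed auto
  moreover have "bounded_linear ?L"
    by (intro bounded_linear_sum bounded_linear_scaleR_const bounded_linear_vec_nth)
  ultimately show ?thesis unfolding has_derivative_at by blast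
qed

lemma partial_inv_fourier:
  fixes g :: "real ^ 'n::finite \<Rightarrow> complex"
  assumes g: "rapid g"
  shows "partial i (inv_fourier g) = inv_fourier (\<lambda>\<xi>. 2 * pi * \<i> * (of_real (\<xi> $ i) * g \<xi>))"
proof
  fix x
  let ?P = "\<lambda>j. inv_fourier (\<lambda>\<xi>. 2 * pi * \<i> * (of_real (\<xi> $ j) * g \<xi>)) x"
  have "(\<Sum>j\<in>UNIV. (axis i 1 $ j) *\<^sub>R ?P j) = (\<Sum>j\<in>UNIV. if j = i then ?P j else 0)"
    by (rule sum.cong) (auto simp: axis_def)
  then show "partial i (inv_fourier g) x = ?P i"
    using partial_eqI[OF inv_fourier_has_derivative[OF g], of i x] by simp
qed

lemma smooth_inv_fourier:
  assumes "rapid g" shows "smooth (inv_fourier g)"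
proof (rule smooth_coinduct[where P="\<lambda>f. \<exists>g. rapid g \<and> f = inv_fourier g"])
  fix f assume "\<exists>g. rapid g \<and> f = inv_fourier g"
  then obtain g where g: "rapid g" "f = inv_fourier g" by blast
  have "f differentiable_on UNIV"
    unfolding g(2) using inv_fourier_has_derivative[OF g(1)]
    by (meson differentiable_at_imp_differentiable_on differentiable_def)
  then show "f differentiable_on UNIV \<and> (\<forall>i. \<exists>g. rapid g \<and> partial i f = inv_fourier g)"
    unfolding g(2) partial_inv_fourier[OF g(1)] using rapid_cmult[OF rapid_coord[OF g(1)]] by blast
qed (use assms in blast)

lemma smooth_fourier: "rapid g \<Longrightarrow> smooth (fourier g)"
  using smooth_affine_comp[OF smooth_inv_fourier, of g "-1" 0] by (simp add: fourier_eq_inv_fourier)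

lemma norm_inv_fourier_le: "norm (inv_fourier g x) \<le> (LINT \<xi>|lborel. norm (g \<xi>))"
  unfolding inv_fourier_def by (rule order.trans[OF integral_norm_bound]) (simp add: norm_mult)

lemma smooth_increment_bound:
  fixes f :: "real ^ 'n::finite \<Rightarrow> complex"
  assumes f: "smooth f" and B: "\<And>i w. w \<in> closed_segment a b \<Longrightarrow> norm (partial i f w) \<le> B"
  shows "norm (f a - f b) \<le> B * CARD('n) * norm (a - b)"
proof (rule differentiable_bound[where S="closed_segment a b" and f'="\<lambda>x h. \<Sum>i\<in>UNIV. (h $ i) *\<^sub>R partial i f x"])
  fix x assume x: "x \<in> closed_segment a b"
  show "(f has_derivative (\<lambda>h. \<Sum>i\<in>UNIV. (h $ i) *\<^sub>R partial i f x)) (at x within closed_segment a b)"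
    by (rule has_derivative_at_withinI[OF smooth_has_derivative[OF f]])
  show "onorm (\<lambda>h. \<Sum>i\<in>UNIV. (h $ i) *\<^sub>R partial i f x) \<le> B * CARD('n)"
  proof (rule onorm_le)
    fix h :: "real ^ 'n"
    have "norm (\<Sum>i\<in>UNIV. (h $ i) *\<^sub>R partial i f x) \<le> (\<Sum>i\<in>(UNIV::'n set). norm h * B)"
      using component_le_norm_cart B[OF x] by (intro sum_norm_le) (auto intro!: mult_mono)
    then show "norm (\<Sum>i\<in>UNIV. (h $ i) *\<^sub>R partial i f x) \<le> B * CARD('n) * norm h" by (simp add: mult_ac)
  qed
qed auto

section \<open>Test functions\<close>

text \<open>The smooth functions of compact support. They serve as Fourier multipliers, and their
  inverse transforms as convolution kernels.\<close>

definition test_function :: "(real ^ 'n::finite \<Rightarrow> complex) \<Rightarrow> bool" where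
  "test_function m \<longleftrightarrow> smooth m \<and> (\<exists>R. \<forall>x. R < norm x \<longrightarrow> m x = 0)"

lemma test_function_smooth: "test_function m \<Longrightarrow> smooth m"
  by (simp add: test_function_def)

lemma test_function_mult: "test_function m \<Longrightarrow> smooth f \<Longrightarrow> test_function (\<lambda>x. f x * m x)"
  by (auto simp: test_function_def smooth_mult)

lemma test_function_cmult: "test_function m \<Longrightarrow> test_function (\<lambda>x. c * m x)"
  by (simp add: test_function_mult smooth_const)

lemma test_function_coord: "test_function m \<Longrightarrow> test_function (\<lambda>x. of_real (x $ i) * m x)"
  by (simp add: test_function_mult smooth_coord)

lemma partial_eq_0:
  assumes "open S" "x \<in> S" "\<And>y. y \<in> S \<Longrightarrow> f y = 0"
  shows "partial i f x = 0"
proof -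
  have "(f has_derivative (\<lambda>h. 0)) (at x)"
    by (rule has_derivative_transform_within_open[OF has_derivative_const assms(1,2), of 0]) (simp add: assms(3))
  then show ?thesis using partial_eqI by fastforce
qed

lemma test_function_partial:
  assumes "test_function m" shows "test_function (partial i m)"
proof -
  obtain R where R: "\<And>x. R < norm x \<Longrightarrow> m x = 0" using assms by (auto simp: test_function_def)
  have "partial i m x = 0" if "R < norm x" for x
  proof (rule partial_eq_0)
    show "open {x::real ^ 'n. R < norm x}" by (intro open_Collect_less continuous_intros)
  qed (use that R in auto)
  then show ?thesis using assms by (auto simp: test_function_def smooth_partial)
qed

lemma test_function_partials: "test_function m \<Longrightarrow> test_function (partials \<beta> m)"
  by (induction \<beta>) (auto simp: test_function_partial)

lemma test_function_bounded:
  assumes "test_function m" obtains C where "0 \<le> C" "\<And>x. norm (m x) \<le> C"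
proof -
  obtain R where R: "\<And>x. R < norm x \<Longrightarrow> m x = 0" using assms by (auto simp: test_function_def)
  have "compact (m ` cball 0 R)"
    using assms by (intro compact_continuous_image smooth_continuous_on) (auto simp: test_function_def)
  then have "\<exists>C. \<forall>x\<in>cball 0 R. norm (m x) \<le> C"
    by (auto dest!: compact_imp_bounded simp: bounded_iff)
  then obtain C where C: "\<And>x. x \<in> cball 0 R \<Longrightarrow> norm (m x) \<le> C" by blast
  have "norm (m x) \<le> max C 0" for x
    using C[of x] R[of x] by (cases "norm x \<le> R") auto
  then show ?thesis by (intro that[of "max C 0"]) auto
qed

lemma test_function_decay:
  assumes "test_function m" shows "\<exists>C. \<forall>x. (1 + norm x) ^ N * norm (m x) \<le> C"
proof -
  obtain R where R: "\<And>x. R < norm x \<Longrightarrow> m x = 0" using assms by (auto simp: test_function_def)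
  obtain C where C: "0 \<le> C" "\<And>x. norm (m x) \<le> C" using test_function_bounded[OF assms] by metis
  have "(1 + norm x) ^ N * norm (m x) \<le> (1 + max R 0) ^ N * C" for x
    using R[of x] C by (cases "norm x \<le> R") (auto intro!: mult_mono power_mono)
  then show ?thesis by blast
qed

lemma test_function_rapid: "test_function m \<Longrightarrow> rapid m"
  by (intro rapid_decay test_function_decay smooth_borel_measurable test_function_smooth)

text \<open>The difference quotients in direction \<open>i\<close> have integral 0 by translation
  invariance and converge dominatedly to the derivative, so neither iterated integrals nor boundary
  terms occur.\<close>

lemma integral_partial_eq_0:
  fixes m :: "real ^ 'n::finite \<Rightarrow> complex"
  assumes m: "test_function m"
  shows "(LINT x|lborel. partial i m x) = 0"
proof -
  have m': "test_function (partial i m)" by (rule test_function_partial[OF m])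
  obtain R where R: "\<And>x. R < norm x \<Longrightarrow> m x = 0" using m by (auto simp: test_function_def)
  obtain C where C: "\<And>j x. norm (partial j m x) \<le> C"
  proof -
    have "\<exists>C. \<forall>x. norm (partial j m x) \<le> C" for j
      using test_function_bounded[OF test_function_partial[OF m]] by metis
    then obtain c where c: "\<And>j x. norm (partial j m x) \<le> c j" by metis
    have "norm (partial j m x) \<le> (\<Sum>i\<in>UNIV. \<bar>c i\<bar>)" for j x
      using c[of j x] member_le_sum[of j UNIV "\<lambda>i. \<bar>c i\<bar>"] by simp
    then show ?thesis by (rule that)
  qed
  define v where "v = (axis i 1 :: real ^ 'n)"
  have nv: "norm v = 1" by (simp add: v_def)
  define t where "t k = 1 / real (Suc k)" for k
  have t: "0 < t k" "t k \<le> 1" for k by (auto simp: t_def)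
  define s where "s k x = (m (x + t k *\<^sub>R v) - m x) /\<^sub>R t k" for k x
  have int_m: "integrable lborel m" by (rule rapid_integrable[OF test_function_rapid[OF m]])
  have shift: "integrable lborel (\<lambda>x. m (x + w))" "(LINT x|lborel. m (x + w)) = (LINT x|lborel. m x)" for w
  proof -
    have 1: "integrable (distr lborel borel ((+) w)) m" using int_m by (simp add: lborel_distr_plus)
    have [measurable]: "m \<in> borel_measurable borel" using rapid_measurable[OF test_function_rapid[OF m]] .
    show "integrable lborel (\<lambda>x. m (x + w))"
      using 1 by (subst (asm) integrable_distr_eq) (auto simp: add.commute)
    have "(LINT x|lborel. m x) = (LINT x|distr lborel borel ((+) w). m x)" by (simp add: lborel_distr_plus)
    also have "\<dots> = (LINT x|lborel. m (w + x))" by (rule integral_distr) auto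
    finally show "(LINT x|lborel. m (x + w)) = (LINT x|lborel. m x)" by (simp add: add.commute)
  qed
  have s0: "(LINT x|lborel. s k x) = 0" for k
    unfolding s_def by (simp add: shift int_m)
  have deriv: "((\<lambda>r. m (x + r *\<^sub>R v)) has_vector_derivative partial i m (x + r *\<^sub>R v)) (at r)" for x r
  proof -
    have 1: "((\<lambda>r. x + r *\<^sub>R v) has_derivative (\<lambda>h. h *\<^sub>R v)) (at r)" by (auto intro!: derivative_eq_intros)
    have 2: "(\<Sum>j\<in>UNIV. (axis i 1 $ j) *\<^sub>R partial j m y) = partial i m y" for y
      using partial_eqI[OF smooth_has_derivative[OF test_function_smooth[OF m]], of i y] by simp
    have "(\<Sum>j\<in>UNIV. ((h *\<^sub>R v) $ j) *\<^sub>R partial j m y) = h *\<^sub>R partial i m y" for h y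
      unfolding v_def 2[symmetric] by (simp add: scaleR_sum_right)
    then show ?thesis
      using has_derivative_compose[OF 1 smooth_has_derivative[OF test_function_smooth[OF m]]]
      by (simp add: has_vector_derivative_def)
  qed
  have lim: "(\<lambda>k. s k x) \<longlonglongrightarrow> partial i m x" for x
  proof -
    let ?F = "\<lambda>h. norm (m (x + h *\<^sub>R v) - m x - h *\<^sub>R partial i m x) / norm h"
    have "(?F \<longlongrightarrow> 0) (at 0)"
      using deriv[of x 0] by (simp add: has_vector_derivative_def has_derivative_at)
    moreover have "filterlim t (at 0) sequentially"
    proof -
      have "t \<longlonglongrightarrow> 0" using LIMSEQ_inverse_real_of_nat by (simp add: t_def[abs_def] inverse_eq_divide)
      then show ?thesis using t(1) by (auto simp: filterlim_at less_imp_neq[symmetric])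
    qed
    ultimately have "(\<lambda>k. ?F (t k)) \<longlonglongrightarrow> 0" by (rule filterlim_compose)
    moreover have "?F (t k) = norm (s k x - partial i m x)" for k
    proof -
      have "s k x - partial i m x = (m (x + t k *\<^sub>R v) - m x - t k *\<^sub>R partial i m x) /\<^sub>R t k"
        using t(1)[of k] by (simp add: s_def scaleR_diff_right)
      then show ?thesis using t(1)[of k] by (simp add: divide_inverse mult.commute)
    qed
    ultimately have "(\<lambda>k. norm (s k x - partial i m x)) \<longlonglongrightarrow> 0" by simp
    then show ?thesis by (rule LIM_zero_cancel[OF tendsto_norm_zero_cancel])
  qed
  \<comment> \<open>The step \<open>t k\<close> is at most 1, so all quotients vanish outside one
    common ball, on which the mean value inequality bounds them.\<close>
  have bound: "norm (s k x) \<le> C * CARD('n) * indicator (cball 0 (R + 1)) x" for k x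
  proof (cases "x \<in> cball 0 (R + 1)")
    case True
    have "norm (m (x + t k *\<^sub>R v) - m x) \<le> C * CARD('n) * norm (x + t k *\<^sub>R v - x)"
      by (rule smooth_increment_bound[OF test_function_smooth[OF m] C])
    moreover have "norm (x + t k *\<^sub>R v - x) = t k" using t(1)[of k] nv by simp
    ultimately have "norm (m (x + t k *\<^sub>R v) - m x) \<le> C * CARD('n) * t k" by simp
    moreover have "norm (s k x) = norm (m (x + t k *\<^sub>R v) - m x) / t k"
      using t(1)[of k] by (simp add: s_def divide_inverse mult.commute)
    ultimately show ?thesis using True t(1)[of k] by (simp add: pos_divide_le_eq)
  next
    case False
    then have x: "R + 1 < norm x" by simp
    have "norm x \<le> norm (x + t k *\<^sub>R v) + norm (t k *\<^sub>R v)" by (metis add_diff_cancel norm_triangle_ineq4)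
    then have "R < norm (x + t k *\<^sub>R v)" using x nv t[of k] by simp
    then show ?thesis using x R by (simp add: s_def)
  qed
  have [measurable]: "m \<in> borel_measurable borel" "partial i m \<in> borel_measurable borel"
    using rapid_measurable[OF test_function_rapid] m m' by auto
  have "(\<lambda>k. LINT x|lborel. s k x) \<longlonglongrightarrow> (LINT x|lborel. partial i m x)"
  proof (rule integral_dominated_convergence[where w="\<lambda>x. C * CARD('n) * indicator (cball 0 (R + 1)) x"])
    show "integrable lborel (\<lambda>x::real ^ 'n. C * CARD('n) * indicator (cball 0 (R + 1)) x)"
      using emeasure_bounded_finite[OF bounded_cball, of "0::real ^ 'n" "R + 1"]
      by (intro integrable_mult_right integrable_real_indicator) auto
  qed (use lim bound in \<open>auto simp: s_def[abs_def]\<close>)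
  then show ?thesis unfolding s0 by (metis LIMSEQ_unique tendsto_const)
qed

lemma smooth_cis_inner: "smooth (\<lambda>\<xi>. cis (2 * pi * (x \<bullet> \<xi>)))"
  and partial_cis_inner:
    "partial i (\<lambda>\<xi>. cis (2 * pi * (x \<bullet> \<xi>))) = (\<lambda>\<xi>. of_real (2 * pi * x $ i) * \<i> * cis (2 * pi * (x \<bullet> \<xi>)))"
proof -
  let ?e = "\<lambda>\<xi>. cis (2 * pi * (x \<bullet> \<xi>))"
  have D: "((\<lambda>\<xi>. c * ?e \<xi>) has_derivative (\<lambda>h. c * ((2 * pi * (x \<bullet> h)) *\<^sub>R (\<i> * ?e \<xi>)))) (at \<xi>)" for c \<xi>
    by (auto intro!: derivative_eq_intros)
  have P: "partial i (\<lambda>\<xi>. c * ?e \<xi>) = (\<lambda>\<xi>. (c * (of_real (2 * pi * x $ i) * \<i>)) * ?e \<xi>)" for c i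
  proof
    fix \<xi>
    have "x \<bullet> axis i 1 = x $ i" by (simp add: inner_axis)
    then show "partial i (\<lambda>\<xi>. c * ?e \<xi>) \<xi> = (c * (of_real (2 * pi * x $ i) * \<i>)) * ?e \<xi>"
      using partial_eqI[OF D, of i c \<xi>] by (simp add: scaleR_conv_of_real)
  qed
  show "smooth ?e"
  proof (rule smooth_coinduct[where P="\<lambda>f. \<exists>c. f = (\<lambda>\<xi>. c * ?e \<xi>)"])
    show "\<exists>c. ?e = (\<lambda>\<xi>. c * ?e \<xi>)" by (rule exI[of _ 1]) simp
    fix f assume "\<exists>c. f = (\<lambda>\<xi>. c * ?e \<xi>)"
    then obtain c where f: "f = (\<lambda>\<xi>. c * ?e \<xi>)" by blast
    have "f differentiable_on UNIV"
      unfolding f using D by (meson differentiable_at_imp_differentiable_on differentiable_def)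
    then show "f differentiable_on UNIV \<and> (\<forall>i. \<exists>c. partial i f = (\<lambda>\<xi>. c * ?e \<xi>))"
      unfolding f P by blast
  qed
  show "partial i ?e = (\<lambda>\<xi>. of_real (2 * pi * x $ i) * \<i> * ?e \<xi>)"
    using P[of i 1] by simp
qed

text \<open>Integration by parts: the derivative of the exponential times \<open>m\<close> has
  integral 0.\<close>

lemma coord_inv_fourier:
  fixes m :: "real ^ 'n::finite \<Rightarrow> complex"
  assumes m: "test_function m"
  shows "of_real (x $ i) * inv_fourier m x = inv_fourier (\<lambda>\<xi>. \<i> / (2 * pi) * partial i m \<xi>) x"
proof -
  let ?e = "\<lambda>\<xi>. cis (2 * pi * (x \<bullet> \<xi>))"
  have int: "integrable lborel (\<lambda>\<xi>. ?e \<xi> * f \<xi>)" if "test_function f" for f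
    by (rule rapid_integrable[OF rapid_cis[OF test_function_rapid[OF that]]])
  have "partial i (\<lambda>\<xi>. ?e \<xi> * m \<xi>) = (\<lambda>\<xi>. ?e \<xi> * partial i m \<xi> + of_real (2 * pi * x $ i) * \<i> * (?e \<xi> * m \<xi>))"
    by (rule ext, subst partial_mult) (auto intro!: smooth_differentiable smooth_cis_inner test_function_smooth m simp: partial_cis_inner)
  then have "0 = (LINT \<xi>|lborel. ?e \<xi> * partial i m \<xi> + of_real (2 * pi * x $ i) * \<i> * (?e \<xi> * m \<xi>))"
    using integral_partial_eq_0[OF test_function_mult[OF m smooth_cis_inner[of x]], of i] by simp
  also have "\<dots> = (LINT \<xi>|lborel. ?e \<xi> * partial i m \<xi>) + of_real (2 * pi * x $ i) * \<i> * (LINT \<xi>|lborel. ?e \<xi> * m \<xi>)"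
    by (subst Bochner_Integration.integral_add[OF int[OF test_function_partial[OF m]] integrable_mult_right[OF int[OF m]]])
       (simp only: integral_mult_right_zero)
  finally have "(LINT \<xi>|lborel. ?e \<xi> * partial i m \<xi>) = - (of_real (2 * pi * x $ i) * \<i> * inv_fourier m x)"
    unfolding inv_fourier_def eq_neg_iff_add_eq_0 by (rule sym)
  moreover have "inv_fourier (\<lambda>\<xi>. \<i> / (2 * pi) * partial i m \<xi>) x = \<i> / (2 * pi) * (LINT \<xi>|lborel. ?e \<xi> * partial i m \<xi>)"
    unfolding inv_fourier_def integral_mult_right_zero[symmetric] by (simp only: mult_ac)
  ultimately have "inv_fourier (\<lambda>\<xi>. \<i> / (2 * pi) * partial i m \<xi>) x
      = (\<i> / (2 * pi)) * - (of_real (2 * pi * x $ i) * \<i> * inv_fourier m x)" by (simp only:)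
  also have "\<dots> = of_real (x $ i) * inv_fourier m x * - (\<i> * \<i>)" by (simp del: complex_i_mult_minus i_squared)
  also have "\<dots> = of_real (x $ i) * inv_fourier m x" by simp
  finally show ?thesis ..
qed

lemma test_function_coord_inv_fourier:
  fixes m :: "real ^ 'n::finite \<Rightarrow> complex"
  shows "test_function m \<Longrightarrow> \<exists>m'. test_function m' \<and> (\<forall>x. monom_at \<beta> x *\<^sub>R inv_fourier m x = inv_fourier m' x)"
proof (induction \<beta> arbitrary: m)
  case Nil
  then show ?case by (auto simp: monom_at_def)
next
  case (Cons i \<beta>)
  have "test_function (\<lambda>\<xi>. \<i> / (2 * pi) * partial i m \<xi>)"
    by (intro test_function_cmult test_function_partial Cons.prems)
  from Cons.IH[OF this] obtain m' where m': "test_function m'"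
    "\<And>x. monom_at \<beta> x *\<^sub>R inv_fourier (\<lambda>\<xi>. \<i> / (2 * pi) * partial i m \<xi>) x = inv_fourier m' x" by blast
  have "monom_at (i # \<beta>) x *\<^sub>R inv_fourier m x = inv_fourier m' x" for x
    unfolding m'(2)[symmetric] coord_inv_fourier[OF Cons.prems, symmetric]
    by (simp add: monom_at_def scaleR_conv_of_real)
  then show ?case using m'(1) by blast
qed

lemma partials_inv_fourier_test_function:
  fixes m :: "real ^ 'n::finite \<Rightarrow> complex"
  shows "test_function m \<Longrightarrow> \<exists>m'. test_function m' \<and> partials \<beta> (inv_fourier m) = inv_fourier m'"
proof (induction \<beta>)
  case (Cons i \<beta>)
  then obtain m' where m': "test_function m'" "partials \<beta> (inv_fourier m) = inv_fourier m'" by blast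
  then show ?case
    using partial_inv_fourier[OF test_function_rapid[OF m'(1)], of i] test_function_cmult[OF test_function_coord[OF m'(1)]]
    by auto
qed auto

text \<open>Derivatives become coordinate factors and monomials become derivatives of the
  multiplier; both keep it a test function, and an inverse transform is bounded by the L1 norm of
  its argument.\<close>

lemma schwartz_inv_fourier:
  fixes m :: "real ^ 'n::finite \<Rightarrow> complex"
  assumes m: "test_function m" shows "schwartz (inv_fourier m)"
  unfolding schwartz_def
proof (intro conjI allI)
  show "smooth (inv_fourier m)" by (rule smooth_inv_fourier[OF test_function_rapid[OF m]])
  fix \<beta> \<gamma> :: "'n list"
  obtain m' where m': "test_function m'" "partials \<gamma> (inv_fourier m) = inv_fourier m'"
    using partials_inv_fourier_test_function[OF m] by blast
  obtain m'' where m'': "test_function m''" "\<And>x. monom_at \<beta> x *\<^sub>R inv_fourier m' x = inv_fourier m'' x"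
    using test_function_coord_inv_fourier[OF m'(1)] by blast
  show "bounded (range (\<lambda>x. monom_at \<beta> x *\<^sub>R partials \<gamma> (inv_fourier m) x))"
    unfolding m' m'' bounded_iff using norm_inv_fourier_le by blast
qed

section \<open>Schwartz functions in terms of polynomial weights\<close>

lemma abs_monom_at_le: fixes x :: "real ^ 'n::finite" shows "\<bar>monom_at \<beta> x\<bar> \<le> (1 + norm x) ^ length \<beta>"
proof (induction \<beta>)
  case (Cons i \<beta>)
  have "\<bar>x $ i\<bar> * \<bar>monom_at \<beta> x\<bar> \<le> (1 + norm x) * (1 + norm x) ^ length \<beta>"
    using component_le_norm_cart[of x i] Cons by (intro mult_mono) auto
  then show ?case by (simp add: monom_at_def abs_mult)
qed (simp add: monom_at_def)

lemma norm_le_component: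
  fixes x :: "real ^ 'n::finite"
  obtains i where "norm x \<le> CARD('n) * \<bar>x $ i\<bar>"
proof -
  define M where "M = Max (range (\<lambda>i. \<bar>x $ i\<bar>))"
  have "M \<in> range (\<lambda>i. \<bar>x $ i\<bar>)" unfolding M_def by (intro Max_in) auto
  then obtain i where i: "M = \<bar>x $ i\<bar>" by auto
  have "norm x \<le> (\<Sum>i\<in>UNIV. \<bar>x $ i\<bar>)" by (rule norm_le_l1_cart)
  also have "\<dots> \<le> of_nat (card (UNIV::'n set)) * M" unfolding M_def by (intro sum_bounded_above Max_ge) auto
  finally show ?thesis using i that by simp
qed

text \<open>Up to constants the weight is at most 1 plus the \<open>N\<close>-th power of the
  largest coordinate, so the multi-indices \<open>[]\<close> and \<open>replicate N i\<close>
  control it.\<close>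

lemma schwartz_decay:
  fixes \<psi> :: "real ^ 'n::finite \<Rightarrow> complex"
  assumes "schwartz \<psi>" shows "\<exists>C. \<forall>x. (1 + norm x) ^ N * norm (partials \<gamma> \<psi> x) \<le> C"
proof -
  have "\<exists>C. \<forall>x. norm (monom_at \<beta> x *\<^sub>R partials \<gamma> \<psi> x) \<le> C" for \<beta>
    using assms unfolding schwartz_def bounded_iff by blast
  then obtain c where c: "\<And>\<beta> x. norm (monom_at \<beta> x *\<^sub>R partials \<gamma> \<psi> x) \<le> c \<beta>" by metis
  define C where "C = 2 ^ N * (c [] + real CARD('n) ^ N * (\<Sum>i\<in>UNIV. c (replicate N i)))"
  have c0: "0 \<le> c \<beta>" for \<beta> using norm_ge_zero c order.trans by blast
  have "(1 + norm x) ^ N * norm (partials \<gamma> \<psi> x) \<le> C" for x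
  proof -
    obtain i where i: "norm x \<le> CARD('n) * \<bar>x $ i\<bar>" by (rule norm_le_component)
    have "(1 + norm x) ^ N \<le> (2 * max 1 (norm x)) ^ N" by (intro power_mono) auto
    also have "\<dots> = 2 ^ N * max 1 (norm x) ^ N" by (rule power_mult_distrib)
    also have "max 1 (norm x) ^ N \<le> 1 + norm x ^ N" by (auto simp: max_def)
    also have "norm x ^ N \<le> (CARD('n) * \<bar>x $ i\<bar>) ^ N" using i by (intro power_mono) auto
    finally have "(1 + norm x) ^ N * norm (partials \<gamma> \<psi> x) \<le> 2 ^ N * (1 + (CARD('n) * \<bar>x $ i\<bar>) ^ N) * norm (partials \<gamma> \<psi> x)"
      by (intro mult_right_mono) auto
    also have "\<dots> = 2 ^ N * (norm (monom_at [] x *\<^sub>R partials \<gamma> \<psi> x) + real CARD('n) ^ N * norm (monom_at (replicate N i) x *\<^sub>R partials \<gamma> \<psi> x))"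
      by (simp add: monom_at_def power_mult_distrib power_abs algebra_simps prod_list_replicate)
    also have "\<dots> \<le> C"
      unfolding C_def
      using c member_le_sum[of i UNIV "\<lambda>i. c (replicate N i)"] c0
      by (intro mult_left_mono add_mono order.trans[OF c]) auto
    finally show ?thesis .
  qed
  then show ?thesis by blast
qed

lemma schwartzI:
  fixes \<psi> :: "real ^ 'n::finite \<Rightarrow> complex"
  assumes "smooth \<psi>" and "\<And>N \<gamma>. \<exists>C. \<forall>x. (1 + norm x) ^ N * norm (partials \<gamma> \<psi> x) \<le> C"
  shows "schwartz \<psi>"
  unfolding schwartz_def
proof (intro conjI allI)
  fix \<beta> \<gamma> :: "'n list"
  obtain C where C: "\<And>x. (1 + norm x) ^ length \<beta> * norm (partials \<gamma> \<psi> x) \<le> C" using assms(2) by blast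
  have "norm (monom_at \<beta> x *\<^sub>R partials \<gamma> \<psi> x) \<le> C" for x
    using mult_right_mono[OF abs_monom_at_le[of \<beta> x], of "norm (partials \<gamma> \<psi> x)"] C[of x] by simp
  then show "bounded (range (\<lambda>x. monom_at \<beta> x *\<^sub>R partials \<gamma> \<psi> x))" unfolding bounded_iff by blast
qed (rule assms)

lemma test_function_schwartz: "test_function m \<Longrightarrow> schwartz m"
  by (intro schwartzI test_function_smooth test_function_decay test_function_partials)

lemma schwartz_smooth: "schwartz \<psi> \<Longrightarrow> smooth \<psi>"
  by (simp add: schwartz_def)

lemma schwartz_rapid: "schwartz \<psi> \<Longrightarrow> rapid \<psi>"
  using schwartz_decay[of \<psi> _ "[]"] by (intro rapid_decay smooth_borel_measurable schwartz_smooth) auto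

lemma schwartz_cmult:
  assumes "schwartz \<psi>" shows "schwartz (\<lambda>x. c * \<psi> x)"
proof (rule schwartzI)
  fix N \<gamma>
  obtain C where "\<And>x. (1 + norm x) ^ N * norm (partials \<gamma> \<psi> x) \<le> C" using schwartz_decay[OF assms] by blast
  then have "(1 + norm x) ^ N * norm (partials \<gamma> (\<lambda>x. c * \<psi> x) x) \<le> norm c * C" for x
    using mult_left_mono[of "(1 + norm x) ^ N * norm (partials \<gamma> \<psi> x)" C "norm c"] assms
    by (simp add: partials_cmult schwartz_smooth norm_mult mult_ac)
  then show "\<exists>C. \<forall>x. (1 + norm x) ^ N * norm (partials \<gamma> (\<lambda>x. c * \<psi> x) x) \<le> C" by blast
qed (simp add: smooth_cmult schwartz_smooth assms)

lemma schwartz_add: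
  assumes "schwartz \<phi>" "schwartz \<psi>" shows "schwartz (\<lambda>x. \<phi> x + \<psi> x)"
proof (rule schwartzI)
  fix N \<gamma>
  obtain C D where "\<And>x. (1 + norm x) ^ N * norm (partials \<gamma> \<phi> x) \<le> C" "\<And>x. (1 + norm x) ^ N * norm (partials \<gamma> \<psi> x) \<le> D"
    using schwartz_decay[OF assms(1)] schwartz_decay[OF assms(2)] by metis
  moreover have "(1 + norm x) ^ N * norm (partials \<gamma> \<phi> x + partials \<gamma> \<psi> x)
      \<le> (1 + norm x) ^ N * norm (partials \<gamma> \<phi> x) + (1 + norm x) ^ N * norm (partials \<gamma> \<psi> x)" for x
    unfolding distrib_left[symmetric] by (intro mult_left_mono norm_triangle_ineq) auto
  ultimately have "(1 + norm x) ^ N * norm (partials \<gamma> (\<lambda>x. \<phi> x + \<psi> x) x) \<le> C + D" for x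
    unfolding partials_add[OF assms[THEN schwartz_smooth]] using add_mono order.trans by meson
  then show "\<exists>C. \<forall>x. (1 + norm x) ^ N * norm (partials \<gamma> (\<lambda>x. \<phi> x + \<psi> x) x) \<le> C" by blast
qed (simp add: smooth_add schwartz_smooth assms)

lemma schwartz_diff: "schwartz \<phi> \<Longrightarrow> schwartz \<psi> \<Longrightarrow> schwartz (\<lambda>x. \<phi> x - \<psi> x)"
  using schwartz_add[of \<phi> "\<lambda>x. (-1) * \<psi> x"] schwartz_cmult[of \<psi> "-1"] by simp

lemma schwartz_sum: "(\<And>i. i \<in> A \<Longrightarrow> schwartz (f i)) \<Longrightarrow> schwartz (\<lambda>x. \<Sum>i\<in>A. f i x)"
proof (induction A rule: infinite_finite_induct)
  case (insert a A)
  then show ?case by (simp add: schwartz_add)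
qed (auto intro!: test_function_schwartz simp: test_function_def smooth_const)

lemma one_plus_norm_add_le: "1 + norm (x + y) \<le> (1 + norm x) * (1 + norm y)"
proof -
  have "norm (x + y) \<le> norm x + norm y" by (rule norm_triangle_ineq)
  moreover have "0 \<le> norm x * norm y" by simp
  ultimately show ?thesis by (simp only: distrib_left distrib_right mult_1 mult_1_right)
qed

lemma partials_reflect: "smooth \<psi> \<Longrightarrow> partials \<gamma> (\<lambda>y. \<psi> (x - y)) = (\<lambda>y. (-1) ^ length \<gamma> * partials \<gamma> \<psi> (x - y))"
  using partials_affine_comp[of \<psi> \<gamma> "-1" x] by simp

lemma schwartz_reflect:
  assumes "schwartz \<psi>" shows "schwartz (\<lambda>y. \<psi> (x - y))"
proof (rule schwartzI)
  show "smooth (\<lambda>y. \<psi> (x - y))" using smooth_affine_comp[OF schwartz_smooth[OF assms], of "-1" x] by simp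
  fix N \<gamma>
  obtain C where C: "\<And>x. (1 + norm x) ^ N * norm (partials \<gamma> \<psi> x) \<le> C" using schwartz_decay[OF assms] by blast
  have "(1 + norm y) ^ N * norm (partials \<gamma> (\<lambda>y. \<psi> (x - y)) y) \<le> (1 + norm x) ^ N * C" for y
  proof -
    have "(1 + norm y) ^ N \<le> ((1 + norm x) * (1 + norm (x - y))) ^ N"
      using one_plus_norm_add_le[of x "y - x"] by (intro power_mono) (auto simp: norm_minus_commute)
    then have "(1 + norm y) ^ N * norm (partials \<gamma> \<psi> (x - y)) \<le> (1 + norm x) ^ N * ((1 + norm (x - y)) ^ N * norm (partials \<gamma> \<psi> (x - y)))"
      by (simp add: power_mult_distrib mult.assoc[symmetric] mult_right_mono)
    also have "\<dots> \<le> (1 + norm x) ^ N * C" by (intro mult_left_mono C) auto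
    finally show ?thesis by (simp add: partials_reflect[OF schwartz_smooth[OF assms]] norm_mult norm_power)
  qed
  then show "\<exists>C. \<forall>y. (1 + norm y) ^ N * norm (partials \<gamma> (\<lambda>y. \<psi> (x - y)) y) \<le> C" by blast
qed

section \<open>Changes of variables and Fubini's theorem for Fourier integrals\<close>

lemma lborel_affine_integrable:
  fixes f :: "'a::euclidean_space \<Rightarrow> 'b::{banach, second_countable_topology}"
  assumes f: "integrable lborel f" and c: "c \<noteq> 0"
  shows "integrable lborel (\<lambda>x. f (t + c *\<^sub>R x))"
    and "(LINT x|lborel. f x) = \<bar>c\<bar> ^ DIM('a) *\<^sub>R (LINT x|lborel. f (t + c *\<^sub>R x))"
proof -
  have [measurable]: "f \<in> borel_measurable borel" using f by auto
  have m: "(\<lambda>x. t + c *\<^sub>R x) \<in> lborel \<rightarrow>\<^sub>M borel" by simp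
  have "integrable (density (distr lborel borel (\<lambda>x. t + c *\<^sub>R x)) (\<lambda>_. ennreal (\<bar>c\<bar> ^ DIM('a)))) f"
    using f lborel_affine[OF c, of t] by simp
  then have "integrable (distr lborel borel (\<lambda>x. t + c *\<^sub>R x)) (\<lambda>x. \<bar>c\<bar> ^ DIM('a) *\<^sub>R f x)"
    by (subst (asm) integrable_density) auto
  then have "integrable lborel (\<lambda>x. \<bar>c\<bar> ^ DIM('a) *\<^sub>R f (t + c *\<^sub>R x))"
    by (subst (asm) integrable_distr_eq) auto
  from integrable_scaleR_right[OF this, of "inverse (\<bar>c\<bar> ^ DIM('a))"]
  show "integrable lborel (\<lambda>x. f (t + c *\<^sub>R x))" using c by simp
  have "(LINT x|lborel. f x) = (LINT x|density (distr lborel borel (\<lambda>x. t + c *\<^sub>R x)) (\<lambda>_. ennreal (\<bar>c\<bar> ^ DIM('a))). f x)"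
    using lborel_affine[OF c, of t] by simp
  also have "\<dots> = (LINT x|distr lborel borel (\<lambda>x. t + c *\<^sub>R x). \<bar>c\<bar> ^ DIM('a) *\<^sub>R f x)"
    by (rule integral_density) auto
  also have "\<dots> = (LINT x|lborel. \<bar>c\<bar> ^ DIM('a) *\<^sub>R f (t + c *\<^sub>R x))"
    by (rule integral_distr[OF m]) auto
  finally show "(LINT x|lborel. f x) = \<bar>c\<bar> ^ DIM('a) *\<^sub>R (LINT x|lborel. f (t + c *\<^sub>R x))" by simp
qed

lemma fourier_kernel_integrable:
  fixes f g :: "real ^ 'n::finite \<Rightarrow> complex"
  assumes f: "integrable lborel f" and g: "integrable lborel g"
  shows "integrable (lborel \<Otimes>\<^sub>M lborel) (\<lambda>(x, \<xi>). cis (2 * pi * (x \<bullet> \<xi>)) * f \<xi> * g x)"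
proof (rule lborel_pair.Fubini_integrable)
  have [measurable]: "f \<in> borel_measurable borel" "g \<in> borel_measurable borel" using f g by auto
  have "continuous_on UNIV (\<lambda>p::(real ^ 'n) \<times> (real ^ 'n). cis (2 * pi * (fst p \<bullet> snd p)))"
    by (intro continuous_intros)
  then have [measurable]: "(\<lambda>p::(real ^ 'n) \<times> (real ^ 'n). cis (2 * pi * (fst p \<bullet> snd p))) \<in> borel_measurable (borel \<Otimes>\<^sub>M borel)"
    unfolding borel_prod by (rule borel_measurable_continuous_onI)
  show "(\<lambda>(x, \<xi>). cis (2 * pi * (x \<bullet> \<xi>)) * f \<xi> * g x) \<in> borel_measurable (lborel \<Otimes>\<^sub>M lborel)"
    unfolding split_beta by measurable
  have "integrable lborel (\<lambda>x. (LINT y|lborel. norm (f y)) * norm (g x))"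
    using g by (intro integrable_mult_right integrable_norm)
  moreover have "(LINT y|lborel. norm (f y) * norm (g x)) = (LINT y|lborel. norm (f y)) * norm (g x)" for x
    by (rule integral_mult_left_zero)
  ultimately show "integrable lborel (\<lambda>x. LINT y|lborel. norm (case (x, y) of (x, \<xi>) \<Rightarrow> cis (2 * pi * (x \<bullet> \<xi>)) * f \<xi> * g x))"
    by (simp add: norm_mult)
  have "integrable lborel (\<lambda>\<xi>. cis (2 * pi * (x \<bullet> \<xi>)) * f \<xi>)" for x
    by (rule Bochner_Integration.integrable_bound[OF f]) (auto simp: norm_mult)
  then show "AE x in lborel. integrable lborel (\<lambda>y. case (x, y) of (x, \<xi>) \<Rightarrow> cis (2 * pi * (x \<bullet> \<xi>)) * f \<xi> * g x)"
    by (intro AE_I2) simp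
qed

lemma inv_fourier_multiplication_formula:
  fixes f g :: "real ^ 'n::finite \<Rightarrow> complex"
  assumes f: "integrable lborel f" and g: "integrable lborel g"
  shows "(LINT x|lborel. inv_fourier f x * g x) = (LINT \<xi>|lborel. f \<xi> * inv_fourier g \<xi>)"
proof -
  have "(LINT \<xi>|lborel. LINT x|lborel. cis (2 * pi * (x \<bullet> \<xi>)) * f \<xi> * g x) =
      (LINT x|lborel. LINT \<xi>|lborel. cis (2 * pi * (x \<bullet> \<xi>)) * f \<xi> * g x)"
    by (rule lborel_pair.Fubini_integral[OF fourier_kernel_integrable[OF f g]])
  moreover have "(LINT \<xi>|lborel. cis (2 * pi * (x \<bullet> \<xi>)) * f \<xi> * g x) = inv_fourier f x * g x" for x
    unfolding inv_fourier_def by (rule integral_mult_left_zero)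
  moreover have "(LINT x|lborel. cis (2 * pi * (x \<bullet> \<xi>)) * f \<xi> * g x) = f \<xi> * inv_fourier g \<xi>" for \<xi>
    unfolding inv_fourier_def integral_mult_right_zero[symmetric]
    by (intro Bochner_Integration.integral_cong) (simp_all add: inner_commute mult_ac)
  ultimately show ?thesis by (simp only:)
qed

lemma inv_fourier_modulation:
  "inv_fourier (\<lambda>\<xi>. cis (2 * pi * (y \<bullet> \<xi>)) * f \<xi>) x = inv_fourier f (x + y)"
  unfolding inv_fourier_def by (simp add: mult.assoc[symmetric] cis_mult inner_add_left distrib_left)

lemma inv_fourier_modulation_minus:
  "inv_fourier (\<lambda>\<xi>. cis (- (2 * pi * (y \<bullet> \<xi>))) * f \<xi>) x = inv_fourier f (x - y)"
  using inv_fourier_modulation[of "- y" f x] by simp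

lemma inv_fourier_cmult: "inv_fourier (\<lambda>\<xi>. c * f \<xi>) x = c * inv_fourier f x"
  unfolding inv_fourier_def integral_mult_right_zero[symmetric] by (simp add: mult_ac)

lemma inv_fourier_dilate:
  fixes f :: "real ^ 'n::finite \<Rightarrow> complex"
  assumes f: "integrable lborel f" and s: "0 < s"
  shows "inv_fourier (\<lambda>\<xi>. f ((1 / s) *\<^sub>R \<xi>)) x = of_real (s ^ CARD('n)) * inv_fourier f (s *\<^sub>R x)"
proof -
  let ?g = "\<lambda>\<xi>. cis (2 * pi * (x \<bullet> \<xi>)) * f ((1 / s) *\<^sub>R \<xi>)"
  have [measurable]: "f \<in> borel_measurable borel" using f by auto
  have "integrable lborel (\<lambda>\<xi>. f ((1 / s) *\<^sub>R \<xi>))"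
    using lborel_affine_integrable(1)[OF f, of "1 / s" 0] s by simp
  then have "integrable lborel ?g"
    by (rule Bochner_Integration.integrable_bound) (auto simp: norm_mult)
  from lborel_affine_integrable(2)[OF this, of s 0] s
  have "(LINT \<xi>|lborel. ?g \<xi>) = s ^ CARD('n) *\<^sub>R (LINT \<xi>|lborel. ?g (s *\<^sub>R \<xi>))" by simp
  also have "(\<lambda>\<xi>. ?g (s *\<^sub>R \<xi>)) = (\<lambda>\<xi>. cis (2 * pi * ((s *\<^sub>R x) \<bullet> \<xi>)) * f \<xi>)" using s by simp
  finally show ?thesis unfolding inv_fourier_def scaleR_conv_of_real[where 'a=complex] .
qed

section \<open>Gaussians and Fourier inversion\<close>

text \<open>After rescaling by \<open>sqrt (2 * pi)\<close> this is the characteristic function of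
  the standard normal distribution.\<close>

lemma gaussian_integral_1d:
  fixes t :: real
  shows "integrable lborel (\<lambda>x. cis (2 * pi * (t * x)) * exp (- pi * x\<^sup>2))"
    and "(LINT x|lborel. cis (2 * pi * (t * x)) * exp (- pi * x\<^sup>2)) = exp (- pi * t\<^sup>2)"
proof -
  define c where "c = sqrt (2 * pi)"
  have c: "0 < c" "c\<^sup>2 = 2 * pi" by (simp_all add: c_def)
  define f where "f y = std_normal_density y *\<^sub>R iexp ((c * t) * y)" for y
  have *: "f (0 + c * x) = of_real (1 / c) * (cis (2 * pi * (t * x)) * exp (- pi * x\<^sup>2))" for x
  proof -
    have "(c * t) * (c * x) = 2 * pi * (t * x)" "(c * x)\<^sup>2 / 2 = pi * x\<^sup>2"
      using c by (simp_all add: power_mult_distrib power2_eq_square)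
    moreover have "f (0 + c * x) = of_real (1 / c * exp (- ((c * x)\<^sup>2 / 2))) * cis ((c * t) * (c * x))"
      by (simp add: f_def std_normal_density_def c_def[symmetric] cis_conv_exp scaleR_conv_of_real)
    ultimately show ?thesis by (simp only:) simp
  qed
  have int: "integrable lborel f"
  proof (rule Bochner_Integration.integrable_bound)
    show "integrable lborel std_normal_density" by (rule integrable_normal_density) simp
    have "(\<lambda>y. iexp ((c * t) * y)) \<in> borel_measurable borel"
      by (intro borel_measurable_continuous_onI continuous_intros)
    then show "f \<in> borel_measurable lborel" unfolding f_def by measurable
  qed (auto simp: f_def)
  have "integrable lborel (\<lambda>x. f (0 + c * x))" using lborel_integrable_real_affine[OF int, of c 0] c by simp
  from integrable_mult_right[OF this, of "of_real c"]
  show "integrable lborel (\<lambda>x. cis (2 * pi * (t * x)) * exp (- pi * x\<^sup>2))"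
    unfolding * using c by simp
  have "exp (- pi * t\<^sup>2) = char std_normal_distribution (c * t)"
  proof -
    have "(c * t)\<^sup>2 / 2 = pi * t\<^sup>2" using c by (simp add: power_mult_distrib)
    then show ?thesis by (simp add: char_std_normal_distribution)
  qed
  also have "\<dots> = (LINT x|lborel. f x)"
    unfolding char_def f_def by (rule integral_density) (auto intro!: borel_measurable_continuous_onI continuous_intros)
  also have "\<dots> = c *\<^sub>R (LINT x|lborel. f (0 + c * x))"
    using lborel_integral_real_affine[of c f 0] c by simp
  also have "\<dots> = (LINT x|lborel. cis (2 * pi * (t * x)) * exp (- pi * x\<^sup>2))"
    unfolding * integral_mult_right_zero using c by (simp add: scaleR_conv_of_real)
  finally show "(LINT x|lborel. cis (2 * pi * (t * x)) * exp (- pi * x\<^sup>2)) = exp (- pi * t\<^sup>2)" ..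
qed

definition gaussian :: "real ^ 'n::finite \<Rightarrow> complex" where
  "gaussian x = of_real (exp (- pi * (norm x)\<^sup>2))"

lemma gaussian_measurable [measurable]: "gaussian \<in> borel_measurable borel"
  unfolding gaussian_def by measurable

text \<open>Lebesgue measure is the image of a product measure, and the Gaussian and the exponential
  factor over the coordinates, so the one-dimensional formula applies in each of them.\<close>

lemma inv_fourier_gaussian: "inv_fourier gaussian = (gaussian :: real ^ 'n::finite \<Rightarrow> complex)"
proof
  fix y :: "real ^ 'n"
  let ?\<phi> = "\<lambda>b s. cis (2 * pi * ((y \<bullet> b) * s)) * of_real (exp (- pi * s\<^sup>2))"
  let ?P = "Pi\<^sub>M (Basis :: (real ^ 'n) set) (\<lambda>_. lborel :: real measure)"
  let ?T = "\<lambda>f. \<Sum>b\<in>(Basis :: (real ^ 'n) set). f b *\<^sub>R b"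
  interpret product_sigma_finite "\<lambda>_::real ^ 'n. lborel :: real measure" ..
  have prod: "cis (2 * pi * (y \<bullet> x)) * gaussian x = (\<Prod>b\<in>Basis. ?\<phi> b (x \<bullet> b))" for x
  proof -
    have "2 * pi * (y \<bullet> x) = (\<Sum>b\<in>Basis. 2 * pi * ((y \<bullet> b) * (x \<bullet> b)))"
      by (simp add: euclidean_inner[of y x] sum_distrib_left)
    then have "cis (2 * pi * (y \<bullet> x)) = (\<Prod>b\<in>Basis. cis (2 * pi * ((y \<bullet> b) * (x \<bullet> b))))"
      by (simp add: cis_conv_exp exp_sum sum_distrib_left)
    moreover have "- pi * (norm x)\<^sup>2 = (\<Sum>b\<in>Basis. - pi * (x \<bullet> b)\<^sup>2)"
      unfolding norm_eq_sqrt_inner euclidean_inner[of x x] by (simp add: sum_nonneg power2_eq_square sum_distrib_left)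
    then have "gaussian x = (\<Prod>b\<in>Basis. of_real (exp (- pi * (x \<bullet> b)\<^sup>2)))"
      by (simp only: gaussian_def exp_sum finite_Basis of_real_prod)
    ultimately show ?thesis by (simp only: prod.distrib)
  qed
  have T: "?T f \<bullet> b = f b" if "b \<in> Basis" for f and b :: "real ^ 'n"
    using that by (simp add: inner_sum_left inner_Basis if_distrib cong: if_cong)
  have lb: "(lborel :: (real ^ 'n) measure) = distr ?P borel ?T" by (rule lborel_eq)
  have "inv_fourier gaussian y = (LINT x|lborel. (\<Prod>b\<in>Basis. ?\<phi> b (x \<bullet> b)))"
    unfolding inv_fourier_def prod ..
  also have "\<dots> = (LINT x|(distr ?P borel ?T). (\<Prod>b\<in>Basis. ?\<phi> b (x \<bullet> b)))"
    by (rule arg_cong[OF lb])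
  also have "\<dots> = (LINT f|?P. (\<Prod>b\<in>Basis. ?\<phi> b (?T f \<bullet> b)))"
    by (rule integral_distr) (auto intro!: borel_measurable_continuous_onI continuous_intros)
  also have "\<dots> = (LINT f|?P. (\<Prod>b\<in>Basis. ?\<phi> b (f b)))"
    by (intro Bochner_Integration.integral_cong refl prod.cong) (simp add: T)
  also have "\<dots> = (\<Prod>b\<in>Basis. LINT s|lborel. ?\<phi> b s)"
    by (rule product_integral_prod) (use gaussian_integral_1d(1) in auto)
  also have "\<dots> = (\<Prod>b\<in>Basis. ?\<phi> 0 (y \<bullet> b))"
    using gaussian_integral_1d(2) by (intro prod.cong refl) (simp add: exp_of_real)
  also have "\<dots> = gaussian y"
  proof -
    have "- pi * (norm y)\<^sup>2 = (\<Sum>b\<in>Basis. - pi * (y \<bullet> b)\<^sup>2)"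
      unfolding norm_eq_sqrt_inner euclidean_inner[of y y] by (simp add: sum_nonneg power2_eq_square sum_distrib_left)
    then have "gaussian y = (\<Prod>b\<in>Basis. of_real (exp (- pi * (y \<bullet> b)\<^sup>2)))"
      by (simp only: gaussian_def exp_sum finite_Basis of_real_prod)
    then show ?thesis by simp
  qed
  finally show "inv_fourier gaussian y = gaussian y" .
qed

lemma rapid_gaussian: "rapid gaussian"
proof (rule rapid_decay)
  fix N
  have "(1 + norm x) ^ N * norm (gaussian x :: complex) \<le> fact N * exp 2" for x :: "real ^ 'n"
  proof -
    define r where "r = norm x"
    have r: "0 \<le> r" by (simp add: r_def)
    \<comment> \<open>A single term of the exponential series dominates the weight, and the Gaussian
      absorbs \<open>exp (1 + r)\<close> because
      \<open>1 + r - pi * r\<^sup>2 \<le> 2\<close>.\<close>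
    have "(\<Sum>k\<in>{N}. (1 + r) ^ k /\<^sub>R fact k) \<le> exp (1 + r)"
      unfolding exp_def using r by (intro sum_le_suminf summable_exp_generic) auto
    then have "(1 + r) ^ N / fact N \<le> exp (1 + r)" by (simp add: divide_inverse mult.commute)
    then have "(1 + r) ^ N \<le> fact N * exp (1 + r)" by (simp add: divide_le_eq mult.commute)
    then have "(1 + r) ^ N * exp (- pi * r\<^sup>2) \<le> fact N * exp (1 + r) * exp (- pi * r\<^sup>2)"
      by (intro mult_right_mono) auto
    also have "\<dots> = fact N * exp (1 + r - pi * r\<^sup>2)" by (simp add: exp_diff exp_minus divide_inverse)
    also have "1 + r - pi * r\<^sup>2 \<le> 2"
    proof -
      have "r \<le> 1 + r\<^sup>2" using zero_le_power2[of "r - 1"] r by (simp add: power2_diff)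
      moreover have "1 * r\<^sup>2 \<le> pi * r\<^sup>2" using pi_gt3 by (intro mult_right_mono) auto
      ultimately show ?thesis by simp
    qed
    finally show ?thesis by (simp add: gaussian_def r_def)
  qed
  then show "\<exists>C. \<forall>x::real ^ 'n. (1 + norm x) ^ N * norm (gaussian x :: complex) \<le> C" by blast
qed measurable

text \<open>The double integral of the inversion formula does not converge absolutely, so a Gaussian
  of growing width \<open>s k\<close> is inserted. The multiplication formula turns it into a
  Gaussian that concentrates at \<open>\<xi>\<close> and is integrated against \<open>m\<close>;
  then both sides have limits.\<close>

lemma fourier_inv_fourier:
  fixes m :: "real ^ 'n::finite \<Rightarrow> complex"
  assumes m: "test_function m"
  shows "fourier (inv_fourier m) = m"
proof
  fix \<xi> :: "real ^ 'n"
  have im: "integrable lborel m" "integrable lborel (inv_fourier m)"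
    using rapid_integrable test_function_rapid[OF m] schwartz_rapid[OF schwartz_inv_fourier[OF m]] by blast+
  have ig: "integrable lborel (gaussian :: real ^ 'n \<Rightarrow> complex)" by (rule rapid_integrable[OF rapid_gaussian])
  have [measurable]: "m \<in> borel_measurable borel" "inv_fourier m \<in> borel_measurable borel" using im by auto
  have mcont: "continuous_on UNIV m" using m by (simp add: test_function_smooth smooth_continuous_on)
  obtain C where C: "\<And>x. norm (m x) \<le> C" using test_function_bounded[OF m] by metis
  define s where "s k = real (Suc k)" for k
  have s: "0 < s k" for k by (simp add: s_def)
  have s0: "(\<lambda>k. 1 / s k) \<longlonglongrightarrow> 0" unfolding s_def using LIMSEQ_inverse_real_of_nat by (simp add: inverse_eq_divide)
  have eq: "(LINT x|lborel. inv_fourier m x * (cis (- (2 * pi * (\<xi> \<bullet> x))) * gaussian ((1 / s k) *\<^sub>R x)))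
     = (LINT \<zeta>|lborel. m (\<xi> + (1 / s k) *\<^sub>R \<zeta>) * gaussian \<zeta>)" for k
  proof -
    let ?G = "\<lambda>x::real ^ 'n. gaussian ((1 / s k) *\<^sub>R x) :: complex"
    have iG: "integrable lborel (\<lambda>x. ?G x)" using lborel_affine_integrable(1)[OF ig, of "1 / s k" 0] s[of k] by simp
    have iG': "integrable lborel (\<lambda>x. cis (- (2 * pi * (\<xi> \<bullet> x))) * ?G x)"
      by (rule Bochner_Integration.integrable_bound[OF iG])
         (auto simp: norm_mult intro!: borel_measurable_times borel_measurable_continuous_onI[of "\<lambda>x. cis (- (2 * pi * (\<xi> \<bullet> x)))"] continuous_intros)
    have "(LINT x|lborel. inv_fourier m x * (cis (- (2 * pi * (\<xi> \<bullet> x))) * ?G x))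
        = (LINT \<eta>|lborel. m \<eta> * (of_real (s k ^ CARD('n)) * gaussian (s k *\<^sub>R (\<eta> - \<xi>))))"
      by (subst inv_fourier_multiplication_formula[OF im(1) iG'])
         (simp only: inv_fourier_modulation_minus inv_fourier_dilate[OF ig s] inv_fourier_gaussian)
    also have "\<dots> = (1 / s k) ^ CARD('n) *\<^sub>R (LINT \<zeta>|lborel. m (\<xi> + (1 / s k) *\<^sub>R \<zeta>) * (of_real (s k ^ CARD('n)) * gaussian (s k *\<^sub>R (\<xi> + (1 / s k) *\<^sub>R \<zeta> - \<xi>))))"
    proof -
      have "integrable lborel (\<lambda>\<eta>. m \<eta> * (of_real (s k ^ CARD('n)) * gaussian (s k *\<^sub>R (\<eta> - \<xi>))))"
      proof (rule Bochner_Integration.integrable_bound[OF integrable_mult_right[OF im(1), of "of_real (s k ^ CARD('n))"]])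
        show "AE \<eta> in lborel. norm (m \<eta> * (of_real (s k ^ CARD('n)) * gaussian (s k *\<^sub>R (\<eta> - \<xi>)))) \<le> norm (of_real (s k ^ CARD('n)) * m \<eta>)"
        proof (rule AE_I2)
          fix \<eta>
          have "norm (m \<eta>) * (s k ^ CARD('n) * norm (gaussian (s k *\<^sub>R (\<eta> - \<xi>)) :: complex)) \<le> norm (m \<eta>) * (s k ^ CARD('n) * 1)"
            using s[of k] by (intro mult_left_mono) (auto simp: gaussian_def)
          then show "norm (m \<eta> * (of_real (s k ^ CARD('n)) * gaussian (s k *\<^sub>R (\<eta> - \<xi>)))) \<le> norm (of_real (s k ^ CARD('n)) * m \<eta>)"
            using s[of k] by (simp add: norm_mult norm_power mult_ac)
        qed
      qed measurable
      from lborel_affine_integrable(2)[OF this, of "1 / s k" \<xi>] s[of k] show ?thesis by simp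
    qed
    also have "\<dots> = (LINT \<zeta>|lborel. m (\<xi> + (1 / s k) *\<^sub>R \<zeta>) * gaussian \<zeta>)"
    proof -
      have "m (\<xi> + (1 / s k) *\<^sub>R \<zeta>) * (of_real (s k ^ CARD('n)) * gaussian (s k *\<^sub>R (\<xi> + (1 / s k) *\<^sub>R \<zeta> - \<xi>)))
        = of_real (s k ^ CARD('n)) * (m (\<xi> + (1 / s k) *\<^sub>R \<zeta>) * gaussian \<zeta>)" for \<zeta>
        using s[of k] by simp
      then have "(1 / s k) ^ CARD('n) *\<^sub>R (LINT \<zeta>|lborel. m (\<xi> + (1 / s k) *\<^sub>R \<zeta>) * (of_real (s k ^ CARD('n)) * gaussian (s k *\<^sub>R (\<xi> + (1 / s k) *\<^sub>R \<zeta> - \<xi>))))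
        = of_real ((1 / s k) ^ CARD('n) * s k ^ CARD('n)) * (LINT \<zeta>|lborel. m (\<xi> + (1 / s k) *\<^sub>R \<zeta>) * gaussian \<zeta>)"
        by (simp only: integral_mult_right_zero scaleR_conv_of_real[where 'a=complex] of_real_mult mult.assoc)
      also have "(1 / s k) ^ CARD('n) * s k ^ CARD('n) = 1" using s[of k] by (simp add: power_mult_distrib[symmetric])
      finally show ?thesis by (simp only: mult_1 of_real_1)
    qed
    finally show ?thesis .
  qed
  \<comment> \<open>The widening Gaussian tends to 1 pointwise, which gives the transform at
    \<open>\<xi>\<close>.\<close>
  have "(\<lambda>k. LINT x|lborel. inv_fourier m x * (cis (- (2 * pi * (\<xi> \<bullet> x))) * gaussian ((1 / s k) *\<^sub>R x)))
      \<longlonglongrightarrow> (LINT x|lborel. inv_fourier m x * (cis (- (2 * pi * (\<xi> \<bullet> x))) * 1))"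
  proof (rule integral_dominated_convergence[where w="\<lambda>x. norm (inv_fourier m x)"])
    show "integrable lborel (\<lambda>x. norm (inv_fourier m x))" using im(2) by (rule integrable_norm)
    have "(\<lambda>k. gaussian ((1 / s k) *\<^sub>R x) :: complex) \<longlonglongrightarrow> of_real (exp (- pi * (norm (0 *\<^sub>R x))\<^sup>2))" for x :: "real ^ 'n"
      unfolding gaussian_def by (intro tendsto_intros s0)
    then show "AE x in lborel. (\<lambda>k. inv_fourier m x * (cis (- (2 * pi * (\<xi> \<bullet> x))) * gaussian ((1 / s k) *\<^sub>R x))) \<longlonglongrightarrow>
        inv_fourier m x * (cis (- (2 * pi * (\<xi> \<bullet> x))) * 1)"
      by (intro AE_I2 tendsto_mult tendsto_const) simp
    show "AE x in lborel. norm (inv_fourier m x * (cis (- (2 * pi * (\<xi> \<bullet> x))) * gaussian ((1 / s k) *\<^sub>R x))) \<le> norm (inv_fourier m x)" for k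
      by (intro AE_I2) (auto simp: norm_mult gaussian_def mult_left_le)
  qed (auto intro!: borel_measurable_times borel_measurable_continuous_onI[of "\<lambda>x. cis (- (2 * pi * (\<xi> \<bullet> x)))"] continuous_intros)
  moreover have "(LINT x|lborel. inv_fourier m x * (cis (- (2 * pi * (\<xi> \<bullet> x))) * 1)) = fourier (inv_fourier m) \<xi>"
    by (simp add: fourier_def inner_commute mult.commute)
  ultimately have 1: "(\<lambda>k. LINT \<zeta>|lborel. m (\<xi> + (1 / s k) *\<^sub>R \<zeta>) * gaussian \<zeta>) \<longlonglongrightarrow> fourier (inv_fourier m) \<xi>"
    unfolding eq by simp
  \<comment> \<open>The concentrating Gaussian gives \<open>m \<xi>\<close> by continuity; its total
    mass is 1, because it is its own transform and has the value 1 at 0.\<close>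
  have "(\<lambda>k. LINT \<zeta>|lborel. m (\<xi> + (1 / s k) *\<^sub>R \<zeta>) * gaussian \<zeta>) \<longlonglongrightarrow> (LINT \<zeta>|lborel. m \<xi> * gaussian (\<zeta> :: real ^ 'n))"
  proof (rule integral_dominated_convergence[where w="\<lambda>\<zeta>::real ^ 'n. C * norm (gaussian \<zeta> :: complex)"])
    show "integrable lborel (\<lambda>\<zeta>::real ^ 'n. C * norm (gaussian \<zeta> :: complex))"
      using ig by (intro integrable_mult_right integrable_norm)
    have "(\<lambda>k. m (\<xi> + (1 / s k) *\<^sub>R \<zeta>)) \<longlonglongrightarrow> m \<xi>" for \<zeta>
    proof -
      have "(\<lambda>k. \<xi> + (1 / s k) *\<^sub>R \<zeta>) \<longlonglongrightarrow> \<xi> + 0 *\<^sub>R \<zeta>" by (intro tendsto_intros s0)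
      moreover have "isCont m \<xi>" using mcont by (simp add: continuous_on_eq_continuous_at)
      ultimately show ?thesis using isCont_tendsto_compose by fastforce
    qed
    then show "AE \<zeta> in lborel. (\<lambda>k. m (\<xi> + (1 / s k) *\<^sub>R \<zeta>) * gaussian \<zeta>) \<longlonglongrightarrow> m \<xi> * gaussian \<zeta>"
      by (intro AE_I2 tendsto_mult tendsto_const)
    show "AE \<zeta> in lborel. norm (m (\<xi> + (1 / s k) *\<^sub>R \<zeta>) * gaussian \<zeta>) \<le> C * norm (gaussian \<zeta> :: complex)" for k
      by (intro AE_I2) (auto simp: norm_mult intro!: mult_right_mono C)
  qed measurable
  moreover have "(LINT \<zeta>|lborel. m \<xi> * gaussian (\<zeta> :: real ^ 'n)) = m \<xi>"
  proof -
    have "(LINT \<zeta>|lborel. gaussian (\<zeta> :: real ^ 'n)) = inv_fourier gaussian (0 :: real ^ 'n)" by (simp add: inv_fourier_def)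
    then show ?thesis by (simp add: inv_fourier_gaussian gaussian_def)
  qed
  ultimately have "(\<lambda>k. LINT \<zeta>|lborel. m (\<xi> + (1 / s k) *\<^sub>R \<zeta>) * gaussian \<zeta>) \<longlonglongrightarrow> m \<xi>" by (simp only:)
  then show "fourier (inv_fourier m) \<xi> = m \<xi>" by (rule LIMSEQ_unique[OF 1])
qed

section \<open>Convolutions with tempered distributions\<close>

lemma multi_indices_finite: "finite {\<beta> :: 'n::finite list. length \<beta> \<le> N}"
  using finite_lists_length_le[of "UNIV :: 'n set" N] by simp

text \<open>The number of terms in the double sum of \<open>schwartz_norm N\<close>, by which a
  bound for the single terms has to be multiplied.\<close>

definition schwartz_const :: "'n::finite itself \<Rightarrow> nat \<Rightarrow> real" where
  "schwartz_const _ N = (real (card {\<beta> :: 'n list. length \<beta> \<le> N}))\<^sup>2"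

lemma schwartz_norm_le:
  fixes \<phi> :: "real ^ 'n::finite \<Rightarrow> complex"
  assumes "\<And>\<gamma> y. length \<gamma> \<le> N \<Longrightarrow> (1 + norm y) ^ N * norm (partials \<gamma> \<phi> y) \<le> B"
  shows "schwartz_norm N \<phi> \<le> schwartz_const TYPE('n) N * B"
proof -
  let ?L = "{\<beta> :: 'n list. length \<beta> \<le> N}"
  have "(SUP x. norm (monom_at \<beta> x *\<^sub>R partials \<gamma> \<phi> x)) \<le> B" if "\<beta> \<in> ?L" "\<gamma> \<in> ?L" for \<beta> \<gamma>
  proof (rule cSUP_least)
    fix x
    have "\<bar>monom_at \<beta> x\<bar> \<le> (1 + norm x) ^ N"
      using that by (intro order.trans[OF abs_monom_at_le power_increasing]) auto
    then have "norm (monom_at \<beta> x *\<^sub>R partials \<gamma> \<phi> x) \<le> (1 + norm x) ^ N * norm (partials \<gamma> \<phi> x)"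
      by (simp add: mult_right_mono)
    also have "\<dots> \<le> B" using assms that by simp
    finally show "norm (monom_at \<beta> x *\<^sub>R partials \<gamma> \<phi> x) \<le> B" .
  qed simp
  then have "schwartz_norm N \<phi> \<le> (\<Sum>\<beta>\<in>?L. \<Sum>\<gamma>\<in>?L. B)"
    unfolding schwartz_norm_def by (intro sum_mono) auto
  also have "\<dots> = schwartz_const TYPE('n) N * B"
    by (simp add: schwartz_const_def power2_eq_square)
  finally show ?thesis .
qed

lemma schwartz_uniform_decay:
  fixes \<psi> :: "real ^ 'n::finite \<Rightarrow> complex"
  assumes "schwartz \<psi>"
  obtains K where "0 \<le> K" "\<And>\<gamma> x. length \<gamma> \<le> M \<Longrightarrow> (1 + norm x) ^ N * norm (partials \<gamma> \<psi> x) \<le> K"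
proof -
  obtain c where c: "\<And>\<gamma> x. (1 + norm x) ^ N * norm (partials \<gamma> \<psi> x) \<le> c \<gamma>"
    using schwartz_decay[OF assms] by metis
  have "(1 + norm x) ^ N * norm (partials \<gamma> \<psi> x) \<le> (\<Sum>\<gamma> | length \<gamma> \<le> M. \<bar>c \<gamma>\<bar>)" if "length \<gamma> \<le> M" for \<gamma> x
  proof -
    have "\<bar>c \<gamma>\<bar> \<le> (\<Sum>\<gamma> | length \<gamma> \<le> M. \<bar>c \<gamma>\<bar>)"
      using that by (intro member_le_sum) (auto simp: multi_indices_finite)
    then show ?thesis using c[of x \<gamma>] by linarith
  qed
  moreover have "0 \<le> (\<Sum>\<gamma> | length \<gamma> \<le> M. \<bar>c \<gamma>\<bar>)" by (intro sum_nonneg) auto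
  ultimately show ?thesis using that by blast
qed

lemma closed_segment_norm_le:
  fixes z z' :: "'a::real_normed_vector"
  assumes "p \<in> closed_segment z z'"
  shows "1 + norm p \<le> (1 + norm z) * (1 + norm z')"
proof -
  obtain t where t: "p = (1 - t) *\<^sub>R z + t *\<^sub>R z'" "0 \<le> t" "t \<le> 1" using assms by (auto simp: in_segment)
  have "norm p \<le> norm ((1 - t) *\<^sub>R z) + norm (t *\<^sub>R z')" unfolding t(1) by (rule norm_triangle_ineq)
  also have "\<dots> \<le> norm z + norm z'" using t by (intro add_mono) (auto simp: mult_left_le_one_le)
  finally have "norm p \<le> norm z + norm z'" .
  moreover have "0 \<le> norm z * norm z'" by simp
  ultimately show ?thesis by (simp only: distrib_left distrib_right mult_1 mult_1_right)
qed

text \<open>The dependence of \<open>\<lambda>y. \<Phi> (z - y)\<close> on \<open>z\<close>,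
  measured by the quantities that bound \<open>schwartz_norm N\<close>. The inequality
  \<open>one_plus_norm_add_le\<close> moves the weight in \<open>y\<close> to a polynomial factor in
  \<open>z\<close>; the Lipschitz estimate follows from the mean value inequality at the price of
  one more derivative, hence \<open>Suc N\<close>.\<close>

lemma reflect_translate_estimates:
  fixes \<Phi> :: "real ^ 'n::finite \<Rightarrow> complex"
  assumes \<Phi>: "schwartz \<Phi>"
  obtains K where "0 \<le> K"
    "\<And>\<gamma> y z z'. length \<gamma> \<le> N \<Longrightarrow> (1 + norm y) ^ N * norm (partials \<gamma> \<Phi> (z - y) - partials \<gamma> \<Phi> (z' - y))
        \<le> K * ((1 + norm z) * (1 + norm z')) ^ N * norm (z - z')"
    "\<And>\<gamma> y z. length \<gamma> \<le> N \<Longrightarrow> (1 + norm y) ^ N * norm (partials \<gamma> \<Phi> (z - y)) \<le> K * (1 + norm z) ^ N"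
proof -
  obtain K where K: "0 \<le> K" "\<And>\<gamma> x. length \<gamma> \<le> Suc N \<Longrightarrow> (1 + norm x) ^ N * norm (partials \<gamma> \<Phi> x) \<le> K"
    using schwartz_uniform_decay[OF \<Phi>] by metis
  have shift: "(1 + norm y) ^ N * norm (partials \<gamma> \<Phi> (p - y)) \<le> (1 + norm p) ^ N * K" if "length \<gamma> \<le> Suc N" for \<gamma> y p
  proof -
    have "(1 + norm y) ^ N \<le> ((1 + norm p) * (1 + norm (p - y))) ^ N"
      using one_plus_norm_add_le[of p "y - p"] by (intro power_mono) (auto simp: norm_minus_commute)
    then have "(1 + norm y) ^ N * norm (partials \<gamma> \<Phi> (p - y)) \<le> (1 + norm p) ^ N * ((1 + norm (p - y)) ^ N * norm (partials \<gamma> \<Phi> (p - y)))"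
      by (simp add: power_mult_distrib mult.assoc[symmetric] mult_right_mono)
    also have "\<dots> \<le> (1 + norm p) ^ N * K" by (intro mult_left_mono K that) auto
    finally show ?thesis .
  qed
  define K' where "K' = K * (1 + CARD('n))"
  have KK': "K \<le> K'" "K * CARD('n) \<le> K'" using K(1) by (auto simp: K'_def distrib_left)
  show ?thesis
  proof (rule that[of K'])
    show "0 \<le> K'" using K KK' by linarith
    fix \<gamma> :: "'n list" and y z z' :: "real ^ 'n" assume \<gamma>: "length \<gamma> \<le> N"
    have "(1 + norm y) ^ N * norm (partials \<gamma> \<Phi> (z - y)) \<le> (1 + norm z) ^ N * K" using shift \<gamma> by simp
    also have "\<dots> \<le> K' * (1 + norm z) ^ N" using mult_right_mono[OF KK'(1), of "(1 + norm z) ^ N"] by (simp add: mult.commute)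
    finally show "(1 + norm y) ^ N * norm (partials \<gamma> \<Phi> (z - y)) \<le> K' * (1 + norm z) ^ N" .
    have y: "0 < (1 + norm y) ^ N" by (intro zero_less_power add_pos_nonneg) auto
    let ?B = "((1 + norm z) * (1 + norm z')) ^ N * K / (1 + norm y) ^ N"
    have incr: "norm (partials \<gamma> \<Phi> (z - y) - partials \<gamma> \<Phi> (z' - y)) \<le> ?B * CARD('n) * norm ((z - y) - (z' - y))"
    proof (rule smooth_increment_bound)
      show "smooth (partials \<gamma> \<Phi>)" by (rule smooth_partials[OF schwartz_smooth[OF \<Phi>]])
      fix i w assume "w \<in> closed_segment (z - y) (z' - y)"
      then have w: "w + y \<in> closed_segment z z'"
        using closed_segment_translation_eq[of y w "z - y" "z' - y"] by (simp add: add.commute)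
      have "(1 + norm y) ^ N * norm (partials (i # \<gamma>) \<Phi> ((w + y) - y)) \<le> (1 + norm (w + y)) ^ N * K"
        using \<gamma> by (intro shift) simp
      also have "\<dots> \<le> ((1 + norm z) * (1 + norm z')) ^ N * K"
        using closed_segment_norm_le[OF w] K(1) by (intro mult_right_mono power_mono) auto
      finally show "norm (partial i (partials \<gamma> \<Phi>) w) \<le> ?B" using y by (simp add: pos_le_divide_eq mult.commute)
    qed
    have "(1 + norm y) ^ N * norm (partials \<gamma> \<Phi> (z - y) - partials \<gamma> \<Phi> (z' - y))
        \<le> ((1 + norm z) * (1 + norm z')) ^ N * (K * CARD('n)) * norm (z - z')"
    proof -
      have "1 + norm y \<noteq> 0" using norm_ge_zero[of y] by linarith
      then have "(1 + norm y) ^ N * (?B * CARD('n) * norm ((z - y) - (z' - y))) = ((1 + norm z) * (1 + norm z')) ^ N * (K * CARD('n)) * norm (z - z')"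
        by simp
      then show ?thesis
        using mult_left_mono[OF incr, of "(1 + norm y) ^ N"] y by (simp only: less_imp_le)
    qed
    also have "\<dots> \<le> ((1 + norm z) * (1 + norm z')) ^ N * K' * norm (z - z')"
      by (intro mult_right_mono mult_left_mono KK') auto
    finally show "(1 + norm y) ^ N * norm (partials \<gamma> \<Phi> (z - y) - partials \<gamma> \<Phi> (z' - y))
        \<le> K' * ((1 + norm z) * (1 + norm z')) ^ N * norm (z - z')" by (simp add: mult_ac)
  qed
qed

section \<open>Growth and continuity of convolutions with tempered distributions\<close>

lemma tempered_bound:
  assumes "tempered u"
  obtains C N where "0 \<le> C" "\<And>\<phi>. schwartz \<phi> \<Longrightarrow> norm (u \<phi>) \<le> C * schwartz_norm N \<phi>"
proof -
  obtain C N where C: "\<And>\<phi>. schwartz \<phi> \<Longrightarrow> norm (u \<phi>) \<le> C * schwartz_norm N \<phi>"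
    using assms unfolding tempered_def by blast
  have "0 \<le> schwartz_norm N \<phi>" if "schwartz \<phi>" for \<phi> :: "real ^ 'a \<Rightarrow> complex"
    unfolding schwartz_norm_def
  proof (intro sum_nonneg)
    fix \<beta> \<gamma> :: "'a list"
    have "bdd_above (range (\<lambda>x. norm (monom_at \<beta> x *\<^sub>R partials \<gamma> \<phi> x)))"
      using that unfolding schwartz_def bounded_iff bdd_above_def by blast
    then show "0 \<le> (SUP x. norm (monom_at \<beta> x *\<^sub>R partials \<gamma> \<phi> x))"
      by (rule cSUP_upper2[of _ _ _ 0]) auto
  qed
  then have "norm (u \<phi>) \<le> \<bar>C\<bar> * schwartz_norm N \<phi>" if "schwartz \<phi>" for \<phi>
    using C[OF that] that by (meson abs_ge_self mult_right_mono order.trans)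
  then show ?thesis using that[of "\<bar>C\<bar>"] by auto
qed

lemma tempered_add: "tempered u \<Longrightarrow> schwartz \<phi> \<Longrightarrow> schwartz \<psi> \<Longrightarrow> u (\<lambda>x. \<phi> x + \<psi> x) = u \<phi> + u \<psi>"
  by (simp add: tempered_def)

lemma tempered_cmult: "tempered u \<Longrightarrow> schwartz \<phi> \<Longrightarrow> u (\<lambda>x. c * \<phi> x) = c * u \<phi>"
  by (simp add: tempered_def)

lemma tempered_diff:
  "tempered u \<Longrightarrow> schwartz \<phi> \<Longrightarrow> schwartz \<psi> \<Longrightarrow> u (\<lambda>x. \<phi> x - \<psi> x) = u \<phi> - u \<psi>"
  using tempered_add[of u \<phi> "\<lambda>x. (-1) * \<psi> x"] tempered_cmult[of u \<psi> "-1"] schwartz_cmult[of \<psi> "-1"] by simp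

lemma tempered_sum:
  assumes "tempered u" "\<And>i. i \<in> A \<Longrightarrow> schwartz (f i)" "finite A"
  shows "u (\<lambda>x. \<Sum>i\<in>A. f i x) = (\<Sum>i\<in>A. u (f i))"
  using assms(3,2)
proof (induction A)
  case empty
  show ?case using tempered_cmult[OF assms(1), of "\<lambda>_. 0" 0] test_function_schwartz[of "\<lambda>_. 0"]
    by (auto simp: test_function_def smooth_const)
next
  case (insert a A)
  then show ?case using tempered_add[OF assms(1), of "f a" "\<lambda>x. \<Sum>i\<in>A. f i x"] schwartz_sum[of A f] by simp
qed

text \<open>The seminorm bound of \<open>u\<close> is applied to translates of
  \<open>\<Phi>\<close>. The Lipschitz part yields continuity, the growth bound integrability
  against Schwartz functions.\<close>

lemma convol_growth:
  fixes \<Phi> :: "real ^ 'n::finite \<Rightarrow> complex"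
  assumes u: "tempered u" and \<Phi>: "schwartz \<Phi>"
  obtains K N where "0 \<le> K"
    "\<And>z z'. norm (convol \<Phi> u z - convol \<Phi> u z') \<le> K * ((1 + norm z) * (1 + norm z')) ^ N * norm (z - z')"
    "\<And>z. norm (convol \<Phi> u z) \<le> K * (1 + norm z) ^ N"
proof -
  obtain C N where C: "0 \<le> C" "\<And>\<phi>. schwartz \<phi> \<Longrightarrow> norm (u \<phi>) \<le> C * schwartz_norm N \<phi>"
    using tempered_bound[OF u] by metis
  obtain K where K: "0 \<le> K"
    "\<And>\<gamma> y z z'. length \<gamma> \<le> N \<Longrightarrow> (1 + norm y) ^ N * norm (partials \<gamma> \<Phi> (z - y) - partials \<gamma> \<Phi> (z' - y))
        \<le> K * ((1 + norm z) * (1 + norm z')) ^ N * norm (z - z')"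
    "\<And>\<gamma> y z. length \<gamma> \<le> N \<Longrightarrow> (1 + norm y) ^ N * norm (partials \<gamma> \<Phi> (z - y)) \<le> K * (1 + norm z) ^ N"
    using reflect_translate_estimates[OF \<Phi>] by metis
  let ?c = "schwartz_const TYPE('n) N"
  have c: "0 \<le> ?c" by (simp add: schwartz_const_def)
  note sm = schwartz_smooth[OF \<Phi>]
  note smr = schwartz_smooth[OF schwartz_reflect[OF \<Phi>]]
  show ?thesis
  proof (rule that[of "C * (?c * K)" N])
    show "0 \<le> C * (?c * K)" using C c K by simp
    fix z z' :: "real ^ 'n"
    have "convol \<Phi> u z - convol \<Phi> u z' = u (\<lambda>y. \<Phi> (z - y) - \<Phi> (z' - y))"
      unfolding convol_def by (rule tempered_diff[OF u schwartz_reflect[OF \<Phi>] schwartz_reflect[OF \<Phi>], symmetric])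
    also have "norm \<dots> \<le> C * schwartz_norm N (\<lambda>y. \<Phi> (z - y) - \<Phi> (z' - y))"
      by (intro C schwartz_diff schwartz_reflect \<Phi>)
    also have "schwartz_norm N (\<lambda>y. \<Phi> (z - y) - \<Phi> (z' - y)) \<le> ?c * (K * ((1 + norm z) * (1 + norm z')) ^ N * norm (z - z'))"
    proof (rule schwartz_norm_le)
      fix \<gamma> :: "'n list" and y assume "length \<gamma> \<le> N"
      moreover have "norm (partials \<gamma> (\<lambda>y. \<Phi> (z - y) - \<Phi> (z' - y)) y) = norm (partials \<gamma> \<Phi> (z - y) - partials \<gamma> \<Phi> (z' - y))"
        unfolding partials_diff[OF smr smr] partials_reflect[OF sm] right_diff_distrib[symmetric] norm_mult norm_power
        by simp
      ultimately show "(1 + norm y) ^ N * norm (partials \<gamma> (\<lambda>y. \<Phi> (z - y) - \<Phi> (z' - y)) y)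
         \<le> K * ((1 + norm z) * (1 + norm z')) ^ N * norm (z - z')" using K(2) by simp
    qed
    finally show "norm (convol \<Phi> u z - convol \<Phi> u z') \<le> C * (?c * K) * ((1 + norm z) * (1 + norm z')) ^ N * norm (z - z')"
      using C(1) by (simp add: mult_left_mono mult.assoc)
    have "norm (convol \<Phi> u z) \<le> C * schwartz_norm N (\<lambda>y. \<Phi> (z - y))"
      unfolding convol_def by (intro C schwartz_reflect \<Phi>)
    also have "schwartz_norm N (\<lambda>y. \<Phi> (z - y)) \<le> ?c * (K * (1 + norm z) ^ N)"
    proof (rule schwartz_norm_le)
      fix \<gamma> :: "'n list" and y assume "length \<gamma> \<le> N"
      then show "(1 + norm y) ^ N * norm (partials \<gamma> (\<lambda>y. \<Phi> (z - y)) y) \<le> K * (1 + norm z) ^ N"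
        using K(3) by (simp add: partials_reflect[OF sm] norm_mult norm_power)
    qed
    finally show "norm (convol \<Phi> u z) \<le> C * (?c * K) * (1 + norm z) ^ N"
      using C(1) by (simp add: mult_left_mono mult.assoc)
  qed
qed

lemma convol_continuous:
  assumes u: "tempered u" and \<Phi>: "schwartz \<Phi>"
  shows "continuous_on UNIV (convol \<Phi> u)"
  unfolding continuous_on_def
proof
  fix z :: "real ^ 'a"
  obtain K N where K: "0 \<le> K"
    "\<And>z z'. norm (convol \<Phi> u z - convol \<Phi> u z') \<le> K * ((1 + norm z) * (1 + norm z')) ^ N * norm (z - z')"
    using convol_growth[OF u \<Phi>] by metis
  have "((\<lambda>z'. K * ((1 + norm z') * (1 + norm z)) ^ N * norm (z' - z)) \<longlongrightarrow> K * ((1 + norm z) * (1 + norm z)) ^ N * norm (z - z)) (at z)"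
    by (intro tendsto_intros)
  then have "((\<lambda>z'. K * ((1 + norm z') * (1 + norm z)) ^ N * norm (z' - z)) \<longlongrightarrow> 0) (at z)" by simp
  then have "((\<lambda>z'. convol \<Phi> u z' - convol \<Phi> u z) \<longlongrightarrow> 0) (at z)"
    by (rule Lim_null_comparison[rotated]) (simp add: K)
  then show "(convol \<Phi> u \<longlongrightarrow> convol \<Phi> u z) (at z within UNIV)" by (rule LIM_zero_cancel)
qed

lemma convol_mult_integrable:
  assumes u: "tempered u" and \<Phi>: "schwartz \<Phi>" and \<psi>: "schwartz \<psi>"
  shows "integrable lborel (\<lambda>z. convol \<Phi> u z * \<psi> z)"
proof -
  obtain K N where "\<And>z. norm (convol \<Phi> u z) \<le> K * (1 + norm z) ^ N" using convol_growth[OF u \<Phi>] by metis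
  then show ?thesis
    by (intro rapid_integrable_mult[OF schwartz_rapid[OF \<psi>]] borel_measurable_continuous_onI convol_continuous[OF u \<Phi>])
qed

text \<open>Replacing \<open>z\<close> by a simple function turns an integral over \<open>z\<close>
  into a finite combination, to which a functional can be applied by linearity alone.\<close>

lemma simple_function_integral_sum:
  fixes s :: "'a::euclidean_space \<Rightarrow> 'b" and F :: "'b \<Rightarrow> complex"
  assumes s: "simple_function lborel s" and \<psi>: "integrable lborel \<psi>"
  shows "integrable lborel (\<lambda>z. F (s z) * \<psi> z)"
    and "(LINT z|lborel. F (s z) * \<psi> z) = (\<Sum>v\<in>range s. (LINT z|lborel. indicator (s -` {v}) z * \<psi> z) * F v)"
proof -
  have fin: "finite (range s)" using s by (simp add: simple_function_def)
  have meas[measurable]: "s -` {v} \<in> sets borel" for v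
    using simple_functionD(2)[OF s, of "{v}"] by simp
  have int: "integrable lborel (\<lambda>z. indicator (s -` {v}) z * \<psi> z)" for v
  proof (rule Bochner_Integration.integrable_bound[OF \<psi>])
    have "\<psi> \<in> borel_measurable lborel" using \<psi> by auto
    then show "(\<lambda>z. indicator (s -` {v}) z * \<psi> z) \<in> borel_measurable lborel"
      by (intro borel_measurable_times borel_measurable_indicator) (use meas[of v] in auto)
  qed (auto simp: indicator_def)
  have *: "F (s z) * \<psi> z = (\<Sum>v\<in>range s. indicator (s -` {v}) z * \<psi> z * F v)" for z
  proof -
    have "(\<Sum>v\<in>range s. indicator (s -` {v}) z * \<psi> z * F v) = (\<Sum>v\<in>range s. if s z = v then \<psi> z * F v else 0)"
      by (rule sum.cong) (auto simp: indicator_def)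
    also have "\<dots> = \<psi> z * F (s z)" using fin by (simp add: sum.delta)
    finally show ?thesis by (simp add: mult.commute)
  qed
  show "integrable lborel (\<lambda>z. F (s z) * \<psi> z)"
    unfolding * by (intro Bochner_Integration.integrable_sum integrable_mult_left int)
  show "(LINT z|lborel. F (s z) * \<psi> z) = (\<Sum>v\<in>range s. (LINT z|lborel. indicator (s -` {v}) z * \<psi> z) * F v)"
    unfolding * by (subst Bochner_Integration.integral_sum) (auto intro!: integrable_mult_left int)
qed

text \<open>In this form the convolution is the transform of a test function, which makes it a
  Schwartz function and gives access to its derivatives.\<close>

lemma convolution_eq_fourier:
  fixes m \<psi> :: "real ^ 'n::finite \<Rightarrow> complex"
  assumes m: "test_function m" and \<psi>: "rapid \<psi>"
  shows "(LINT z|lborel. inv_fourier m (z - y) * \<psi> z) = fourier (\<lambda>\<xi>. inv_fourier \<psi> \<xi> * m \<xi>) y"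
proof -
  have "integrable lborel (\<lambda>\<xi>. cis (2 * pi * (- y \<bullet> \<xi>)) * m \<xi>)"
    by (rule rapid_integrable[OF rapid_cis[OF test_function_rapid[OF m]]])
  then have "(LINT z|lborel. inv_fourier (\<lambda>\<xi>. cis (- (2 * pi * (y \<bullet> \<xi>))) * m \<xi>) z * \<psi> z)
      = (LINT \<xi>|lborel. (cis (- (2 * pi * (y \<bullet> \<xi>))) * m \<xi>) * inv_fourier \<psi> \<xi>)"
    by (intro inv_fourier_multiplication_formula rapid_integrable[OF \<psi>]) simp
  then show ?thesis
    unfolding inv_fourier_modulation_minus by (simp add: fourier_def inner_commute mult_ac)
qed

lemma partial_fourier:
  assumes g: "rapid g"
  shows "partial i (fourier g) = (\<lambda>y. - fourier (\<lambda>\<xi>. 2 * pi * \<i> * (of_real (\<xi> $ i) * g \<xi>)) y)"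
proof -
  have "partial i (\<lambda>x. inv_fourier g ((-1) *\<^sub>R x + 0)) = (\<lambda>x. of_real (-1) * partial i (inv_fourier g) ((-1) *\<^sub>R x + 0))"
    by (rule partial_affine_comp[OF smooth_inv_fourier[OF g]])
  then show ?thesis by (simp add: fourier_eq_inv_fourier partial_inv_fourier[OF g])
qed

text \<open>The induction carries along the multiplier of the differentiated kernel, so
  differentiation under the integral reduces to that of a Fourier transform; each derivative in
  \<open>y\<close> reverses the sign.\<close>

lemma partials_convolution:
  fixes m \<psi> :: "real ^ 'n::finite \<Rightarrow> complex"
  assumes m: "test_function m" and \<psi>: "rapid \<psi>"
  shows "\<exists>m'. test_function m' \<and> partials \<gamma> (inv_fourier m) = inv_fourier m' \<and>
    partials \<gamma> (\<lambda>y. LINT z|lborel. inv_fourier m (z - y) * \<psi> z)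
      = (\<lambda>y. (-1) ^ length \<gamma> * (LINT z|lborel. inv_fourier m' (z - y) * \<psi> z))"
proof (induction \<gamma>)
  case Nil
  then show ?case using m by auto
next
  case (Cons i \<gamma>)
  then obtain m' where m': "test_function m'" "partials \<gamma> (inv_fourier m) = inv_fourier m'"
    "partials \<gamma> (\<lambda>y. LINT z|lborel. inv_fourier m (z - y) * \<psi> z)
      = (\<lambda>y. (-1) ^ length \<gamma> * (LINT z|lborel. inv_fourier m' (z - y) * \<psi> z))" by blast
  let ?m = "\<lambda>\<xi>. 2 * pi * \<i> * (of_real (\<xi> $ i) * m' \<xi>)"
  have t: "test_function ?m" by (intro test_function_cmult test_function_coord m')
  have g: "test_function (\<lambda>\<xi>. inv_fourier \<psi> \<xi> * m' \<xi>)"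
    by (intro test_function_mult m' smooth_inv_fourier \<psi>)
  have "partials (i # \<gamma>) (\<lambda>y. LINT z|lborel. inv_fourier m (z - y) * \<psi> z)
      = (\<lambda>y. (-1) ^ length \<gamma> * partial i (fourier (\<lambda>\<xi>. inv_fourier \<psi> \<xi> * m' \<xi>)) y)"
    unfolding partials.simps m'(3) convolution_eq_fourier[OF m'(1) \<psi>]
    by (intro partial_cmult smooth_fourier test_function_rapid g)
  also have "\<dots> = (\<lambda>y. (-1) ^ length (i # \<gamma>) * (LINT z|lborel. inv_fourier ?m (z - y) * \<psi> z))"
    unfolding partial_fourier[OF test_function_rapid[OF g]] convolution_eq_fourier[OF t \<psi>]
    by (simp add: mult_ac)
  finally show ?case
    using t m'(2) partial_inv_fourier[OF test_function_rapid[OF m'(1)], of i] by auto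
qed

lemma schwartz_fourier: "test_function g \<Longrightarrow> schwartz (fourier g)"
  using schwartz_reflect[OF schwartz_inv_fourier, of g 0] by (simp add: fourier_eq_inv_fourier)

text \<open>The convolution \<open>y \<mapsto> \<integral> \<Phi> (z - y) \<psi> z dz\<close> is approximated, in the Schwartz seminorm that controls \<open>u\<close>, by
  the finite sums obtained when \<open>z\<close> is replaced by simple functions \<open>s j z\<close> in the argument of \<open>\<Phi>\<close>.\<close>

theorem tempered_convolution_exchange:
  fixes m \<psi> :: "real ^ 'n::finite \<Rightarrow> complex"
  assumes u: "tempered u" and m: "test_function m" and \<psi>: "schwartz \<psi>"
  shows "u (\<lambda>y. LINT z|lborel. inv_fourier m (z - y) * \<psi> z) = (LINT z|lborel. convol (inv_fourier m) u z * \<psi> z)"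
proof -
  let ?\<Phi> = "inv_fourier m"
  let ?H = "\<lambda>y. LINT z|lborel. ?\<Phi> (z - y) * \<psi> z"
  let ?F = "convol ?\<Phi> u"
  have \<Phi>: "schwartz ?\<Phi>" by (rule schwartz_inv_fourier[OF m])
  note r = schwartz_rapid[OF \<psi>]
  have [measurable]: "\<psi> \<in> borel_measurable borel" by (rule rapid_measurable[OF r])
  have i\<psi>: "integrable lborel \<psi>" by (rule rapid_integrable[OF r])
  have H: "schwartz ?H"
    unfolding convolution_eq_fourier[OF m r]
    by (intro schwartz_fourier test_function_mult m smooth_inv_fourier r)
  obtain C N where C: "0 \<le> C" "\<And>\<phi>. schwartz \<phi> \<Longrightarrow> norm (u \<phi>) \<le> C * schwartz_norm N \<phi>"
    using tempered_bound[OF u] by metis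
  obtain K where K: "0 \<le> K"
    "\<And>\<gamma> y z z'. length \<gamma> \<le> N \<Longrightarrow> (1 + norm y) ^ N * norm (partials \<gamma> ?\<Phi> (z - y) - partials \<gamma> ?\<Phi> (z' - y))
        \<le> K * ((1 + norm z) * (1 + norm z')) ^ N * norm (z - z')"
    using reflect_translate_estimates[OF \<Phi>] by metis
  let ?c = "schwartz_const TYPE('n) N"
  have c0: "0 \<le> ?c" by (simp add: schwartz_const_def)
  obtain s where s: "\<And>j. simple_function lborel (s j)" "\<And>z::real ^ 'n. (\<lambda>j. s j z) \<longlonglongrightarrow> z"
    "\<And>j z. norm (s j z) \<le> 2 * norm z"
    using borel_measurable_implies_sequence_metric[of "\<lambda>z::real ^ 'n. z" lborel 0] by auto
  have s1: "1 + norm (s j z) \<le> 2 * (1 + norm z)" for j z using s(3)[of j z] by simp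
  have meas_s[measurable]: "s j \<in> borel_measurable borel" for j
    using borel_measurable_simple_function[OF s(1)[of j]] by simp
  \<comment> \<open>The integrand of the error, in the seminorm that controls \<open>u\<close>, made
    by replacing \<open>z\<close> with \<open>s j z\<close>. The bound
    \<open>norm (s j z) \<le> 2 * norm z\<close> provides a majorant independent of
    \<open>j\<close>.\<close>
  define E where "E j z = K * ((1 + norm z) * (1 + norm (s j z))) ^ N * norm (z - s j z) * norm (\<psi> z)" for j z
  have E_le: "E j z \<le> K * 2 ^ N * 3 * ((1 + norm z) ^ (2 * N + 1) * norm (\<psi> z))" for j z
  proof -
    have "norm (z - s j z) \<le> 3 * (1 + norm z)" using norm_triangle_ineq4[of z "s j z"] s(3)[of j z] by simp
    moreover have "((1 + norm z) * (1 + norm (s j z))) ^ N \<le> ((1 + norm z) * (2 * (1 + norm z))) ^ N"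
      by (intro power_mono mult_left_mono s1) auto
    ultimately have "E j z \<le> K * ((1 + norm z) * (2 * (1 + norm z))) ^ N * (3 * (1 + norm z)) * norm (\<psi> z)"
      unfolding E_def using K(1) by (intro mult_right_mono mult_mono mult_left_mono) auto
    also have "\<dots> = K * 2 ^ N * 3 * ((1 + norm z) ^ (2 * N + 1) * norm (\<psi> z))"
    proof -
      have "K * (a * (2 * a)) ^ N * (3 * a) * norm (\<psi> z) = K * 2 ^ N * 3 * (a ^ (2 * N + 1) * norm (\<psi> z))" for a :: real
      proof -
        have "a ^ (2 * N + 1) = a * (a ^ N * a ^ N)" by (simp add: power_add mult_2)
        then show ?thesis by (simp only: power_mult_distrib mult_ac)
      qed
      then show ?thesis .
    qed
    finally show ?thesis .
  qed
  have E0: "0 \<le> E j z" for j z unfolding E_def using K(1) by simp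
  have iW: "integrable lborel (\<lambda>z. K * 2 ^ N * 3 * ((1 + norm z) ^ (2 * N + 1) * norm (\<psi> z)))"
    by (intro integrable_mult_right rapid_weighted_integrable r)
  have mE[measurable]: "E j \<in> borel_measurable borel" for j unfolding E_def by measurable
  have iE: "integrable lborel (E j)" for j
  proof (rule Bochner_Integration.integrable_bound[OF iW])
    show "AE z in lborel. norm (E j z) \<le> norm (K * 2 ^ N * 3 * ((1 + norm z) ^ (2 * N + 1) * norm (\<psi> z)))"
      using E_le E0 by (intro AE_I2) (simp add: abs_le_iff order.trans[OF E_le])
  qed simp
  have limE: "(\<lambda>j. LINT z|lborel. E j z) \<longlonglongrightarrow> 0"
  proof -
    have "(\<lambda>j. LINT z|lborel. E j z) \<longlonglongrightarrow> (LINT z|lborel. (\<lambda>_::real ^ 'n. 0::real) z)"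
    proof (rule integral_dominated_convergence[OF _ _ iW])
      show "AE z in lborel. (\<lambda>j. E j z) \<longlonglongrightarrow> 0"
      proof (rule AE_I2)
        fix z
        have "(\<lambda>j. E j z) \<longlonglongrightarrow> K * ((1 + norm z) * (1 + norm z)) ^ N * norm (z - z) * norm (\<psi> z)"
          unfolding E_def by (intro tendsto_intros s)
        then show "(\<lambda>j. E j z) \<longlonglongrightarrow> 0" by simp
      qed
      show "AE z in lborel. norm (E j z) \<le> K * 2 ^ N * 3 * ((1 + norm z) ^ (2 * N + 1) * norm (\<psi> z))" for j
        using E_le E0 by (intro AE_I2) simp
    qed auto
    then show ?thesis by simp
  qed
  define S where "S j y = (LINT z|lborel. ?\<Phi> (s j z - y) * \<psi> z)" for j y
  \<comment> \<open>\<open>S j\<close> is a finite combination of translates, so linearity evaluates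
    \<open>u\<close> on it, and its distance from \<open>?H\<close> in the seminorm is controlled by
    the integral of \<open>E j\<close>.\<close>
  have bound: "norm (u ?H - (LINT z|lborel. ?F (s j z) * \<psi> z)) \<le> C * (?c * (LINT z|lborel. E j z))" for j
  proof -
    let ?w = "\<lambda>v. LINT z|lborel. indicator (s j -` {v}) z * \<psi> z"
    have fin: "finite (range (s j))" using s(1)[of j] by (simp add: simple_function_def)
    have S: "S j = (\<lambda>y. \<Sum>v\<in>range (s j). ?w v * ?\<Phi> (v - y))"
    proof
      fix y
      show "S j y = (\<Sum>v\<in>range (s j). ?w v * ?\<Phi> (v - y))"
        unfolding S_def by (rule simple_function_integral_sum(2)[OF s(1) i\<psi>, where F="\<lambda>v. ?\<Phi> (v - y)"])
    qed
    have sS: "schwartz (S j)" unfolding S by (intro schwartz_sum schwartz_cmult schwartz_reflect \<Phi>)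
    have pS: "partials \<gamma> (S j) y = (-1) ^ length \<gamma> * (LINT z|lborel. partials \<gamma> ?\<Phi> (s j z - y) * \<psi> z)" for \<gamma> y
    proof -
      have "partials \<gamma> (\<lambda>y. \<Sum>v\<in>A. ?w v * ?\<Phi> (v - y)) y = (\<Sum>v\<in>A. ?w v * ((-1) ^ length \<gamma> * partials \<gamma> ?\<Phi> (v - y)))"
        if "finite A" for A
        using that
      proof (induction A)
        case empty
        have "partials \<gamma> (\<lambda>y. 0 * (0::complex)) = (\<lambda>y. 0 * partials \<gamma> (\<lambda>_. 0) y)"
          by (rule partials_cmult[OF smooth_const])
        then show ?case by simp
      next
        case (insert v A)
        have sm: "smooth (\<lambda>y. ?\<Phi> (v - y))" for v by (rule schwartz_smooth[OF schwartz_reflect[OF \<Phi>]])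
        have "partials \<gamma> (\<lambda>y. ?w v * ?\<Phi> (v - y) + (\<Sum>v\<in>A. ?w v * ?\<Phi> (v - y))) =
          (\<lambda>y. partials \<gamma> (\<lambda>y. ?w v * ?\<Phi> (v - y)) y + partials \<gamma> (\<lambda>y. \<Sum>v\<in>A. ?w v * ?\<Phi> (v - y)) y)"
          by (intro partials_add smooth_cmult smooth_sum sm)
        then show ?case
          using insert by (simp add: partials_cmult[OF sm] partials_reflect[OF schwartz_smooth[OF \<Phi>]])
      qed
      from this[OF fin] show ?thesis
        unfolding S simple_function_integral_sum(2)[OF s(1) i\<psi>, where F="\<lambda>v. partials \<gamma> ?\<Phi> (v - y)"]
        by (simp add: sum_distrib_left mult_ac)
    qed
    have uS: "u (S j) = (LINT z|lborel. ?F (s j z) * \<psi> z)"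
    proof -
      have "u (S j) = (\<Sum>v\<in>range (s j). u (\<lambda>y. ?w v * ?\<Phi> (v - y)))"
        unfolding S by (rule tempered_sum[OF u schwartz_cmult[OF schwartz_reflect[OF \<Phi>]] fin])
      also have "\<dots> = (\<Sum>v\<in>range (s j). ?w v * ?F v)"
        by (intro sum.cong refl) (simp add: tempered_cmult[OF u schwartz_reflect[OF \<Phi>]] convol_def)
      also have "\<dots> = (LINT z|lborel. ?F (s j z) * \<psi> z)"
        by (rule simple_function_integral_sum(2)[OF s(1) i\<psi>, symmetric])
      finally show ?thesis .
    qed
    have "norm (u ?H - u (S j)) \<le> C * schwartz_norm N (\<lambda>y. ?H y - S j y)"
      unfolding tempered_diff[OF u H sS, symmetric] by (intro C schwartz_diff H sS)
    also have "schwartz_norm N (\<lambda>y. ?H y - S j y) \<le> ?c * (LINT z|lborel. E j z)"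
    proof (rule schwartz_norm_le)
      fix \<gamma> :: "'n list" and y assume \<gamma>: "length \<gamma> \<le> N"
      obtain m' where m': "test_function m'" "partials \<gamma> ?\<Phi> = inv_fourier m'"
        "partials \<gamma> ?H = (\<lambda>y. (-1) ^ length \<gamma> * (LINT z|lborel. inv_fourier m' (z - y) * \<psi> z))"
        using partials_convolution[OF m r] by blast
      have i1: "integrable lborel (\<lambda>z. inv_fourier m' (s j z - y) * \<psi> z)"
        by (rule simple_function_integral_sum(1)[OF s(1) i\<psi>])
      have i2: "integrable lborel (\<lambda>z. inv_fourier m' (z - y) * \<psi> z)"
      proof (rule rapid_integrable_mult[OF r, where C="LINT \<xi>|lborel. norm (m' \<xi>)" and N=0])
        have "inv_fourier m' \<in> borel_measurable borel"
          by (intro smooth_borel_measurable smooth_inv_fourier test_function_rapid m')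
        then show "(\<lambda>z. inv_fourier m' (z - y)) \<in> borel_measurable borel" by measurable
      qed (simp add: norm_inv_fourier_le)
      have "norm (partials \<gamma> (\<lambda>y. ?H y - S j y) y) = norm (LINT z|lborel. inv_fourier m' (z - y) * \<psi> z - inv_fourier m' (s j z - y) * \<psi> z)"
        unfolding partials_diff[OF schwartz_smooth[OF H] schwartz_smooth[OF sS]] pS m' right_diff_distrib[symmetric]
          Bochner_Integration.integral_diff[OF i2 i1] norm_mult norm_power by simp
      also have "\<dots> \<le> (LINT z|lborel. norm (inv_fourier m' (z - y) * \<psi> z - inv_fourier m' (s j z - y) * \<psi> z))"
        by (rule integral_norm_bound)
      finally have "(1 + norm y) ^ N * norm (partials \<gamma> (\<lambda>y. ?H y - S j y) y)
          \<le> (1 + norm y) ^ N * (LINT z|lborel. norm (inv_fourier m' (z - y) * \<psi> z - inv_fourier m' (s j z - y) * \<psi> z))"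
        by (intro mult_left_mono) auto
      also have "\<dots> = (LINT z|lborel. (1 + norm y) ^ N * norm (inv_fourier m' (z - y) * \<psi> z - inv_fourier m' (s j z - y) * \<psi> z))"
        by (rule integral_mult_right_zero[symmetric])
      also have "\<dots> \<le> (LINT z|lborel. E j z)"
      proof (rule integral_mono)
        show "integrable lborel (\<lambda>z. (1 + norm y) ^ N * norm (inv_fourier m' (z - y) * \<psi> z - inv_fourier m' (s j z - y) * \<psi> z))"
          by (intro integrable_mult_right integrable_norm Bochner_Integration.integrable_diff i1 i2)
        fix z
        have "(1 + norm y) ^ N * norm (inv_fourier m' (z - y) - inv_fourier m' (s j z - y)) \<le> K * ((1 + norm z) * (1 + norm (s j z))) ^ N * norm (z - s j z)"
          using K(2)[OF \<gamma>, of y z "s j z"] by (simp add: m')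
        from mult_right_mono[OF this, of "norm (\<psi> z)"]
        show "(1 + norm y) ^ N * norm (inv_fourier m' (z - y) * \<psi> z - inv_fourier m' (s j z - y) * \<psi> z) \<le> E j z"
          unfolding left_diff_distrib[symmetric] norm_mult E_def by (simp add: mult.assoc)
      qed (rule iE)
      finally show "(1 + norm y) ^ N * norm (partials \<gamma> (\<lambda>y. ?H y - S j y) y) \<le> (LINT z|lborel. E j z)" .
    qed
    finally show ?thesis using C(1) by (simp add: uS mult_left_mono)
  qed
  have "(\<lambda>j. C * (?c * (LINT z|lborel. E j z))) \<longlonglongrightarrow> C * (?c * 0)"
    by (intro tendsto_intros limE)
  then have "(\<lambda>j. C * (?c * (LINT z|lborel. E j z))) \<longlonglongrightarrow> 0" by simp
  then have "(\<lambda>j. u ?H - (LINT z|lborel. ?F (s j z) * \<psi> z)) \<longlonglongrightarrow> 0"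
    by (rule Lim_null_comparison[OF always_eventually, rotated]) (use bound in blast)
  then have "(\<lambda>j. u ?H - (u ?H - (LINT z|lborel. ?F (s j z) * \<psi> z))) \<longlonglongrightarrow> u ?H - 0"
    by (intro tendsto_diff tendsto_const)
  then have lim1: "(\<lambda>j. LINT z|lborel. ?F (s j z) * \<psi> z) \<longlonglongrightarrow> u ?H" by simp
  obtain K' N' where K': "0 \<le> K'" "\<And>z. norm (?F z) \<le> K' * (1 + norm z) ^ N'"
    using convol_growth[OF u \<Phi>] by metis
  have Fc: "continuous_on UNIV ?F" by (rule convol_continuous[OF u \<Phi>])
  then have [measurable]: "?F \<in> borel_measurable borel" by (rule borel_measurable_continuous_onI)
  \<comment> \<open>The same integrals also converge to the right-hand side, by continuity and
    polynomial growth of the convolution; uniqueness of limits concludes.\<close>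
  have "(\<lambda>j. LINT z|lborel. ?F (s j z) * \<psi> z) \<longlonglongrightarrow> (LINT z|lborel. ?F z * \<psi> z)"
  proof (rule integral_dominated_convergence[where w="\<lambda>z. K' * 2 ^ N' * ((1 + norm z) ^ N' * norm (\<psi> z))"])
    show "integrable lborel (\<lambda>z. K' * 2 ^ N' * ((1 + norm z) ^ N' * norm (\<psi> z)))"
      by (intro integrable_mult_right rapid_weighted_integrable r)
    have "(\<lambda>j. ?F (s j z)) \<longlonglongrightarrow> ?F z" for z
      using Fc by (intro isCont_tendsto_compose[OF _ s(2)[of z]]) (simp add: continuous_on_eq_continuous_at)
    then show "AE z in lborel. (\<lambda>j. ?F (s j z) * \<psi> z) \<longlonglongrightarrow> ?F z * \<psi> z"
      by (intro AE_I2 tendsto_mult tendsto_const)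
    show "AE z in lborel. norm (?F (s j z) * \<psi> z) \<le> K' * 2 ^ N' * ((1 + norm z) ^ N' * norm (\<psi> z))" for j
    proof (rule AE_I2)
      fix z
      have "norm (?F (s j z)) \<le> K' * (1 + norm (s j z)) ^ N'" by (rule K')
      also have "\<dots> \<le> K' * (2 * (1 + norm z)) ^ N'" using K'(1) by (intro mult_left_mono power_mono s1) auto
      finally have "norm (?F (s j z)) * norm (\<psi> z) \<le> K' * (2 * (1 + norm z)) ^ N' * norm (\<psi> z)"
        by (intro mult_right_mono) auto
      then show "norm (?F (s j z) * \<psi> z) \<le> K' * 2 ^ N' * ((1 + norm z) ^ N' * norm (\<psi> z))"
        by (simp only: norm_mult power_mult_distrib mult.assoc)
    qed
  qed measurable
  from LIMSEQ_unique[OF lim1 this] show ?thesis .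
qed

section \<open>Bumps, uniqueness of representing functions, multipliers as convolutions\<close>

lemma test_function_bump:
  fixes x0 :: "real ^ 'n::finite"
  assumes "0 < \<epsilon>"
  shows "test_function (\<lambda>x. complex_of_real (cutoff 2 ((1 / \<epsilon>) *\<^sub>R (x - x0))))"
  unfolding test_function_def
proof (intro conjI exI allI impI)
  show "smooth (\<lambda>x. complex_of_real (cutoff 2 ((1 / \<epsilon>) *\<^sub>R (x - x0))))"
    using smooth_affine_comp[OF smooth_cutoff[of 2], of "1 / \<epsilon>" "- (1 / \<epsilon>) *\<^sub>R x0"]
    by (simp add: scaleR_diff_right)
  fix x :: "real ^ 'n" assume "norm x0 + 2 * \<epsilon> < norm x"
  then have "2 * \<epsilon> \<le> norm (x - x0)" using norm_triangle_ineq2[of x x0] by linarith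
  then show "complex_of_real (cutoff 2 ((1 / \<epsilon>) *\<^sub>R (x - x0))) = 0"
    using assms by (subst cutoff_eq_0) (simp_all add: pos_le_divide_eq)
qed

lemma integral_bump_pos:
  fixes x0 :: "real ^ 'n::finite"
  assumes \<epsilon>: "0 < \<epsilon>"
  shows "integrable lborel (\<lambda>x. cutoff 2 ((1 / \<epsilon>) *\<^sub>R (x - x0)))"
    and "0 < (LINT x|lborel. cutoff 2 ((1 / \<epsilon>) *\<^sub>R (x - x0)))"
proof -
  let ?f = "\<lambda>x. cutoff 2 ((1 / \<epsilon>) *\<^sub>R (x - x0))"
  have "integrable lborel (\<lambda>x. complex_of_real (?f x))"
    by (rule rapid_integrable[OF test_function_rapid[OF test_function_bump[OF \<epsilon>]]])
  then show int: "integrable lborel ?f" by (simp add: complex_of_real_integrable_eq)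
  have "0 < measure lborel (ball x0 \<epsilon>)" using \<epsilon> by (rule content_ball_pos)
  also have "\<dots> = (LINT x|lborel. indicator (ball x0 \<epsilon>) x)" by simp
  also have "\<dots> \<le> (LINT x|lborel. ?f x)"
  proof (rule integral_mono[OF _ int])
    show "integrable lborel (indicat_real (ball x0 \<epsilon>))"
      using emeasure_bounded_finite[OF bounded_ball, of x0 \<epsilon>] by (intro integrable_real_indicator) auto
    fix x
    show "indicat_real (ball x0 \<epsilon>) x \<le> ?f x"
    proof (cases "x \<in> ball x0 \<epsilon>")
      case True
      then have "norm ((1 / \<epsilon>) *\<^sub>R (x - x0)) \<le> 1" using \<epsilon> by (simp add: dist_norm norm_minus_commute)
      then show ?thesis by (simp add: cutoff_eq_1)
    qed (simp add: cutoff_nonneg)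
  qed
  finally show "0 < (LINT x|lborel. ?f x)" .
qed

text \<open>Justifies the description operator in \<open>function_of\<close>. Multiplied by
  \<open>cnj c\<close>, where \<open>c\<close> is the value of the difference at \<open>x0\<close>,
  the difference has real part at least \<open>(norm c)\<^sup>2 / 2\<close> near \<open>x0\<close>,
  and a bump there detects it.\<close>

lemma represented_by_unique:
  assumes g: "represented_by u g" and h: "represented_by u h"
  shows "g = h"
proof (rule ccontr)
  assume "g \<noteq> h"
  then obtain x0 where x0: "g x0 \<noteq> h x0" by auto
  define d where "d x = g x - h x" for x
  define c where "c = d x0"
  have c: "c \<noteq> 0" using x0 by (simp add: c_def d_def)
  have "continuous_on UNIV d" unfolding d_def using g h by (intro continuous_intros) (auto simp: represented_by_def)
  then have "isCont d x0" by (simp add: continuous_on_eq_continuous_at)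
  then obtain \<delta> where \<delta>: "0 < \<delta>" "\<And>x. norm (x - x0) < \<delta> \<Longrightarrow> norm (d x - c) < norm c / 2"
    unfolding continuous_at_eps_delta dist_norm c_def[symmetric] using c by (meson half_gt_zero zero_less_norm_iff)
  \<comment> \<open>The bump vanishes from distance \<open>2 * \<epsilon>\<close> on, and this stays
    below \<open>\<delta>\<close>.\<close>
  define \<epsilon> where "\<epsilon> = \<delta> / 3"
  have \<epsilon>: "0 < \<epsilon>" "2 * \<epsilon> < \<delta>" using \<delta>(1) by (auto simp: \<epsilon>_def)
  let ?f = "\<lambda>x. cutoff 2 ((1 / \<epsilon>) *\<^sub>R (x - x0))"
  let ?\<psi> = "\<lambda>x. complex_of_real (?f x)"
  have s: "schwartz ?\<psi>" by (rule test_function_schwartz[OF test_function_bump[OF \<epsilon>(1)]])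
  have i: "integrable lborel (\<lambda>x. g x * ?\<psi> x)" "integrable lborel (\<lambda>x. h x * ?\<psi> x)"
    and e: "(LINT x|lborel. g x * ?\<psi> x) = (LINT x|lborel. h x * ?\<psi> x)"
    using g h s by (auto simp: represented_by_def)
  have id: "integrable lborel (\<lambda>x. d x * ?\<psi> x)"
    unfolding d_def left_diff_distrib by (intro Bochner_Integration.integrable_diff i)
  have "(LINT x|lborel. d x * ?\<psi> x) = 0"
    unfolding d_def left_diff_distrib Bochner_Integration.integral_diff[OF i] e by simp
  then have 0: "(LINT x|lborel. Re (cnj c * (d x * ?\<psi> x))) = 0"
    using integral_Re[OF integrable_mult_right[OF id, of "cnj c"]] by (simp add: integral_mult_right_zero)
  have "(norm c)\<^sup>2 / 2 * (LINT x|lborel. ?f x) = (LINT x|lborel. (norm c)\<^sup>2 / 2 * ?f x)"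
    by (rule integral_mult_right_zero[symmetric])
  also have "\<dots> \<le> (LINT x|lborel. Re (cnj c * (d x * ?\<psi> x)))"
  proof (rule integral_mono)
    show "integrable lborel (\<lambda>x. (norm c)\<^sup>2 / 2 * ?f x)" by (rule integrable_mult_right[OF integral_bump_pos(1)[OF \<epsilon>(1)]])
    show "integrable lborel (\<lambda>x. Re (cnj c * (d x * ?\<psi> x)))" by (rule integrable_Re[OF integrable_mult_right[OF id]])
    fix x
    show "(norm c)\<^sup>2 / 2 * ?f x \<le> Re (cnj c * (d x * ?\<psi> x))"
    proof (cases "norm (x - x0) < \<delta>")
      case True
      have "- Re (cnj c * (d x - c)) \<le> norm (cnj c * (d x - c))" by (metis abs_Re_le_cmod abs_le_D2)
      also have "\<dots> \<le> norm c * (norm c / 2)" unfolding norm_mult complex_mod_cnj using \<delta>(2)[OF True] by (intro mult_left_mono) auto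
      finally have "- Re (cnj c * (d x - c)) \<le> (norm c)\<^sup>2 / 2" by (simp add: power2_eq_square)
      moreover have "Re (cnj c * c) = (norm c)\<^sup>2" by (metis Re_complex_of_real complex_norm_square mult.commute)
      ultimately have "(norm c)\<^sup>2 / 2 \<le> Re (cnj c * d x)" by (simp add: right_diff_distrib)
      then have "(norm c)\<^sup>2 / 2 * ?f x \<le> Re (cnj c * d x) * ?f x" by (intro mult_right_mono cutoff_nonneg)
      also have "\<dots> = Re (cnj c * (d x * ?\<psi> x))" by (simp only: mult.assoc[symmetric]) (simp add: mult.commute)
      finally show ?thesis .
    next
      case False
      then have "2 \<le> norm ((1 / \<epsilon>) *\<^sub>R (x - x0))" using \<epsilon> by (simp add: pos_le_divide_eq)
      then have "?f x = 0" by (intro cutoff_eq_0) auto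
      then show ?thesis by simp
    qed
  qed
  finally have "(norm c)\<^sup>2 / 2 * (LINT x|lborel. ?f x) \<le> 0" unfolding 0 .
  moreover have "0 < (norm c)\<^sup>2 / 2 * (LINT x|lborel. ?f x)"
    using c integral_bump_pos(2)[OF \<epsilon>(1), of x0] by (intro mult_pos_pos) auto
  ultimately show False by simp
qed

text \<open>Unfolded, the distribution tests \<open>u\<close> with the transform of
  \<open>inv_fourier \<psi>\<close> times \<open>m\<close>, which is \<open>\<psi>\<close> convolved
  with the kernel; the exchange theorem moves \<open>u\<close> inside. From here on both kinds of
  norms are expressed by \<open>convol\<close>.\<close>

lemma function_of_multiplier:
  fixes m :: "real ^ 'n::finite \<Rightarrow> complex"
  assumes u: "tempered u" and m: "test_function m"
  shows "function_of (dist_inv_fourier (dist_mult m (dist_fourier u))) = convol (inv_fourier m) u"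
proof -
  let ?v = "dist_inv_fourier (dist_mult m (dist_fourier u))"
  have \<Phi>: "schwartz (inv_fourier m)" by (rule schwartz_inv_fourier[OF m])
  have "represented_by ?v (convol (inv_fourier m) u)"
    unfolding represented_by_def
  proof (intro conjI allI impI)
    show "continuous_on UNIV (convol (inv_fourier m) u)" by (rule convol_continuous[OF u \<Phi>])
    fix \<psi> :: "real ^ 'n \<Rightarrow> complex" assume \<psi>: "schwartz \<psi>"
    show "integrable lborel (\<lambda>x. convol (inv_fourier m) u x * \<psi> x)" by (rule convol_mult_integrable[OF u \<Phi> \<psi>])
    have "?v \<psi> = u (fourier (\<lambda>\<xi>. inv_fourier \<psi> \<xi> * m \<xi>))"
      by (simp add: dist_inv_fourier_def dist_mult_def dist_fourier_def mult.commute)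
    also have "fourier (\<lambda>\<xi>. inv_fourier \<psi> \<xi> * m \<xi>) = (\<lambda>y. LINT z|lborel. inv_fourier m (z - y) * \<psi> z)"
      using convolution_eq_fourier[OF m schwartz_rapid[OF \<psi>]] by (simp add: fun_eq_iff)
    also have "u \<dots> = (LINT x|lborel. convol (inv_fourier m) u x * \<psi> x)"
      by (rule tempered_convolution_exchange[OF u m \<psi>])
    finally show "?v \<psi> = (LINT x|lborel. convol (inv_fourier m) u x * \<psi> x)" .
  qed
  then show ?thesis
    unfolding function_of_def using represented_by_unique by (metis (mono_tags, lifting) the_equality)
qed

lemma inv_fourier_reflected_kernel:
  fixes m :: "real ^ 'n::finite \<Rightarrow> complex"
  assumes m: "test_function m"
  shows "inv_fourier (\<lambda>z. inv_fourier m (x - z)) \<xi> = cis (2 * pi * (x \<bullet> \<xi>)) * m \<xi>"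
proof -
  have "integrable lborel (\<lambda>z. cis (2 * pi * (\<xi> \<bullet> z)) * inv_fourier m (x - z))"
    by (rule rapid_integrable[OF rapid_cis[OF schwartz_rapid[OF schwartz_reflect[OF schwartz_inv_fourier[OF m]]]]])
  from lborel_affine_integrable(2)[OF this, of "-1" x]
  have "inv_fourier (\<lambda>z. inv_fourier m (x - z)) \<xi> = (LINT z|lborel. cis (2 * pi * (\<xi> \<bullet> (x - z))) * inv_fourier m z)"
    by (simp add: inv_fourier_def)
  also have "\<dots> = (LINT z|lborel. cis (2 * pi * (x \<bullet> \<xi>)) * (cis (- 2 * pi * (z \<bullet> \<xi>)) * inv_fourier m z))"
    by (intro Bochner_Integration.integral_cong refl)
       (simp add: mult.assoc[symmetric] cis_mult inner_diff_right right_diff_distrib inner_commute)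
  also have "\<dots> = cis (2 * pi * (x \<bullet> \<xi>)) * fourier (inv_fourier m) \<xi>"
    unfolding fourier_def by (rule integral_mult_right_zero)
  finally show ?thesis by (simp add: fourier_inv_fourier[OF m])
qed

text \<open>Associativity of convolution, obtained by testing the exchange theorem with the
  reflected kernel of \<open>m\<close>.\<close>

lemma convol_mult:
  fixes m \<nu> :: "real ^ 'n::finite \<Rightarrow> complex"
  assumes u: "tempered u" and m: "test_function m" and \<nu>: "test_function \<nu>"
  shows "convol (inv_fourier (\<lambda>\<xi>. m \<xi> * \<nu> \<xi>)) u x
    = (LINT z|lborel. inv_fourier m (x - z) * convol (inv_fourier \<nu>) u z)"
proof -
  let ?\<psi> = "\<lambda>z. inv_fourier m (x - z)"
  have \<psi>: "schwartz ?\<psi>" by (rule schwartz_reflect[OF schwartz_inv_fourier[OF m]])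
  have "(LINT z|lborel. convol (inv_fourier \<nu>) u z * ?\<psi> z) = u (\<lambda>y. LINT z|lborel. inv_fourier \<nu> (z - y) * ?\<psi> z)"
    by (rule tempered_convolution_exchange[OF u \<nu> \<psi>, symmetric])
  also have "(\<lambda>y. LINT z|lborel. inv_fourier \<nu> (z - y) * ?\<psi> z) = (\<lambda>y. inv_fourier (\<lambda>\<xi>. m \<xi> * \<nu> \<xi>) (x - y))"
  proof
    fix y
    have "(LINT z|lborel. inv_fourier \<nu> (z - y) * ?\<psi> z) = fourier (\<lambda>\<xi>. cis (2 * pi * (x \<bullet> \<xi>)) * (m \<xi> * \<nu> \<xi>)) y"
      unfolding convolution_eq_fourier[OF \<nu> schwartz_rapid[OF \<psi>]] inv_fourier_reflected_kernel[OF m] by (simp add: mult.assoc)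
    then show "(LINT z|lborel. inv_fourier \<nu> (z - y) * ?\<psi> z) = inv_fourier (\<lambda>\<xi>. m \<xi> * \<nu> \<xi>) (x - y)"
      by (simp add: fourier_eq_inv_fourier inv_fourier_modulation)
  qed
  finally show ?thesis by (simp add: convol_def mult.commute)
qed

lemma convol_sum:
  assumes u: "tempered u" and A: "finite A" and m: "\<And>j. j \<in> A \<Longrightarrow> test_function (m j)"
  shows "convol (inv_fourier (\<lambda>\<xi>. \<Sum>j\<in>A. m j \<xi>)) u x = (\<Sum>j\<in>A. convol (inv_fourier (m j)) u x)"
proof -
  have "inv_fourier (\<lambda>\<xi>. \<Sum>j\<in>A. m j \<xi>) y = (\<Sum>j\<in>A. inv_fourier (m j) y)" for y
    unfolding inv_fourier_def sum_distrib_left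
    by (rule Bochner_Integration.integral_sum) (intro rapid_integrable rapid_cis test_function_rapid m)
  then show ?thesis
    unfolding convol_def by (simp add: tempered_sum[OF u schwartz_reflect[OF schwartz_inv_fourier[OF m]] A])
qed

section \<open>Lacunary sequences and partitions of unity built from cutoffs\<close>

lemma lacunary_mult_power_le:
  fixes a :: "int \<Rightarrow> real"
  assumes a: "\<And>k. 0 < a k" and b: "0 < b" "\<And>k. b \<le> a (k + 1) / a k"
  shows "a k * b ^ n \<le> a (k + int n)"
proof (induction n)
  case (Suc n)
  have "a k * b ^ Suc n = a k * b ^ n * b" by simp
  also have "\<dots> \<le> a (k + int n) * b" using Suc b by (intro mult_right_mono) auto
  also have "\<dots> \<le> a (k + int n + 1)" using b(2)[of "k + int n"] a[of "k + int n"] by (simp add: pos_le_divide_eq mult.commute)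
  finally show ?case by (simp add: add_ac)
qed simp

lemma lacunary_mono:
  fixes a :: "int \<Rightarrow> real"
  assumes a: "\<And>k. 0 < a k" and b: "1 < b" "\<And>k. b \<le> a (k + 1) / a k" and "j \<le> k"
  shows "a j \<le> a k"
proof -
  have "a j * 1 \<le> a j * b ^ nat (k - j)" using a[of j] b(1) by (intro mult_left_mono one_le_power) auto
  also have "\<dots> \<le> a (j + int (nat (k - j)))" using b by (intro lacunary_mult_power_le a) auto
  finally show ?thesis using \<open>j \<le> k\<close> by simp
qed

lemma lacunary_unbounded:
  fixes a :: "int \<Rightarrow> real"
  assumes a: "\<And>k. 0 < a k" and b: "1 < b" "\<And>k. b \<le> a (k + 1) / a k"
  obtains n :: int where "0 \<le> n" "r \<le> a n"
proof -
  obtain n where n: "r / a 0 < b ^ n" using real_arch_pow[OF b(1)] by blast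
  have "r \<le> a 0 * b ^ n" using n a[of 0] by (simp add: pos_divide_less_eq mult.commute less_imp_le)
  also have "\<dots> \<le> a (0 + int n)" using b by (intro lacunary_mult_power_le a) auto
  finally show ?thesis by (intro that[of "int n"]) auto
qed

lemma lacunary_small:
  fixes a :: "int \<Rightarrow> real"
  assumes a: "\<And>k. 0 < a k" and b: "1 < b" "\<And>k. b \<le> a (k + 1) / a k" and r: "0 < r"
  obtains n :: int where "n \<le> 0" "a n \<le> r"
proof -
  obtain n where n: "a 0 / r < b ^ n" using real_arch_pow[OF b(1)] by blast
  have "a (- int n) * b ^ n \<le> a (- int n + int n)" using b by (intro lacunary_mult_power_le a) auto
  also have "\<dots> \<le> r * b ^ n" using n r by (simp add: pos_divide_less_eq mult.commute less_imp_le)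
  finally have "a (- int n) \<le> r" using b by simp
  then show ?thesis by (intro that[of "- int n"]) auto
qed

section \<open>Multipliers as differences of cutoffs\<close>

definition scaled_cutoff :: "real \<Rightarrow> real \<Rightarrow> real ^ 'n::finite \<Rightarrow> complex" where
  "scaled_cutoff b s \<xi> = of_real (cutoff b ((1 / s) *\<^sub>R \<xi>))"

text \<open>The differences telescope. For the sequences used below, the \<open>k\<close>-th one
  rises between radii \<open>c (k - 1)\<close> and \<open>b * c (k - 1)\<close>, stays 1 up to
  \<open>c k\<close>, and falls until \<open>b * c k\<close>.\<close>

definition step_multiplier :: "real \<Rightarrow> (int \<Rightarrow> real) \<Rightarrow> int \<Rightarrow> real ^ 'n::finite \<Rightarrow> complex" where
  "step_multiplier b c k \<xi> = scaled_cutoff b (c k) \<xi> - scaled_cutoff b (c (k - 1)) \<xi>"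

lemma test_function_cutoff:
  assumes "1 < b" shows "test_function (\<lambda>\<xi>. complex_of_real (cutoff b \<xi>))"
  unfolding test_function_def
  using smooth_cutoff[OF assms] assms by (auto intro!: exI[of _ b] cutoff_eq_0)

lemma scaled_cutoff_eq_1: "1 < b \<Longrightarrow> 0 < s \<Longrightarrow> norm \<xi> \<le> s \<Longrightarrow> scaled_cutoff b s \<xi> = 1"
  by (simp add: scaled_cutoff_def cutoff_eq_1)

lemma scaled_cutoff_eq_0: "1 < b \<Longrightarrow> 0 < s \<Longrightarrow> b * s \<le> norm \<xi> \<Longrightarrow> scaled_cutoff b s \<xi> = 0"
  by (simp add: scaled_cutoff_def cutoff_eq_0 pos_le_divide_eq)

lemma scaled_cutoff_affine:
  "scaled_cutoff b s = (\<lambda>\<xi>. (\<lambda>\<xi>. complex_of_real (cutoff b \<xi>)) ((1 / s) *\<^sub>R \<xi> + 0))"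
  by (simp add: scaled_cutoff_def fun_eq_iff)

lemma smooth_scaled_cutoff: "1 < b \<Longrightarrow> smooth (scaled_cutoff b s)"
  unfolding scaled_cutoff_affine by (rule smooth_affine_comp[OF smooth_cutoff])

lemma test_function_scaled_cutoff:
  assumes "1 < b" "0 < s" shows "test_function (scaled_cutoff b s)"
  unfolding test_function_def using smooth_scaled_cutoff[OF assms(1)]
  by (auto intro!: exI[of _ "b * s"] scaled_cutoff_eq_0[OF assms])

lemma test_function_diff: "test_function f \<Longrightarrow> test_function g \<Longrightarrow> test_function (\<lambda>x. f x - g x)"
  unfolding test_function_def
proof (elim conjE exE, intro conjI smooth_diff)
  fix R S assume "\<forall>x. R < norm x \<longrightarrow> f x = 0" "\<forall>x. S < norm x \<longrightarrow> g x = 0"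
  then show "\<exists>R. \<forall>x. R < norm x \<longrightarrow> f x - g x = 0" by (intro exI[of _ "max R S"]) auto
qed

lemma monom_at_scale: "monom_at \<beta> (c *\<^sub>R x) = c ^ length \<beta> * monom_at \<beta> x"
  by (induction \<beta>) (auto simp: monom_at_def)

text \<open>Monomial and derivative have the same order, so the expression is invariant under
  dilation, and one Schwartz seminorm of the unscaled cutoff bounds all scales.\<close>

lemma scaled_cutoff_mihlin:
  assumes b: "1 < b"
  obtains C where "\<And>s \<xi>. norm (monom_at \<beta> \<xi> *\<^sub>R partials \<beta> (scaled_cutoff b s) \<xi>) \<le> C"
proof -
  let ?\<theta> = "\<lambda>\<xi>. complex_of_real (cutoff b \<xi>)"
  have "schwartz ?\<theta>" by (rule test_function_schwartz[OF test_function_cutoff[OF b]])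
  then obtain C where C: "\<And>\<xi>. norm (monom_at \<beta> \<xi> *\<^sub>R partials \<beta> ?\<theta> \<xi>) \<le> C"
    unfolding schwartz_def bounded_iff by blast
  have "norm (monom_at \<beta> \<xi> *\<^sub>R partials \<beta> (scaled_cutoff b s) \<xi>) \<le> C" for s \<xi>
  proof -
    have "partials \<beta> (scaled_cutoff b s) = (\<lambda>\<xi>. of_real (1 / s) ^ length \<beta> * partials \<beta> ?\<theta> ((1 / s) *\<^sub>R \<xi> + 0))"
      unfolding scaled_cutoff_affine by (rule partials_affine_comp[OF smooth_cutoff[OF b]])
    then have "monom_at \<beta> \<xi> *\<^sub>R partials \<beta> (scaled_cutoff b s) \<xi> = monom_at \<beta> ((1 / s) *\<^sub>R \<xi>) *\<^sub>R partials \<beta> ?\<theta> ((1 / s) *\<^sub>R \<xi>)"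
      by (simp add: monom_at_scale scaleR_conv_of_real[where 'a=complex])
    then show ?thesis using C by metis
  qed
  then show ?thesis by (rule that)
qed

text \<open>The lower bound \<open>b\<close> of the ratios is also the outer radius of the cutoffs,
  so a transition zone from \<open>c k\<close> to \<open>b * c k\<close> fits between
  \<open>a k\<close> and \<open>a (k + 1)\<close>.\<close>

locale lacunary =
  fixes a :: "int \<Rightarrow> real" and b :: real
  assumes pos: "0 < a k" and b: "1 < b" and ratio: "b \<le> a (k + 1) / a k"
begin

lemma ratio_mult: "b * a k \<le> a (k + 1)"
  using ratio[of k] pos[of k] by (simp add: pos_le_divide_eq)

lemma mono: "j \<le> k \<Longrightarrow> a j \<le> a k"
  using lacunary_mono[where a=a and b=b, OF pos b ratio] .

text \<open>The sequence \<open>c\<close> prescribes where in \<open>[a k, a (k + 1)]\<close> the transition between neighbouring functions takes place.\<close>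

context
  fixes c :: "int \<Rightarrow> real"
  assumes c: "\<And>k. a k \<le> c k" "\<And>k. b * c k \<le> a (k + 1)"
begin

lemma c_pos: "0 < c k"
  using c(1)[of k] pos[of k] by linarith

lemma test_function_step: "test_function (step_multiplier b c k)"
  unfolding step_multiplier_def by (intro test_function_diff test_function_scaled_cutoff b c_pos)

lemma step_eq_1:
  assumes "b * c (k - 1) \<le> norm \<xi>" "norm \<xi> \<le> c k"
  shows "step_multiplier b c k \<xi> = 1"
  using assms by (simp add: step_multiplier_def scaled_cutoff_eq_0[OF b c_pos] scaled_cutoff_eq_1[OF b c_pos])

lemma step_eq_0_below:
  assumes "norm \<xi> \<le> c (k - 1)" shows "step_multiplier b c k \<xi> = 0"
proof -
  have "c (k - 1) \<le> b * c (k - 1)" using b c_pos[of "k - 1"] by simp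
  also have "\<dots> \<le> c k" using c(2)[of "k - 1"] c(1)[of k] by simp
  finally show ?thesis using assms by (simp add: step_multiplier_def scaled_cutoff_eq_1[OF b c_pos])
qed

lemma step_eq_0_above:
  assumes "b * c k \<le> norm \<xi>" shows "step_multiplier b c k \<xi> = 0"
proof -
  have "c (k - 1) \<le> b * c (k - 1)" using b c_pos[of "k - 1"] by simp
  also have "\<dots> \<le> c k" using c(2)[of "k - 1"] c(1)[of k] by simp
  finally have "b * c (k - 1) \<le> b * c k" using b by simp
  then show ?thesis using assms by (simp add: step_multiplier_def scaled_cutoff_eq_0[OF b c_pos])
qed

lemma step_support:
  assumes "step_multiplier b c k \<xi> \<noteq> 0" shows "a (k - 1) \<le> norm \<xi>" "norm \<xi> \<le> a (k + 1)"
  using assms step_eq_0_below[of \<xi> k] step_eq_0_above[of k \<xi>] c(1)[of "k - 1"] c(2)[of k] by linarith+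

text \<open>On the plateau of one multiplier no other is active; this provides functions that are
  seen by a single level.\<close>

lemma step_isolated:
  assumes \<xi>: "b * c (k - 1) \<le> norm \<xi>" "norm \<xi> \<le> c k" and "j \<noteq> k"
  shows "step_multiplier b c j \<xi> = 0"
proof -
  have cmono: "c i \<le> c l" if "i \<le> l" for i l
  proof (cases "i = l")
    case False
    have "c i \<le> b * c i" using b c_pos[of i] by simp
    also have "\<dots> \<le> a l" using c(2)[of i] mono[of "i + 1" l] False that by simp
    finally show ?thesis using c(1)[of l] by simp
  qed simp
  consider "j \<le> k - 1" | "k \<le> j - 1" using \<open>j \<noteq> k\<close> by linarith
  then show ?thesis
  proof cases
    case 1
    then have "b * c j \<le> b * c (k - 1)" using cmono b by simp
    then show ?thesis using \<xi>(1) by (intro step_eq_0_above) simp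
  next
    case 2
    then show ?thesis using cmono[OF 2] \<xi>(2) by (intro step_eq_0_below) simp
  qed
qed

lemma step_has_sum:
  assumes "\<xi> \<noteq> 0" shows "((\<lambda>k. step_multiplier b c k \<xi>) has_sum 1) UNIV"
proof -
  obtain n where n: "0 \<le> n" "norm \<xi> \<le> a n" using lacunary_unbounded[where a=a and b=b, OF pos b ratio] by metis
  obtain m where m: "m \<le> 0" "a m \<le> norm \<xi>" using lacunary_small[where a=a and b=b and r="norm \<xi>", OF pos b ratio] assms by auto
  let ?\<chi> = "\<lambda>k. scaled_cutoff b (c k) \<xi>"
  \<comment> \<open>The sum telescopes between an index where the cutoff is 0 at
    \<open>\<xi>\<close> and one where it is 1. The lower end is \<open>m - 1\<close>, because
    \<open>b * c (m - 1) \<le> a m\<close>.\<close>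
  have "(\<Sum>k\<in>{i<..i + int l}. ?\<chi> k - ?\<chi> (k - 1)) = ?\<chi> (i + int l) - ?\<chi> i" for i l
  proof (induction l)
    case (Suc l)
    have "{i<..i + int (Suc l)} = insert (i + int (Suc l)) {i<..i + int l}" by auto
    then show ?case using Suc by (simp add: algebra_simps)
  qed simp
  from this[of "m - 1" "nat (n - (m - 1))"]
  have "(\<Sum>k\<in>{m - 1<..n}. ?\<chi> k - ?\<chi> (k - 1)) = ?\<chi> n - ?\<chi> (m - 1)" using n m by simp
  also have "?\<chi> n = 1" using n(2) c(1)[of n] by (intro scaled_cutoff_eq_1 b c_pos) simp
  also have "?\<chi> (m - 1) = 0" using m(2) c(2)[of "m - 1"] by (intro scaled_cutoff_eq_0 b c_pos) simp
  finally have sum: "(\<Sum>k\<in>{m - 1<..n}. step_multiplier b c k \<xi>) = 1" by (simp add: step_multiplier_def)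
  show ?thesis
  proof (rule has_sum_finite_neutralI[of "{m - 1<..n}"])
    fix k assume "k \<in> UNIV - {m - 1<..n}"
    then consider "k \<le> m - 1" | "n \<le> k - 1" by force
    then show "step_multiplier b c k \<xi> = 0"
    proof cases
      case 1
      then have "b * c k \<le> norm \<xi>" using c(2)[of k] mono[of "k + 1" m] m(2) by linarith
      then show ?thesis by (rule step_eq_0_above)
    next
      case 2
      then have "norm \<xi> \<le> c (k - 1)" using c(1)[of "k - 1"] mono[of n "k - 1"] n(2) by linarith
      then show ?thesis by (rule step_eq_0_below)
    qed
  qed (simp_all add: sum)
qed

lemma adapted_partition_step:
  "adapted_partition a (\<lambda>k. inv_fourier (step_multiplier b c k) :: real ^ 'n::finite \<Rightarrow> complex)"
  unfolding adapted_partition_def fourier_inv_fourier[OF test_function_step]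
proof (intro conjI allI impI)
  fix k
  show "schwartz (inv_fourier (step_multiplier b c k) :: real ^ 'n \<Rightarrow> complex)"
    by (rule schwartz_inv_fourier[OF test_function_step])
  have "closed (annulus r R :: (real ^ 'n) set)" for r R
  proof -
    have "annulus r R = {\<xi>::real ^ 'n. r \<le> norm \<xi>} \<inter> {\<xi>. norm \<xi> \<le> R}" by (auto simp: annulus_def)
    then show ?thesis by (simp add: closed_Int closed_Collect_le continuous_on_norm_id)
  qed
  then show "closure (support_on UNIV (step_multiplier b c k :: real ^ 'n \<Rightarrow> complex)) \<subseteq> annulus (a (k - 1)) (a (k + 1))"
    using step_support by (intro closure_minimal) (auto simp: support_on_def annulus_def)
next
  fix \<xi> :: "real ^ 'n" assume "\<xi> \<noteq> 0"
  then show "((\<lambda>k. step_multiplier b c k \<xi>) has_sum 1) UNIV" by (rule step_has_sum)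
next
  fix \<beta> :: "'n list"
  obtain C where C: "\<And>s \<xi>. norm (monom_at \<beta> \<xi> *\<^sub>R partials \<beta> (scaled_cutoff b s) \<xi>) \<le> C"
    using scaled_cutoff_mihlin[OF b] by metis
  have "norm (monom_at \<beta> \<xi> *\<^sub>R partials \<beta> (step_multiplier b c k) \<xi>) \<le> C + C" for k \<xi>
  proof -
    have "partials \<beta> (step_multiplier b c k) = (\<lambda>\<xi>. partials \<beta> (scaled_cutoff b (c k)) \<xi> - partials \<beta> (scaled_cutoff b (c (k - 1))) \<xi>)"
      unfolding step_multiplier_def[abs_def] by (intro partials_diff smooth_scaled_cutoff b)
    then have "monom_at \<beta> \<xi> *\<^sub>R partials \<beta> (step_multiplier b c k) \<xi>
      = monom_at \<beta> \<xi> *\<^sub>R partials \<beta> (scaled_cutoff b (c k)) \<xi> - monom_at \<beta> \<xi> *\<^sub>R partials \<beta> (scaled_cutoff b (c (k - 1))) \<xi>"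
      by (simp only: scaleR_diff_right)
    then show ?thesis by (simp only: order.trans[OF norm_triangle_ineq4 add_mono[OF C C]])
  qed
  then show "\<exists>C. \<forall>k \<xi>. norm (monom_at \<beta> \<xi> *\<^sub>R partials \<beta> (step_multiplier b c k) \<xi>) \<le> C" by blast
qed

end

end

section \<open>Convolutions annihilate polynomials\<close>

text \<open>A condition on a neighbourhood is inherited by derivatives, unlike vanishing at the
  single point 0.\<close>

definition vanishes_near_0 :: "(real ^ 'n::finite \<Rightarrow> complex) \<Rightarrow> bool" where
  "vanishes_near_0 m \<longleftrightarrow> (\<exists>r>0. \<forall>\<xi>. norm \<xi> < r \<longrightarrow> m \<xi> = 0)"

lemma vanishes_near_0_partial:
  assumes "vanishes_near_0 m" shows "vanishes_near_0 (partial i m)"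
proof -
  obtain r where r: "0 < r" "\<And>\<xi>. norm \<xi> < r \<Longrightarrow> m \<xi> = 0" using assms by (auto simp: vanishes_near_0_def)
  have "partial i m \<xi> = 0" if "norm \<xi> < r" for \<xi>
    by (rule partial_eq_0[of "ball 0 r"]) (use that r in auto)
  then show ?thesis using r(1) by (auto simp: vanishes_near_0_def)
qed

lemma vanishes_near_0_add:
  assumes "vanishes_near_0 f" "vanishes_near_0 g" shows "vanishes_near_0 (\<lambda>x. f x + g x)"
proof -
  obtain r s where "0 < r" "\<And>\<xi>. norm \<xi> < r \<Longrightarrow> f \<xi> = 0" "0 < s" "\<And>\<xi>. norm \<xi> < s \<Longrightarrow> g \<xi> = 0"
    using assms unfolding vanishes_near_0_def by metis
  then show ?thesis unfolding vanishes_near_0_def by (intro exI[of _ "min r s"]) auto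
qed

lemma vanishes_near_0_mult: "vanishes_near_0 g \<Longrightarrow> vanishes_near_0 (\<lambda>x. f x * g x)"
  by (auto simp: vanishes_near_0_def)

lemma test_function_add: "test_function f \<Longrightarrow> test_function g \<Longrightarrow> test_function (\<lambda>x. f x + g x)"
  using test_function_diff[of f "\<lambda>x. (-1) * g x"] test_function_cmult[of g "-1"] by simp

lemma inv_fourier_add:
  assumes "test_function f" "test_function g"
  shows "inv_fourier (\<lambda>\<xi>. f \<xi> + g \<xi>) x = inv_fourier f x + inv_fourier g x"
  unfolding inv_fourier_def distrib_left
  by (intro Bochner_Integration.integral_add rapid_integrable rapid_cis test_function_rapid assms)

text \<open>Coordinates act on the multiplier as derivatives, by \<open>coord_inv_fourier\<close>,
  and derivatives still vanish near 0. The multiplier varies in the induction because a product of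
  polynomials acts one factor at a time.\<close>

lemma real_polynomial_mult_inv_fourier:
  fixes p :: "real ^ 'n::finite \<Rightarrow> real"
  assumes "real_polynomial_function p" "test_function m" "vanishes_near_0 m"
  shows "\<exists>m'. test_function m' \<and> vanishes_near_0 m' \<and> (\<forall>y. of_real (p y) * inv_fourier m y = inv_fourier m' y)"
  using assms
proof (induction arbitrary: m)
  case (linear f)
  have f: "f y = (\<Sum>i\<in>UNIV. y $ i * f (axis i 1))" for y
  proof -
    have "f y = f (\<Sum>i\<in>UNIV. (y $ i) *\<^sub>R axis i 1)"
      using basis_expansion[of y] by (simp add: scalar_mult_eq_scaleR)
    then show ?thesis
      using bounded_linear.linear[OF linear(1)] by (simp add: linear_sum linear_cmul)
  qed
  have "\<exists>m'. test_function m' \<and> vanishes_near_0 m' \<and>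
      (\<forall>y. of_real (\<Sum>i\<in>A. y $ i * f (axis i 1)) * inv_fourier m y = inv_fourier m' y)" if "finite A" for A :: "'n set"
    using that
  proof (induction A)
    case empty
    have "test_function (\<lambda>x. 0 * m x)" "vanishes_near_0 (\<lambda>x. 0 * m x)"
      using linear by (intro test_function_cmult vanishes_near_0_mult; simp)+
    then show ?case by (intro exI[of _ "\<lambda>x. 0 * m x"]) (simp add: inv_fourier_def)
  next
    case (insert i A)
    then obtain m' where m': "test_function m'" "vanishes_near_0 m'"
      "\<And>y. of_real (\<Sum>i\<in>A. y $ i * f (axis i 1)) * inv_fourier m y = inv_fourier m' y" by blast
    let ?g = "\<lambda>\<xi>. of_real (f (axis i 1)) * (\<i> / (2 * pi) * partial i m \<xi>)"
    have g: "test_function ?g" "vanishes_near_0 ?g"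
      by (intro test_function_cmult vanishes_near_0_mult test_function_partial vanishes_near_0_partial linear)+
    have "of_real (\<Sum>i\<in>insert i A. y $ i * f (axis i 1)) * inv_fourier m y = inv_fourier (\<lambda>\<xi>. ?g \<xi> + m' \<xi>) y" for y
    proof -
      have "inv_fourier ?g y = of_real (f (axis i 1)) * (of_real (y $ i) * inv_fourier m y)"
        unfolding inv_fourier_cmult[of "of_real (f (axis i 1))"] coord_inv_fourier[OF linear(2), symmetric] ..
      then show ?thesis
        unfolding inv_fourier_add[OF g(1) m'(1)] m'(3)[symmetric] using insert by (simp add: algebra_simps)
    qed
    then show ?case using test_function_add[OF g(1) m'(1)] vanishes_near_0_add[OF g(2) m'(2)] by blast
  qed
  from this[of UNIV] show ?case unfolding f[symmetric] by simp
next
  case (const c)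
  then show ?case
    by (intro exI[of _ "\<lambda>x. of_real c * m x"]) (simp add: test_function_cmult vanishes_near_0_mult inv_fourier_cmult)
next
  case (add f g)
  obtain m1 where m1: "test_function m1" "vanishes_near_0 m1" "\<And>y. of_real (f y) * inv_fourier m y = inv_fourier m1 y"
    using add.IH(1)[OF add.prems] by blast
  obtain m2 where m2: "test_function m2" "vanishes_near_0 m2" "\<And>y. of_real (g y) * inv_fourier m y = inv_fourier m2 y"
    using add.IH(2)[OF add.prems] by blast
  show ?case
    using m1 m2 by (intro exI[of _ "\<lambda>x. m1 x + m2 x"])
      (simp add: test_function_add vanishes_near_0_add inv_fourier_add distrib_right)
next
  case (mult f g)
  obtain m1 where m1: "test_function m1" "vanishes_near_0 m1" "\<And>y. of_real (g y) * inv_fourier m y = inv_fourier m1 y"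
    using mult.IH(2)[OF mult.prems] by blast
  obtain m2 where m2: "test_function m2" "vanishes_near_0 m2" "\<And>y. of_real (f y) * inv_fourier m1 y = inv_fourier m2 y"
    using mult.IH(1)[OF m1(1,2)] by blast
  show ?case
    using m2 by (intro exI[of _ m2]) (simp add: mult.assoc m1(3))
qed

text \<open>By Fourier inversion the integral of a kernel is the value of its multiplier at
  0.\<close>

lemma integral_real_polynomial_mult_inv_fourier:
  fixes p :: "real ^ 'n::finite \<Rightarrow> real"
  assumes "real_polynomial_function p" "test_function m" "vanishes_near_0 m"
  shows "integrable lborel (\<lambda>y. of_real (p y) * inv_fourier m y)" "(LINT y|lborel. of_real (p y) * inv_fourier m y) = 0"
proof -
  obtain m' where m': "test_function m'" "vanishes_near_0 m'" "\<And>y. of_real (p y) * inv_fourier m y = inv_fourier m' y"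
    using real_polynomial_mult_inv_fourier[OF assms] by blast
  show "integrable lborel (\<lambda>y. of_real (p y) * inv_fourier m y)"
    unfolding m' by (rule rapid_integrable[OF schwartz_rapid[OF schwartz_inv_fourier[OF m'(1)]]])
  have "(LINT y|lborel. inv_fourier m' y) = fourier (inv_fourier m') 0" by (simp add: fourier_def)
  also have "\<dots> = 0" using m'(2) unfolding fourier_inv_fourier[OF m'(1)] by (auto simp: vanishes_near_0_def)
  finally show "(LINT y|lborel. of_real (p y) * inv_fourier m y) = 0" unfolding m' .
qed

lemma inv_fourier_minus:
  assumes "test_function m"
  shows "inv_fourier (\<lambda>\<xi>. m (- \<xi>)) x = inv_fourier m (- x)"
proof -
  have "integrable lborel (\<lambda>\<xi>. cis (2 * pi * (- x \<bullet> \<xi>)) * m \<xi>)"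
    by (rule rapid_integrable[OF rapid_cis[OF test_function_rapid[OF assms]]])
  from lborel_affine_integrable(2)[OF this, of "-1" 0] show ?thesis by (simp add: inv_fourier_def)
qed

lemma test_function_minus: "test_function m \<Longrightarrow> test_function (\<lambda>\<xi>. m (- \<xi>))"
  using smooth_affine_comp[of m "-1" 0] unfolding test_function_def by (metis (no_types, lifting) add.right_neutral norm_minus_cancel scaleR_minus1_left ext)

lemma integral_polynomial_convolution_eq_0:
  fixes P :: "real ^ 'n::finite \<Rightarrow> complex"
  assumes P: "polynomial_function P" and m: "test_function m" and v: "vanishes_near_0 m"
  shows "(LINT y|lborel. P y * inv_fourier m (x - y)) = 0"
proof -
  \<comment> \<open>Translation by \<open>x\<close> and reflection of the kernel become a modulation
    and a reflection of the multiplier, which preserve vanishing near 0.\<close>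
  let ?m = "\<lambda>\<xi>. cis (2 * pi * (- x \<bullet> \<xi>)) * m (- \<xi>)"
  have m': "test_function ?m" by (intro test_function_mult test_function_minus m smooth_cis_inner)
  have v': "vanishes_near_0 ?m" using v by (auto simp: vanishes_near_0_def)
  have e: "inv_fourier m (x - y) = inv_fourier ?m y" for y
    unfolding inv_fourier_modulation inv_fourier_minus[OF m] by simp
  have Re: "real_polynomial_function (\<lambda>y. Re (P y))" and Im: "real_polynomial_function (\<lambda>y. Im (P y))"
    using P bounded_linear_Re bounded_linear_Im unfolding polynomial_function_def by (auto simp: o_def)
  have "P y * inv_fourier ?m y = of_real (Re (P y)) * inv_fourier ?m y + \<i> * (of_real (Im (P y)) * inv_fourier ?m y)" for y
    by (subst complex_eq[of "P y"]) (simp add: distrib_right mult.assoc)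
  then have "(LINT y|lborel. P y * inv_fourier m (x - y)) =
      (LINT y|lborel. of_real (Re (P y)) * inv_fourier ?m y + \<i> * (of_real (Im (P y)) * inv_fourier ?m y))"
    unfolding e by simp
  also have "\<dots> = (LINT y|lborel. of_real (Re (P y)) * inv_fourier ?m y) + (LINT y|lborel. \<i> * (of_real (Im (P y)) * inv_fourier ?m y))"
    by (intro Bochner_Integration.integral_add integrable_mult_right integral_real_polynomial_mult_inv_fourier(1)[OF _ m' v'] Re Im)
  also have "\<dots> = 0"
    unfolding integral_mult_right_zero integral_real_polynomial_mult_inv_fourier(2)[OF Re m' v']
      integral_real_polynomial_mult_inv_fourier(2)[OF Im m' v'] by simp
  finally show ?thesis .
qed

section \<open>Frequency-localised test distributions\<close>

definition dist_of :: "(real ^ 'n::finite \<Rightarrow> complex) \<Rightarrow> 'n functional" where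
  "dist_of f = (\<lambda>\<psi>. LINT x|lborel. f x * \<psi> x)"

lemma schwartz_norm_0: "schwartz_norm 0 \<psi> = (SUP x. norm (\<psi> x))"
  by (simp add: schwartz_norm_def monom_at_def)

lemma schwartz_bounded_by_norm: "schwartz \<psi> \<Longrightarrow> norm (\<psi> x) \<le> schwartz_norm 0 \<psi>"
  unfolding schwartz_norm_0
proof (rule cSUP_upper)
  assume "schwartz \<psi>"
  then obtain C where "\<And>x. (1 + norm x) ^ 0 * norm (partials [] \<psi> x) \<le> C" using schwartz_decay by metis
  then show "bdd_above (range (\<lambda>x. norm (\<psi> x)))" unfolding bdd_above_def by auto
qed simp

lemma schwartz_mult_integrable: "schwartz \<phi> \<Longrightarrow> schwartz \<psi> \<Longrightarrow> integrable lborel (\<lambda>x. \<phi> x * \<psi> x)"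
proof (rule rapid_integrable_mult[OF schwartz_rapid, where N=0])
  assume "schwartz \<phi>"
  then show "norm (\<phi> x) \<le> schwartz_norm 0 \<phi> * (1 + norm x) ^ 0" for x by (simp add: schwartz_bounded_by_norm)
qed (auto intro: rapid_measurable schwartz_rapid)

lemma tempered_dist_of:
  assumes f: "schwartz f" shows "tempered (dist_of f)"
  unfolding tempered_def
proof (intro conjI allI impI)
  fix \<phi> \<psi> c
  show "dist_of f (\<lambda>x. \<phi> x + \<psi> x) = dist_of f \<phi> + dist_of f \<psi>" if "schwartz \<phi>" "schwartz \<psi>"
    unfolding dist_of_def distrib_left by (intro Bochner_Integration.integral_add schwartz_mult_integrable f that)
  show "dist_of f (\<lambda>x. c * \<phi> x) = c * dist_of f \<phi>" if "schwartz \<phi>"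
    unfolding dist_of_def integral_mult_right_zero[symmetric] by (simp add: mult_ac)
next
  have "norm (dist_of f \<phi>) \<le> (LINT x|lborel. norm (f x)) * schwartz_norm 0 \<phi>" if \<phi>: "schwartz \<phi>" for \<phi>
  proof -
    have i: "integrable lborel (\<lambda>x. norm (f x))" by (rule integrable_norm[OF rapid_integrable[OF schwartz_rapid[OF f]]])
    have "norm (dist_of f \<phi>) \<le> (LINT x|lborel. norm (f x * \<phi> x))" unfolding dist_of_def by (rule integral_norm_bound)
    also have "\<dots> \<le> (LINT x|lborel. norm (f x) * schwartz_norm 0 \<phi>)"
      using schwartz_bounded_by_norm[OF \<phi>]
      by (intro integral_mono integrable_norm schwartz_mult_integrable f \<phi> integrable_mult_left i)
         (simp add: norm_mult mult_left_mono)
    also have "\<dots> = (LINT x|lborel. norm (f x)) * schwartz_norm 0 \<phi>" by (rule integral_mult_left_zero)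
    finally show ?thesis .
  qed
  then show "\<exists>C N. \<forall>\<phi>. schwartz \<phi> \<longrightarrow> norm (dist_of f \<phi>) \<le> C * schwartz_norm N \<phi>" by blast
qed

lemma convol_dist_of_inv_fourier:
  assumes g: "test_function g" and m: "test_function m"
  shows "convol (inv_fourier m) (dist_of (inv_fourier g)) x = inv_fourier (\<lambda>\<xi>. g \<xi> * m \<xi>) x"
proof -
  have "convol (inv_fourier m) (dist_of (inv_fourier g)) x = (LINT z|lborel. inv_fourier g z * inv_fourier m (x - z))"
    by (simp add: convol_def dist_of_def)
  also have "\<dots> = (LINT \<xi>|lborel. g \<xi> * inv_fourier (\<lambda>z. inv_fourier m (x - z)) \<xi>)"
    by (intro inv_fourier_multiplication_formula rapid_integrable test_function_rapid schwartz_rapid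
        schwartz_reflect schwartz_inv_fourier g m)
  also have "\<dots> = inv_fourier (\<lambda>\<xi>. g \<xi> * m \<xi>) x"
    unfolding inv_fourier_reflected_kernel[OF m] by (simp add: inv_fourier_def mult_ac)
  finally show ?thesis .
qed

text \<open>The representative that \<open>SOME\<close> picks from a class is unknown; this allows a
  known one to be used in its place.\<close>

lemma convol_mod_poly:
  fixes u v :: "'n::finite functional"
  assumes uv: "(u, v) \<in> equal_mod_poly" and m: "test_function m" "vanishes_near_0 m"
  shows "convol (inv_fourier m) v x = convol (inv_fourier m) u x"
proof -
  obtain P :: "real ^ 'n \<Rightarrow> complex" where P: "polynomial_function P"
    "\<And>\<psi>. schwartz \<psi> \<Longrightarrow> u \<psi> - v \<psi> = (LINT x|lborel. P x * \<psi> x)"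
    using uv unfolding equal_mod_poly_def by blast
  have "u (\<lambda>y. inv_fourier m (x - y)) - v (\<lambda>y. inv_fourier m (x - y)) = 0"
    unfolding P(2)[OF schwartz_reflect[OF schwartz_inv_fourier[OF m(1)]]]
    by (rule integral_polynomial_convolution_eq_0[OF P(1) m])
  then show ?thesis by (simp add: convol_def)
qed

lemma equal_mod_poly_refl:
  assumes "tempered u" shows "(u, u) \<in> equal_mod_poly"
proof -
  have "polynomial_function (\<lambda>x::real ^ 'a. 0 :: complex)" by simp
  then show ?thesis using assms unfolding equal_mod_poly_def by (auto intro!: exI[of _ "\<lambda>_. 0"])
qed

lemma class_representative:
  assumes "f \<in> tempered_mod_poly" shows "tempered (SOME u. u \<in> f)"
proof -
  obtain u where u: "tempered u" "f = equal_mod_poly `` {u}"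
    using assms unfolding tempered_mod_poly_def by (auto elim!: quotientE)
  have "(SOME v. v \<in> f) \<in> f"
    by (rule someI[of "\<lambda>v. v \<in> f" u]) (simp add: u(2) equal_mod_poly_refl[OF u(1)])
  then have "(u, SOME v. v \<in> f) \<in> equal_mod_poly" using u(2) by blast
  then show ?thesis unfolding equal_mod_poly_def by blast
qed

section \<open>Lp norms and functions seen by a single level\<close>

lemma Lp_norm_cmult:
  assumes "0 < p" "h \<in> borel_measurable lborel"
  shows "Lp_norm p (\<lambda>x. c * h x) = c * Lp_norm p h"
proof -
  have "(\<integral>\<^sup>+x. ennpowr (c * h x) p \<partial>lborel) = ennpowr c p * (\<integral>\<^sup>+x. ennpowr (h x) p \<partial>lborel)"
    using assms by (simp add: ennpowr_mult nn_integral_cmult)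
  then show ?thesis using assms(1) by (simp add: Lp_norm_def ennpowr_mult ennpowr_ennpowr)
qed

text \<open>Boundedness reduces the \<open>p\<close>-th power to the first power, which is
  integrable.\<close>

lemma Lp_norm_schwartz_finite:
  assumes p: "1 \<le> p" and f: "schwartz f"
  shows "Lp_norm p (\<lambda>x. ennreal (norm (f x))) < top"
proof -
  define D where "D = schwartz_norm 0 f"
  have D: "norm (f x) \<le> D" for x unfolding D_def by (rule schwartz_bounded_by_norm[OF f])
  have i: "integrable lborel (\<lambda>x. D powr (p - 1) * norm (f x))"
    by (intro integrable_mult_right integrable_norm rapid_integrable schwartz_rapid f)
  have "(\<integral>\<^sup>+x. ennpowr (ennreal (norm (f x))) p \<partial>lborel) \<le> (\<integral>\<^sup>+x. ennreal (D powr (p - 1) * norm (f x)) \<partial>lborel)"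
  proof (rule nn_integral_mono)
    fix x
    have "norm (f x) powr p = norm (f x) powr (p - 1) * norm (f x)"
      using powr_add[of "norm (f x)" "p - 1" 1] by simp
    also have "\<dots> \<le> D powr (p - 1) * norm (f x)" using p D by (intro mult_right_mono powr_mono2) auto
    finally show "ennpowr (ennreal (norm (f x))) p \<le> ennreal (D powr (p - 1) * norm (f x))"
      by (simp add: ennpowr_ennreal ennreal_leI)
  qed
  also have "\<dots> < top" by (subst nn_integral_eq_integral[OF i]) (auto intro!: AE_I2 mult_nonneg_nonneg)
  finally have "(\<integral>\<^sup>+x. ennpowr (ennreal (norm (f x))) p \<partial>lborel) \<noteq> top" by (rule less_imp_neq)
  then have "Lp_norm p (\<lambda>x. ennreal (norm (f x))) \<noteq> top" by (simp only: Lp_norm_def ennpowr_eq_top_iff not_False_eq_True)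
  then show ?thesis by (rule top.not_eq_extremum[THEN iffD1])
qed

lemma Lp_norm_pos:
  fixes f :: "real ^ 'n::finite \<Rightarrow> complex"
  assumes f: "continuous_on UNIV f" and x0: "f x0 \<noteq> 0"
  shows "Lp_norm p (\<lambda>x. ennreal (norm (f x))) \<noteq> 0"
proof
  assume "Lp_norm p (\<lambda>x. ennreal (norm (f x))) = 0"
  then have "(\<integral>\<^sup>+x. ennpowr (ennreal (norm (f x))) p \<partial>lborel) = 0" by (simp add: Lp_norm_def ennpowr_eq_0_iff)
  moreover have [measurable]: "f \<in> borel_measurable borel" by (rule borel_measurable_continuous_onI[OF f])
  ultimately have "AE x in lborel. ennpowr (ennreal (norm (f x))) p = 0"
    by (subst (asm) nn_integral_0_iff_AE) measurable
  then have ae: "AE x in lborel. f x = 0" by (auto simp: ennpowr_eq_0_iff elim: eventually_mono)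
  have "open {x. f x \<noteq> 0}"
  proof -
    have "open (f -` (- {0}))" by (rule open_vimage[OF _ f]) auto
    then show ?thesis by (simp add: vimage_def)
  qed
  then obtain e where e: "0 < e" "ball x0 e \<subseteq> {x. f x \<noteq> 0}" using x0 by (auto simp: open_contains_ball)
  have "AE x in lborel. x \<notin> ball x0 e" using ae e(2) by (auto elim!: eventually_mono)
  then have "emeasure lborel (ball x0 e) = 0" by (subst AE_iff_measurable[symmetric, of _ _ "\<lambda>x. x \<notin> ball x0 e"]) auto
  then have "measure lborel (ball x0 e) = 0" by (simp add: measure_def)
  then show False using content_ball_pos[OF e(1), of x0] by simp
qed

text \<open>All convolutions but the \<open>k\<close>-th vanish and that one reproduces the
  function, so the inner sum has a single term and the norm exposes the weight
  \<open>a k powr \<alpha>\<close>.\<close>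

lemma adapted_TL_norm_single_frequency:
  fixes g :: "real ^ 'n::finite \<Rightarrow> complex"
  assumes p: "1 < p" and q: "1 < q" and a: "0 < a k"
    and g: "test_function g" and m: "\<And>j. test_function (m j)" "\<And>j. vanishes_near_0 (m j)"
    and k: "\<And>\<xi>. g \<xi> * m k \<xi> = g \<xi>" and j: "\<And>j \<xi>. j \<noteq> k \<Longrightarrow> g \<xi> * m j \<xi> = 0"
  shows "adapted_TL_norm \<alpha> p q a (\<lambda>j. inv_fourier (m j)) (equal_mod_poly `` {dist_of (inv_fourier g)})
    = ennreal (a k powr \<alpha>) * Lp_norm p (\<lambda>x. ennreal (norm (inv_fourier g x)))"
proof -
  let ?u = "dist_of (inv_fourier g)"
  let ?f = "equal_mod_poly `` {?u}"
  define v where "v = (SOME v. v \<in> ?f)"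
  have f: "schwartz (inv_fourier g)" by (rule schwartz_inv_fourier[OF g])
  have [measurable]: "inv_fourier g \<in> borel_measurable borel" by (rule rapid_measurable[OF schwartz_rapid[OF f]])
  have "v \<in> ?f" unfolding v_def
    by (rule someI[of "\<lambda>v. v \<in> ?f" ?u]) (simp add: equal_mod_poly_refl[OF tempered_dist_of[OF f]])
  then have uv: "(?u, v) \<in> equal_mod_poly" by simp
  have c: "convol (inv_fourier (m j)) v x = (if j = k then inv_fourier g x else 0)" for j x
  proof (cases "j = k")
    case False
    then show ?thesis
      unfolding convol_mod_poly[OF uv m] convol_dist_of_inv_fourier[OF g m(1)] by (simp add: inv_fourier_def j del: mult_eq_0_iff)
  qed (simp add: convol_mod_poly[OF uv m] convol_dist_of_inv_fourier[OF g m(1)] k)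
  have "ennpowr (\<Sum>\<^sub>\<infinity>j. ennreal (a j powr (\<alpha> * q) * norm (convol (inv_fourier (m j)) v x) powr q)) (1 / q)
      = ennreal (a k powr \<alpha>) * ennreal (norm (inv_fourier g x))" for x
  proof -
    have "(\<Sum>\<^sub>\<infinity>j. ennreal (a j powr (\<alpha> * q) * norm (convol (inv_fourier (m j)) v x) powr q))
        = ennreal (a k powr (\<alpha> * q) * norm (convol (inv_fourier (m k)) v x) powr q)"
    proof -
      have "(\<Sum>\<^sub>\<infinity>j. ennreal (a j powr (\<alpha> * q) * norm (convol (inv_fourier (m j)) v x) powr q))
        = (\<Sum>\<^sub>\<infinity>j\<in>{k}. ennreal (a j powr (\<alpha> * q) * norm (convol (inv_fourier (m j)) v x) powr q))"
        by (rule infsum_cong_neutral) (auto simp: c)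
      then show ?thesis by simp
    qed
    also have "ennpowr (ennreal (a k powr (\<alpha> * q) * norm (convol (inv_fourier (m k)) v x) powr q)) (1 / q)
        = ennreal ((a k powr (\<alpha> * q) * norm (inv_fourier g x) powr q) powr (1 / q))"
      by (simp add: c ennpowr_ennreal del: ennreal_mult)
    also have "(a k powr (\<alpha> * q) * norm (inv_fourier g x) powr q) powr (1 / q) = a k powr \<alpha> * norm (inv_fourier g x)"
      using q by (simp add: powr_mult powr_powr)
    finally show ?thesis by (simp add: ennreal_mult)
  qed
  then have "adapted_TL_norm \<alpha> p q a (\<lambda>j. inv_fourier (m j)) ?f
      = Lp_norm p (\<lambda>x. ennreal (a k powr \<alpha>) * ennreal (norm (inv_fourier g x)))"
    by (simp add: adapted_TL_norm_def adapted_TL_dist_norm_def v_def)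
  also have "\<dots> = ennreal (a k powr \<alpha>) * Lp_norm p (\<lambda>x. ennreal (norm (inv_fourier g x)))"
    using p by (intro Lp_norm_cmult) auto
  finally show ?thesis .
qed

section \<open>Equivalence of the adapted norms forces bounded ratios\<close>

context lacunary
begin

lemma step_vanishes_near_0:
  assumes "\<And>k. a k \<le> c k" "\<And>k. b * c k \<le> a (k + 1)"
  shows "vanishes_near_0 (step_multiplier b c k)"
  unfolding vanishes_near_0_def
  using step_support(1)[OF assms] pos[of "k - 1"] by (intro exI[of _ "a (k - 1)"]) force

text \<open>Let the transitions take place at the left ends of the intervals \<open>[a k, a (k + 1)]\<close> (sequence \<open>a\<close>) or at the right
  ends (sequence \<open>a (k + 1) / b\<close>). A function with frequencies between \<open>b * a (k - 1)\<close> and \<open>a k / b\<close> is left alone by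
  the \<open>k\<close>-th convolution of the first and by the \<open>k - 1\<close>-st of the second partition.\<close>

lemma ratio_powr_bounded:
  fixes \<alpha> p q :: real
  assumes p: "1 < p" and q: "1 < q"
    and eq: "\<And>\<Phi> \<Psi> :: int \<Rightarrow> real ^ 'n::finite \<Rightarrow> complex.
           adapted_partition a \<Phi> \<Longrightarrow> adapted_partition a \<Psi> \<Longrightarrow>
           equivalent_norms tempered_mod_poly (adapted_TL_norm \<alpha> p q a \<Phi>) (adapted_TL_norm \<alpha> p q a \<Psi>)"
  obtains C where "0 < C" "\<And>k. b\<^sup>2 < a k / a (k - 1) \<Longrightarrow> (a k / a (k - 1)) powr \<bar>\<alpha>\<bar> \<le> C"
proof -
  define d where "d k = a (k + 1) / b" for k
  have a: "\<And>k. a k \<le> a k" "\<And>k. b * a k \<le> a (k + 1)" using ratio_mult by auto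
  have d: "\<And>k. a k \<le> d k" "\<And>k. b * d k \<le> a (k + 1)" using ratio_mult b by (auto simp: d_def pos_le_divide_eq mult.commute)
  define \<Phi> where "\<Phi> = (\<lambda>k. inv_fourier (step_multiplier b a k) :: real ^ 'n \<Rightarrow> complex)"
  define \<Psi> where "\<Psi> = (\<lambda>k. inv_fourier (step_multiplier b d k) :: real ^ 'n \<Rightarrow> complex)"
  have "adapted_partition a \<Phi>" "adapted_partition a \<Psi>"
    unfolding \<Phi>_def \<Psi>_def using adapted_partition_step[OF a] adapted_partition_step[OF d] by auto
  then have "equivalent_norms tempered_mod_poly (adapted_TL_norm \<alpha> p q a \<Phi>) (adapted_TL_norm \<alpha> p q a \<Psi>)" by (rule eq)
  then obtain C D where C: "0 < C" "\<And>f. f \<in> tempered_mod_poly \<Longrightarrow> adapted_TL_norm \<alpha> p q a \<Phi> f \<le> ennreal C * adapted_TL_norm \<alpha> p q a \<Psi> f"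
    and D: "0 < D" "\<And>f. f \<in> tempered_mod_poly \<Longrightarrow> adapted_TL_norm \<alpha> p q a \<Psi> f \<le> ennreal D * adapted_TL_norm \<alpha> p q a \<Phi> f"
    unfolding equivalent_norms_def by blast
  have "(a k / a (k - 1)) powr \<bar>\<alpha>\<bar> \<le> max C D" if k: "b\<^sup>2 < a k / a (k - 1)" for k
  proof -
    \<comment> \<open>\<open>lo\<close> and \<open>hi\<close> delimit the frequencies on the plateau
      of level \<open>k\<close> of the first partition and of level \<open>k - 1\<close> of the
      second. The window has positive width exactly if the ratio exceeds
      \<open>b\<^sup>2\<close>.\<close>
    define lo where "lo = b * a (k - 1)"
    define hi where "hi = a k / b"
    have lo: "0 < lo" using b pos[of "k - 1"] by (simp add: lo_def)
    have "b\<^sup>2 * a (k - 1) < a k" using k pos[of "k - 1"] by (simp add: pos_less_divide_eq)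
    then have lohi: "lo < hi" using b by (simp add: lo_def hi_def pos_less_divide_eq power2_eq_square mult_ac)
    define x0 where "x0 = ((lo + hi) / 2) *\<^sub>R axis (undefined :: 'n) (1 :: real)"
    have x0: "norm x0 = (lo + hi) / 2" using lo lohi by (simp add: x0_def)
    \<comment> \<open>A quarter of the width: the bump lives within distance \<open>2 * e\<close> of
      the midpoint radius, hence inside the window.\<close>
    define e where "e = (hi - lo) / 4"
    have e: "0 < e" using lohi by (simp add: e_def)
    let ?\<theta> = "\<lambda>\<xi>. cutoff 2 ((1 / e) *\<^sub>R (\<xi> - x0))"
    define g where "g = (\<lambda>\<xi>. complex_of_real (?\<theta> \<xi>))"
    have g: "test_function g" unfolding g_def by (rule test_function_bump[OF e])
    have supp: "lo \<le> norm \<xi> \<and> norm \<xi> \<le> hi" if "g \<xi> \<noteq> 0" for \<xi>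
    proof -
      have "\<not> 2 \<le> norm ((1 / e) *\<^sub>R (\<xi> - x0))" using that cutoff_eq_0[of 2 "(1 / e) *\<^sub>R (\<xi> - x0)"] by (auto simp: g_def)
      then have "norm (\<xi> - x0) < 2 * e" using e by (simp add: not_le pos_divide_less_eq)
      then have "\<bar>norm \<xi> - norm x0\<bar> < 2 * e" using norm_triangle_ineq3[of \<xi> x0] by linarith
      then have "norm \<xi> - (lo + hi) / 2 < 2 * ((hi - lo) / 4)" "- (norm \<xi> - (lo + hi) / 2) < 2 * ((hi - lo) / 4)"
        unfolding x0 e_def abs_less_iff by auto
      then show ?thesis by (simp add: field_simps)
    qed
    \<comment> \<open>The value at 0 is the integral of the nonnegative bump. It makes
      \<open>L\<close> nonzero, so \<open>L\<close> cancels when the two norms are compared.\<close>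
    have i0: "inv_fourier g 0 \<noteq> 0"
    proof -
      have "inv_fourier g 0 = of_real (LINT \<xi>|lborel. ?\<theta> \<xi>)" by (simp add: inv_fourier_def g_def)
      then show ?thesis using integral_bump_pos(2)[OF e, of x0] by simp
    qed
    let ?f = "equal_mod_poly `` {dist_of (inv_fourier g)}"
    have f: "?f \<in> tempered_mod_poly"
      unfolding tempered_mod_poly_def using tempered_dist_of[OF schwartz_inv_fourier[OF g]] by (auto intro: quotientI)
    define L where "L = Lp_norm p (\<lambda>x. ennreal (norm (inv_fourier g x)))"
    have "L < top" unfolding L_def using p by (intro Lp_norm_schwartz_finite schwartz_inv_fourier g) auto
    moreover have "L \<noteq> 0"
      unfolding L_def by (rule Lp_norm_pos[OF smooth_continuous_on[OF smooth_inv_fourier[OF test_function_rapid[OF g]]] i0])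
    ultimately obtain l where l: "L = ennreal l" "0 < l" by (cases L) (auto simp: less_le)
    have g_cases: "g \<xi> * step_multiplier b c i \<xi> = (if i = j then g \<xi> else 0)"
      if c: "\<And>k. a k \<le> c k" "\<And>k. b * c k \<le> a (k + 1)" and lh: "b * c (j - 1) \<le> lo" "hi \<le> c j" for c i j \<xi>
    proof (cases "g \<xi> = 0")
      case False
      then have "b * c (j - 1) \<le> norm \<xi>" "norm \<xi> \<le> c j" using supp lh by force+
      then show ?thesis
        by (cases "i = j") (simp_all add: step_eq_1[OF c] step_isolated[OF c, where k=j and j=i and \<xi>=\<xi>])
    qed simp
    have lh1: "b * a (k - 1) \<le> lo" "hi \<le> a k"
      using b pos[of k] by (simp_all add: lo_def hi_def pos_divide_le_eq)
    have lh2: "b * d ((k - 1) - 1) \<le> lo" "hi \<le> d (k - 1)"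
      using b pos[of "k - 1"] by (simp_all add: lo_def hi_def d_def)
    have N1: "adapted_TL_norm \<alpha> p q a \<Phi> ?f = ennreal (a k powr \<alpha>) * L"
      unfolding \<Phi>_def L_def
      by (rule adapted_TL_norm_single_frequency[OF p q pos g test_function_step[OF a] step_vanishes_near_0[OF a]])
         (simp_all add: g_cases[OF a lh1])
    have N2: "adapted_TL_norm \<alpha> p q a \<Psi> ?f = ennreal (a (k - 1) powr \<alpha>) * L"
      unfolding \<Psi>_def L_def
      by (rule adapted_TL_norm_single_frequency[OF p q pos g test_function_step[OF d] step_vanishes_near_0[OF d]])
         (simp_all add: g_cases[OF d lh2])
    have "ennreal (a k powr \<alpha> * l) \<le> ennreal (C * (a (k - 1) powr \<alpha> * l))"
      using C(2)[OF f] C(1) l by (simp add: N1 N2 ennreal_mult)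
    then have 1: "a k powr \<alpha> \<le> C * a (k - 1) powr \<alpha>" using C(1) l by (subst (asm) ennreal_le_iff) auto
    have "ennreal (a (k - 1) powr \<alpha> * l) \<le> ennreal (D * (a k powr \<alpha> * l))"
      using D(2)[OF f] D(1) l by (simp add: N1 N2 ennreal_mult)
    then have 2: "a (k - 1) powr \<alpha> \<le> D * a k powr \<alpha>" using D(1) l by (subst (asm) ennreal_le_iff) auto
    have pp: "0 < a k powr \<alpha>" "0 < a (k - 1) powr \<alpha>" using pos[of k] pos[of "k - 1"] by auto
    show ?thesis
    \<comment> \<open>The sign of \<open>\<alpha>\<close> decides which of the two inequalities
      bounds the ratio from above.\<close>
    proof (cases "0 \<le> \<alpha>")
      case True
      then have "(a k / a (k - 1)) powr \<bar>\<alpha>\<bar> \<le> C"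
        using 1 pp pos[of k] pos[of "k - 1"] by (simp add: powr_divide pos_divide_le_eq)
      then show ?thesis by simp
    next
      case False
      then have "(a k / a (k - 1)) powr \<bar>\<alpha>\<bar> = a (k - 1) powr \<alpha> / a k powr \<alpha>"
        using pos[of k] pos[of "k - 1"] by (simp add: powr_divide powr_minus)
      also have "\<dots> \<le> D" using 2 pp by (simp add: pos_divide_le_eq)
      finally show ?thesis by simp
    qed
  qed
  then show ?thesis using C(1) by (intro that[of "max C D"]) auto
qed

lemma ratio_bounded:
  fixes \<alpha> p q :: real
  assumes "\<alpha> \<noteq> 0" and p: "1 < p" and q: "1 < q"
    and eq: "\<And>\<Phi> \<Psi> :: int \<Rightarrow> real ^ 'n::finite \<Rightarrow> complex.
           adapted_partition a \<Phi> \<Longrightarrow> adapted_partition a \<Psi> \<Longrightarrow>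
           equivalent_norms tempered_mod_poly (adapted_TL_norm \<alpha> p q a \<Phi>) (adapted_TL_norm \<alpha> p q a \<Psi>)"
  shows "\<exists>C\<^sub>0>b. \<forall>k. a (k + 1) / a k \<le> C\<^sub>0"
proof -
  obtain C where C: "0 < C" "\<And>k. b\<^sup>2 < a k / a (k - 1) \<Longrightarrow> (a k / a (k - 1)) powr \<bar>\<alpha>\<bar> \<le> C"
    using ratio_powr_bounded[OF p q eq] by metis
  \<comment> \<open>Short intervals have ratio at most \<open>b\<^sup>2\<close>; for long ones the
    bounded power is undone by the exponent \<open>1 / \<bar>\<alpha>\<bar>\<close>, which is where
    \<open>\<alpha> \<noteq> 0\<close> enters. The summand \<open>b\<^sup>2\<close> also makes the
    bound exceed \<open>b\<close>.\<close>
  define C0 where "C0 = b\<^sup>2 + C powr (1 / \<bar>\<alpha>\<bar>)"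
  have "b < b\<^sup>2" using b by (simp add: power2_eq_square)
  then have "b < C0" by (simp add: C0_def add_strict_increasing2 add_pos_nonneg less_le_trans)
  moreover have "a (k + 1) / a k \<le> C0" for k
  proof (cases "b\<^sup>2 < a (k + 1) / a k")
    case True
    have r: "0 < a (k + 1) / a k" using pos by simp
    have "((a (k + 1) / a k) powr \<bar>\<alpha>\<bar>) powr (1 / \<bar>\<alpha>\<bar>) \<le> C powr (1 / \<bar>\<alpha>\<bar>)"
      using C(2)[of "k + 1"] True by (intro powr_mono2) auto
    moreover have "((a (k + 1) / a k) powr \<bar>\<alpha>\<bar>) powr (1 / \<bar>\<alpha>\<bar>) = a (k + 1) / a k"
      using \<open>\<alpha> \<noteq> 0\<close> less_imp_le[OF r] by (simp only: powr_powr) (simp add: abs_of_nonneg less_imp_le[OF pos])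
    ultimately have "a (k + 1) / a k \<le> C powr (1 / \<bar>\<alpha>\<bar>)" by simp
    then show ?thesis by (simp add: C0_def add_increasing)
  qed (simp add: C0_def add_increasing2)
  ultimately show ?thesis by blast
qed

end

section \<open>Comparison of Littlewood--Paley decompositions\<close>

text \<open>Symmetric intervals are cofinal among the finite sets; the sum becomes the limit of an
  increasing sequence, as monotone convergence requires.\<close>

lemma infsum_int_SUP:
  fixes f :: "int \<Rightarrow> ennreal"
  shows "infsum f UNIV = (SUP l::nat. sum f {- int l..int l})"
proof (rule antisym)
  show "infsum f UNIV \<le> (SUP l::nat. sum f {- int l..int l})"
    unfolding nonneg_infsum_complete[of UNIV f, simplified]
  proof (rule SUP_least)
    fix F :: "int set" assume "F \<in> {F. finite F}"
    then have F: "finite F" by simp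
    define l where "l = nat (Max (insert 0 (abs ` F)))"
    have "F \<subseteq> {- int l..int l}"
    proof
      fix k assume "k \<in> F"
      then have "\<bar>k\<bar> \<le> Max (insert 0 (abs ` F))" using F by (intro Max_ge) auto
      then show "k \<in> {- int l..int l}" by (auto simp: l_def)
    qed
    then have "sum f F \<le> sum f {- int l..int l}" by (intro sum_mono2) auto
    also have "\<dots> \<le> (SUP l::nat. sum f {- int l..int l})" by (rule SUP_upper) simp
    finally show "sum f F \<le> (SUP l::nat. sum f {- int l..int l})" .
  qed
  show "(SUP l::nat. sum f {- int l..int l}) \<le> infsum f UNIV"
    unfolding nonneg_infsum_complete[of UNIV f, simplified] by (intro SUP_least SUP_upper) auto
qed

lemma sum_le_infsum_ennreal:
  fixes f :: "int \<Rightarrow> ennreal"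
  assumes "finite F" shows "sum f F \<le> infsum f UNIV"
  unfolding nonneg_infsum_complete[of UNIV f, simplified] using assms by (intro SUP_upper) auto

text \<open>The numerator costs \<open>l ^ DIM('a)\<close> and the denominator
  \<open>l ^ (DIM('a) + 1)\<close>.\<close>

lemma decay_kernel_comparable:
  fixes z :: "'a::euclidean_space"
  assumes s: "0 < s" and t: "0 < t" and l: "1 \<le> l" "s \<le> l * t" "t \<le> l * s"
  shows "decay_kernel s z \<le> l ^ (2 * DIM('a) + 1) * decay_kernel t z"
proof -
  let ?n = "DIM('a)"
  have p: "0 < 1 + t * norm z" using t by (simp add: add_pos_nonneg)
  have "(1 + t * norm z) / l \<le> 1 + s * norm z"
  proof -
    have "t * norm z \<le> l * s * norm z" using l by (intro mult_right_mono) auto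
    then have "1 + t * norm z \<le> l * (1 + s * norm z)" using l(1) by (simp add: distrib_left mult.assoc)
    then show ?thesis using l(1) by (simp add: pos_divide_le_eq mult.commute)
  qed
  then have "decay_kernel s z \<le> (l * t) ^ ?n / ((1 + t * norm z) / l) ^ (?n + 1)"
    unfolding decay_kernel_def using s l p by (intro frac_le power_mono zero_less_power divide_pos_pos) auto
  also have "\<dots> = l ^ (2 * ?n + 1) * decay_kernel t z"
    using l(1) by (simp add: decay_kernel_def power_mult_distrib power_divide power_add mult_2 mult_2_right mult_ac)
  finally show ?thesis .
qed

lemma powr_comparable:
  fixes s t l \<alpha> :: real
  assumes s: "0 < s" and t: "0 < t" and l: "1 \<le> l" "s \<le> l * t" "t \<le> l * s"
  shows "s powr \<alpha> \<le> l powr \<bar>\<alpha>\<bar> * t powr \<alpha>"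
proof (cases "0 \<le> \<alpha>")
  case True
  then have "s powr \<alpha> \<le> (l * t) powr \<alpha>" using s l by (intro powr_mono2) auto
  then show ?thesis using True t l by (simp add: powr_mult)
next
  case False
  have "(l * s) powr \<alpha> \<le> t powr \<alpha>" using False s t l by (intro powr_mono2') auto
  then have "l powr \<alpha> * s powr \<alpha> \<le> t powr \<alpha>" using l s by (simp add: powr_mult)
  then have "l powr (- \<alpha>) * (l powr \<alpha> * s powr \<alpha>) \<le> l powr (- \<alpha>) * t powr \<alpha>" by (intro mult_left_mono) auto
  then show ?thesis using False l by (simp add: mult.assoc[symmetric] powr_add[symmetric])
qed

lemma kernel_op_cmult:
  fixes w :: "'a::euclidean_space \<Rightarrow> ennreal"
  assumes [measurable]: "w \<in> borel_measurable borel"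
  shows "kernel_op t (\<lambda>y. c * w y) x = c * kernel_op t w x"
proof -
  have "kernel_op t (\<lambda>y. c * w y) x = (\<integral>\<^sup>+y. c * (ennreal (decay_kernel t (x - y)) * w y) \<partial>lborel)"
    unfolding kernel_op_def by (simp add: mult_ac)
  then show ?thesis by (simp add: kernel_op_def nn_integral_cmult)
qed

text \<open>Step multipliers and dyadic dilates are compared through these properties only. Since
  both have them, one inequality, used in either direction, gives the equivalence.\<close>

definition frequency_system :: "(int \<Rightarrow> real) \<Rightarrow> (int \<Rightarrow> real ^ 'n::finite \<Rightarrow> complex) \<Rightarrow> bool" where
  "frequency_system s m \<longleftrightarrow> (\<forall>k. 0 < s k) \<and> (\<forall>k. test_function (m k)) \<and>
    (\<exists>A\<ge>1. \<forall>k \<xi>. m k \<xi> \<noteq> 0 \<longrightarrow> s k \<le> A * norm \<xi> \<and> norm \<xi> \<le> A * s k) \<and>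
    (\<forall>\<xi>. \<xi> \<noteq> 0 \<longrightarrow> ((\<lambda>k. m k \<xi>) has_sum 1) UNIV) \<and>
    (\<exists>D\<ge>0. \<forall>k x. norm (inv_fourier (m k) x) \<le> D * decay_kernel (s k) x) \<and>
    (\<forall>l. \<exists>N. \<forall>r>0. finite {k. s k \<le> l * r \<and> r \<le> l * s k} \<and> card {k. s k \<le> l * r \<and> r \<le> l * s k} \<le> N)"

definition system_norm :: "real \<Rightarrow> real \<Rightarrow> real \<Rightarrow> (int \<Rightarrow> real) \<Rightarrow> (int \<Rightarrow> real ^ 'n::finite \<Rightarrow> complex) \<Rightarrow> 'n functional \<Rightarrow> ennreal" where
  "system_norm \<alpha> p q s m u = Lp_norm p (\<lambda>x. ennpowr
       (\<Sum>\<^sub>\<infinity>k. ennreal (s k powr (\<alpha> * q) * norm (convol (inv_fourier (m k)) u x) powr q)) (1 / q))"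

lemma system_norm_eq:
  assumes "0 < p"
  shows "system_norm \<alpha> p q s m u = ennpowr (\<integral>\<^sup>+x. ennpowr
       (\<Sum>\<^sub>\<infinity>k. ennreal (s k powr (\<alpha> * q) * norm (convol (inv_fourier (m k)) u x) powr q)) (p / q) \<partial>lborel) (1 / p)"
  unfolding system_norm_def Lp_norm_def ennpowr_ennpowr by simp

text \<open>On the annulus of \<open>m k\<close> only the \<open>\<nu> j\<close> of comparable scale
  are nonzero, so multiplying by their sum 1 changes nothing. Each piece is the kernel of
  \<open>m k\<close> convolved with \<open>convol (inv_fourier (\<nu> j)) u\<close>, and
  comparability allows kernel and weight to be taken at the scale \<open>t j\<close>.\<close>

lemma frequency_system_pointwise:
  fixes m \<nu> :: "int \<Rightarrow> real ^ 'n::finite \<Rightarrow> complex"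
  assumes sm: "frequency_system s m" and t\<nu>: "frequency_system t \<nu>"
  shows "\<exists>l B. 1 \<le> l \<and> 0 \<le> B \<and>
    (\<forall>u k x. tempered u \<longrightarrow> ennreal (s k powr \<alpha> * norm (convol (inv_fourier (m k)) u x))
      \<le> ennreal B * (\<Sum>j | t j \<le> l * s k \<and> s k \<le> l * t j.
           kernel_op (t j) (\<lambda>y. ennreal (t j powr \<alpha> * norm (convol (inv_fourier (\<nu> j)) u y))) x))"
proof -
  obtain A where A: "1 \<le> A" "\<And>k \<xi>. m k \<xi> \<noteq> 0 \<Longrightarrow> s k \<le> A * norm \<xi> \<and> norm \<xi> \<le> A * s k"
    using sm unfolding frequency_system_def by blast
  obtain A' where A': "1 \<le> A'" "\<And>k \<xi>. \<nu> k \<xi> \<noteq> 0 \<Longrightarrow> t k \<le> A' * norm \<xi> \<and> norm \<xi> \<le> A' * t k"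
    using t\<nu> unfolding frequency_system_def by blast
  obtain D where D: "0 \<le> D" "\<And>k x. norm (inv_fourier (m k) x) \<le> D * decay_kernel (s k) x"
    using sm unfolding frequency_system_def by blast
  have s: "0 < s k" and m: "test_function (m k)" for k using sm unfolding frequency_system_def by auto
  have t: "0 < t k" and \<nu>: "test_function (\<nu> k)" for k using t\<nu> unfolding frequency_system_def by auto
  have one: "((\<lambda>k. \<nu> k \<xi>) has_sum 1) UNIV" if "\<xi> \<noteq> 0" for \<xi> using t\<nu> that unfolding frequency_system_def by auto
  \<comment> \<open>If \<open>m k\<close> and \<open>\<nu> j\<close> are both nonzero at some
    \<open>\<xi>\<close>, their scales are within the factors \<open>A\<close> and \<open>A'\<close>
    of \<open>norm \<xi>\<close>, hence within the product of each other.\<close>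
  define l where "l = A * A'"
  have l: "1 \<le> l" unfolding l_def using A(1) A'(1) mult_mono[of 1 A 1 A'] by simp
  define J where "J k = {j. t j \<le> l * s k \<and> s k \<le> l * t j}" for k
  have J: "finite (J k)" for k
  proof -
    have "finite {j. t j \<le> l * r \<and> r \<le> l * t j}" if "0 < r" for r
      using t\<nu> that unfolding frequency_system_def by blast
    then show ?thesis unfolding J_def using s by blast
  qed
  have decomp: "m k = (\<lambda>\<xi>. \<Sum>j\<in>J k. m k \<xi> * \<nu> j \<xi>)" for k
  proof
    fix \<xi>
    show "m k \<xi> = (\<Sum>j\<in>J k. m k \<xi> * \<nu> j \<xi>)"
    proof (cases "m k \<xi> = 0")
      case False
      have \<xi>: "s k \<le> A * norm \<xi>" "norm \<xi> \<le> A * s k" using A(2)[OF False] by auto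
      then have "\<xi> \<noteq> 0" using s[of k] by auto
      have "\<nu> j \<xi> = 0" if "j \<notin> J k" for j
      proof (rule ccontr)
        assume "\<nu> j \<xi> \<noteq> 0"
        from A'(2)[OF this] have j: "t j \<le> A' * norm \<xi>" "norm \<xi> \<le> A' * t j" by auto
        have "A' * norm \<xi> \<le> A' * (A * s k)" using \<xi>(2) A'(1) by (intro mult_left_mono) auto
        then have "t j \<le> l * s k" using j(1) by (simp add: l_def mult_ac)
        moreover have "A * norm \<xi> \<le> A * (A' * t j)" using j(2) A(1) by (intro mult_left_mono) auto
        then have "s k \<le> l * t j" using \<xi>(1) by (simp add: l_def mult_ac)
        ultimately show False using that by (simp add: J_def)
      qed
      then have "((\<lambda>j. \<nu> j \<xi>) has_sum (\<Sum>j\<in>J k. \<nu> j \<xi>)) UNIV"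
        using J by (intro has_sum_finite_neutralI[of "J k"]) auto
      then have "(\<Sum>j\<in>J k. \<nu> j \<xi>) = 1" using one[OF \<open>\<xi> \<noteq> 0\<close>] has_sum_unique by blast
      then show ?thesis by (simp add: sum_distrib_left[symmetric])
    qed simp
  qed
  \<comment> \<open>The first factor changes the weight from \<open>s k\<close> to
    \<open>t j\<close>; the second combines the kernel bound with its change of scale.\<close>
  define B where "B = l powr \<bar>\<alpha>\<bar> * (D * l ^ (2 * CARD('n) + 1))"
  have B0: "0 \<le> B" unfolding B_def using D l by simp
  have main: "ennreal (s k powr \<alpha> * norm (convol (inv_fourier (m k)) u x))
      \<le> ennreal B * (\<Sum>j\<in>J k. kernel_op (t j) (\<lambda>y. ennreal (t j powr \<alpha> * norm (convol (inv_fourier (\<nu> j)) u y))) x)"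
    if u: "tempered u" for u k x
  proof -
    define g where "g j = convol (inv_fourier (\<nu> j)) u" for j
    have gm[measurable]: "g j \<in> borel_measurable borel" for j
      unfolding g_def by (intro borel_measurable_continuous_onI convol_continuous u schwartz_inv_fourier \<nu>)
    have mm[measurable]: "inv_fourier (m k) \<in> borel_measurable borel" by (rule rapid_measurable[OF schwartz_rapid[OF schwartz_inv_fourier[OF m]]])
    have "convol (inv_fourier (m k)) u x = (\<Sum>j\<in>J k. convol (inv_fourier (\<lambda>\<xi>. m k \<xi> * \<nu> j \<xi>)) u x)"
      by (subst decomp, rule convol_sum[OF u J]) (intro test_function_mult \<nu> test_function_smooth m)
    also have "\<dots> = (\<Sum>j\<in>J k. LINT z|lborel. inv_fourier (m k) (x - z) * g j z)"
      unfolding g_def by (intro sum.cong refl convol_mult u m \<nu>)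
    finally have c: "norm (convol (inv_fourier (m k)) u x) \<le> (\<Sum>j\<in>J k. norm (LINT z|lborel. inv_fourier (m k) (x - z) * g j z))"
      by (simp add: norm_sum)
    have summand: "ennreal (s k powr \<alpha> * norm (LINT z|lborel. inv_fourier (m k) (x - z) * g j z))
        \<le> ennreal B * kernel_op (t j) (\<lambda>y. ennreal (t j powr \<alpha> * norm (g j y))) x" if j: "j \<in> J k" for j
    proof -
      have jl: "t j \<le> l * s k" "s k \<le> l * t j" using j by (auto simp: J_def)
      have "ennreal (norm (LINT z|lborel. inv_fourier (m k) (x - z) * g j z))
          \<le> (\<integral>\<^sup>+z. ennreal (norm (inv_fourier (m k) (x - z) * g j z)) \<partial>lborel)"
        by (rule integral_norm_bound_ennreal)
           (use convol_mult_integrable[OF u schwartz_inv_fourier[OF \<nu>] schwartz_reflect[OF schwartz_inv_fourier[OF m]], of j k x]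
             in \<open>simp add: g_def mult.commute\<close>)
      also have "\<dots> \<le> (\<integral>\<^sup>+z. ennreal (D * l ^ (2 * CARD('n) + 1)) * (ennreal (decay_kernel (t j) (x - z)) * ennreal (norm (g j z))) \<partial>lborel)"
      proof (rule nn_integral_mono)
        fix z
        have "norm (inv_fourier (m k) (x - z)) \<le> D * decay_kernel (s k) (x - z)" by (rule D)
        also have "\<dots> \<le> D * (l ^ (2 * CARD('n) + 1) * decay_kernel (t j) (x - z))"
          using decay_kernel_comparable[OF s t l jl(2,1), of "x - z"] D(1) by (intro mult_left_mono) auto
        finally have "norm (inv_fourier (m k) (x - z)) * norm (g j z) \<le> D * (l ^ (2 * CARD('n) + 1) * decay_kernel (t j) (x - z)) * norm (g j z)"
          by (intro mult_right_mono) auto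
        then show "ennreal (norm (inv_fourier (m k) (x - z) * g j z)) \<le> ennreal (D * l ^ (2 * CARD('n) + 1)) * (ennreal (decay_kernel (t j) (x - z)) * ennreal (norm (g j z)))"
          using D(1) l decay_kernel_nonneg[of "t j" "x - z"] t[of j]
          by (simp add: norm_mult ennreal_mult[symmetric] mult.assoc ennreal_leI)
      qed
      also have "\<dots> = ennreal (D * l ^ (2 * CARD('n) + 1)) * kernel_op (t j) (\<lambda>y. ennreal (norm (g j y))) x"
        by (simp add: kernel_op_def nn_integral_cmult)
      finally have 1: "ennreal (norm (LINT z|lborel. inv_fourier (m k) (x - z) * g j z))
        \<le> ennreal (D * l ^ (2 * CARD('n) + 1)) * kernel_op (t j) (\<lambda>y. ennreal (norm (g j y))) x" .
      have 2: "ennreal (s k powr \<alpha>) \<le> ennreal (l powr \<bar>\<alpha>\<bar> * t j powr \<alpha>)"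
        by (intro ennreal_leI powr_comparable s t l jl)
      have "ennreal (s k powr \<alpha> * norm (LINT z|lborel. inv_fourier (m k) (x - z) * g j z))
         = ennreal (s k powr \<alpha>) * ennreal (norm (LINT z|lborel. inv_fourier (m k) (x - z) * g j z))"
        by (rule ennreal_mult) auto
      also have "\<dots> \<le> ennreal (l powr \<bar>\<alpha>\<bar> * t j powr \<alpha>) * (ennreal (D * l ^ (2 * CARD('n) + 1)) * kernel_op (t j) (\<lambda>y. ennreal (norm (g j y))) x)"
        by (intro mult_mono 1 2) auto
      also have "\<dots> = ennreal B * (ennreal (t j powr \<alpha>) * kernel_op (t j) (\<lambda>y. ennreal (norm (g j y))) x)"
        using D(1) l by (simp add: B_def ennreal_mult mult_ac)
      also have "ennreal (t j powr \<alpha>) * kernel_op (t j) (\<lambda>y. ennreal (norm (g j y))) x = kernel_op (t j) (\<lambda>y. ennreal (t j powr \<alpha> * norm (g j y))) x"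
        by (subst kernel_op_cmult[symmetric]) (auto simp: ennreal_mult)
      finally show ?thesis .
    qed
    have "ennreal (s k powr \<alpha> * norm (convol (inv_fourier (m k)) u x)) \<le> ennreal (\<Sum>j\<in>J k. s k powr \<alpha> * norm (LINT z|lborel. inv_fourier (m k) (x - z) * g j z))"
      unfolding sum_distrib_left[symmetric] by (intro ennreal_leI mult_left_mono c) auto
    also have "\<dots> = (\<Sum>j\<in>J k. ennreal (s k powr \<alpha> * norm (LINT z|lborel. inv_fourier (m k) (x - z) * g j z)))"
      by (rule sum_ennreal[symmetric]) auto
    also have "\<dots> \<le> (\<Sum>j\<in>J k. ennreal B * kernel_op (t j) (\<lambda>y. ennreal (t j powr \<alpha> * norm (g j y))) x)"
      by (intro sum_mono summand)
    finally show ?thesis unfolding g_def by (simp add: sum_distrib_left)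
  qed
  show ?thesis
    by (rule exI[of _ l], rule exI[of _ B]) (use main l B0 in \<open>simp add: J_def\<close>)
qed

text \<open>The vector-valued inequality concerns finite families, with a constant independent of
  the family. Hence finite partial sums over \<open>k\<close> are estimated first, each involving
  finitely many \<open>j\<close>, and monotone convergence extends the bound.\<close>

theorem system_norm_le:
  fixes m \<nu> :: "int \<Rightarrow> real ^ 'n::finite \<Rightarrow> complex"
  assumes sm: "frequency_system s m" and t\<nu>: "frequency_system t \<nu>" and p: "1 < p" and q: "1 < q"
  obtains C where "0 < C" "\<And>u. tempered u \<Longrightarrow> system_norm \<alpha> p q s m u \<le> ennreal C * system_norm \<alpha> p q t \<nu> u"
proof -
  have s: "0 < s k" and m: "test_function (m k)" for k using sm unfolding frequency_system_def by auto
  have t: "0 < t k" and \<nu>: "test_function (\<nu> k)" for k using t\<nu> unfolding frequency_system_def by auto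
  obtain l B where l: "1 \<le> l" and B: "0 \<le> B" and pt: "\<And>u k x. tempered u \<Longrightarrow> ennreal (s k powr \<alpha> * norm (convol (inv_fourier (m k)) u x))
      \<le> ennreal B * (\<Sum>j | t j \<le> l * s k \<and> s k \<le> l * t j.
           kernel_op (t j) (\<lambda>y. ennreal (t j powr \<alpha> * norm (convol (inv_fourier (\<nu> j)) u y))) x)"
    using frequency_system_pointwise[OF sm t\<nu>, of \<alpha>] by (elim exE conjE) (rule that, auto)
  define J where "J k = {j. t j \<le> l * s k \<and> s k \<le> l * t j}" for k
  obtain N1 where N1: "\<And>r. 0 < r \<Longrightarrow> finite {j. t j \<le> l * r \<and> r \<le> l * t j} \<and> card {j. t j \<le> l * r \<and> r \<le> l * t j} \<le> N1"
    using t\<nu> unfolding frequency_system_def by meson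
  obtain N2 where N2: "\<And>r. 0 < r \<Longrightarrow> finite {k. s k \<le> l * r \<and> r \<le> l * s k} \<and> card {k. s k \<le> l * r \<and> r \<le> l * s k} \<le> N2"
    using sm unfolding frequency_system_def by meson
  have J: "finite (J k)" "card (J k) \<le> N1" for k using N1[OF s[of k]] by (auto simp: J_def)
  have J': "finite {k. j \<in> J k}" "card {k. j \<in> J k} \<le> N2" for j
    using N2[OF t[of j]] by (auto simp: J_def conj_commute)
  obtain V where V: "0 \<le> V" "\<And>(K :: int set) t (g :: int \<Rightarrow> real ^ 'n \<Rightarrow> real).
    finite K \<Longrightarrow> (\<And>k. k \<in> K \<Longrightarrow> 0 < t k) \<Longrightarrow> (\<And>k. k \<in> K \<Longrightarrow> g k \<in> borel_measurable borel) \<Longrightarrow>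
    (\<And>k x. k \<in> K \<Longrightarrow> 0 \<le> g k x) \<Longrightarrow>
    (\<integral>\<^sup>+x. ennpowr (\<Sum>k\<in>K. ennpowr (kernel_op (t k) (\<lambda>y. ennreal (g k y)) x) q) (p / q) \<partial>lborel)
      \<le> ennreal V * (\<integral>\<^sup>+x. ennpowr (\<Sum>k\<in>K. ennreal (g k x powr q)) (p / q) \<partial>lborel)"
  proof (rule kernel_op_vector_bound[OF p q])
    fix V assume V: "0 \<le> V" and bound: "\<And>(K :: int set) t (g :: int \<Rightarrow> real ^ 'n \<Rightarrow> real).
      finite K \<Longrightarrow> (\<And>k. k \<in> K \<Longrightarrow> 0 < t k) \<Longrightarrow> (\<And>k. k \<in> K \<Longrightarrow> g k \<in> borel_measurable borel) \<Longrightarrow>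
      (\<And>k x. k \<in> K \<Longrightarrow> 0 \<le> g k x) \<Longrightarrow>
      (\<integral>\<^sup>+x. ennpowr (\<Sum>k\<in>K. ennpowr (kernel_op (t k) (\<lambda>y. ennreal (g k y)) x) q) (p / q) \<partial>lborel)
        \<le> ennreal V * (\<integral>\<^sup>+x. ennpowr (\<Sum>k\<in>K. ennreal (g k x powr q)) (p / q) \<partial>lborel)"
    show thesis by (rule that[OF V bound])
  qed
  \<comment> \<open>\<open>B\<close> comes from the pointwise bound, \<open>N1\<close> from the
    \<open>q\<close>-th power of a sum of at most \<open>N1\<close> terms, and \<open>N2\<close>
    counts how many \<open>k\<close> share the same \<open>j\<close>.\<close>
  define c where "c = B powr q * real N1 powr q * real N2"
  have c: "0 \<le> c" by (simp add: c_def)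
  \<comment> \<open>The summand 1 secures \<open>0 < C\<close>, since the first term may be
    0.\<close>
  define C where "C = (c powr (p / q) * V) powr (1 / p) + 1"
  have "0 < C" by (simp add: C_def add_nonneg_pos)
  moreover have "system_norm \<alpha> p q s m u \<le> ennreal C * system_norm \<alpha> p q t \<nu> u" if u: "tempered u" for u
  proof -
    define f where "f k x = norm (convol (inv_fourier (m k)) u x)" for k x
    define g where "g j x = norm (convol (inv_fourier (\<nu> j)) u x)" for j x
    have f[measurable]: "f k \<in> borel_measurable borel" for k
    proof -
    have [measurable]: "convol (inv_fourier (m k)) u \<in> borel_measurable borel"
      by (rule borel_measurable_continuous_onI[OF convol_continuous[OF u schwartz_inv_fourier[OF m]]])
    show ?thesis unfolding f_def by measurable
  qed
    have g[measurable]: "g k \<in> borel_measurable borel" for k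
    proof -
    have [measurable]: "convol (inv_fourier (\<nu> k)) u \<in> borel_measurable borel"
      by (rule borel_measurable_continuous_onI[OF convol_continuous[OF u schwartz_inv_fourier[OF \<nu>]]])
    show ?thesis unfolding g_def by measurable
  qed
    have fg0: "0 \<le> f k x" "0 \<le> g k x" for k x by (auto simp: f_def g_def)
    define F where "F k x = ennreal (s k powr (\<alpha> * q) * f k x powr q)" for k x
    define G where "G k x = ennreal (t k powr (\<alpha> * q) * g k x powr q)" for k x
    have F: "F k x = ennpowr (ennreal (s k powr \<alpha> * f k x)) q" for k x
      using fg0 by (simp add: F_def ennpowr_ennreal powr_mult powr_powr)
    define Y where "Y j x = ennpowr (kernel_op (t j) (\<lambda>y. ennreal (t j powr \<alpha> * g j y)) x) q" for j x
    have FY: "F k x \<le> ennreal (B powr q * real N1 powr q) * (\<Sum>j\<in>J k. Y j x)" for k x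
    proof -
      have "F k x \<le> ennpowr (ennreal B * (\<Sum>j\<in>J k. kernel_op (t j) (\<lambda>y. ennreal (t j powr \<alpha> * g j y)) x)) q"
        unfolding F using pt[OF u, of k x] q by (intro ennpowr_mono[of q]) (auto simp: f_def g_def J_def)
      also have "\<dots> = ennreal (B powr q) * ennpowr (\<Sum>j\<in>J k. kernel_op (t j) (\<lambda>y. ennreal (t j powr \<alpha> * g j y)) x) q"
        using q B by (simp add: ennpowr_mult ennpowr_ennreal)
      also have "\<dots> \<le> ennreal (B powr q) * (ennreal (real (card (J k)) powr q) * (\<Sum>j\<in>J k. Y j x))"
        unfolding Y_def using q J by (intro mult_left_mono ennpowr_sum_le) auto
      also have "\<dots> \<le> ennreal (B powr q) * (ennreal (real N1 powr q) * (\<Sum>j\<in>J k. Y j x))"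
        using q J(2)[of k] by (intro mult_left_mono mult_right_mono ennreal_leI powr_mono2) auto
      finally show ?thesis by (simp add: ennreal_mult mult.assoc)
    qed
    have finite_bound: "(\<integral>\<^sup>+x. ennpowr (\<Sum>k\<in>K. F k x) (p / q) \<partial>lborel)
        \<le> ennreal (c powr (p / q) * V) * (\<integral>\<^sup>+x. ennpowr (\<Sum>\<^sub>\<infinity>j. G j x) (p / q) \<partial>lborel)" if K: "finite K" for K
    proof -
      define L where "L = (\<Union>k\<in>K. J k)"
      have L: "finite L" unfolding L_def using K J by auto
      have sumF: "(\<Sum>k\<in>K. F k x) \<le> ennreal c * (\<Sum>j\<in>L. Y j x)" for x
      proof -
        have "(\<Sum>k\<in>K. F k x) \<le> (\<Sum>k\<in>K. ennreal (B powr q * real N1 powr q) * (\<Sum>j\<in>J k. Y j x))"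
          by (intro sum_mono FY)
        also have "\<dots> = ennreal (B powr q * real N1 powr q) * (\<Sum>k\<in>K. \<Sum>j\<in>J k. Y j x)" by (simp add: sum_distrib_left)
        also have "(\<Sum>k\<in>K. \<Sum>j\<in>J k. Y j x) = (\<Sum>k\<in>K. \<Sum>j\<in>{j\<in>L. j \<in> J k}. Y j x)"
          by (intro sum.cong refl) (auto simp: L_def)
        \<comment> \<open>Exchanging the sums turns the neighbours of each \<open>k\<close> into the
          multiplicity of each \<open>j\<close>, which is at most \<open>N2\<close>.\<close>
        also have "\<dots> = (\<Sum>j\<in>L. \<Sum>k\<in>{k\<in>K. j \<in> J k}. Y j x)" by (rule sum.swap_restrict[OF K L])
        also have "\<dots> = (\<Sum>j\<in>L. of_nat (card {k\<in>K. j \<in> J k}) * Y j x)" by simp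
        also have "\<dots> \<le> (\<Sum>j\<in>L. ennreal (real N2) * Y j x)"
        proof (intro sum_mono mult_right_mono)
          fix j
          have "card {k\<in>K. j \<in> J k} \<le> card {k. j \<in> J k}" by (rule card_mono[OF J'(1)]) auto
          then have "card {k\<in>K. j \<in> J k} \<le> N2" using J'(2)[of j] by simp
          then show "(of_nat (card {k\<in>K. j \<in> J k}) :: ennreal) \<le> ennreal (real N2)"
            by (simp add: ennreal_of_nat_eq_real_of_nat)
        qed auto
        also have "\<dots> = ennreal (real N2) * (\<Sum>j\<in>L. Y j x)" by (simp add: sum_distrib_left)
        finally show ?thesis by (simp add: c_def ennreal_mult mult.assoc mult_left_mono)
      qed
      have h[measurable]: "(\<lambda>y. ennreal (t j powr \<alpha> * g j y)) \<in> borel_measurable borel" for j by measurable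
      have Ym: "Y j \<in> borel_measurable borel" for j unfolding Y_def by (intro ennpowr_measurable kernel_op_measurable h)
      have Ym2: "(\<lambda>x. ennpowr (\<Sum>j\<in>L. Y j x) (p / q)) \<in> borel_measurable lborel"
        using Ym by (intro ennpowr_measurable borel_measurable_sum) simp
      have "(\<integral>\<^sup>+x. ennpowr (\<Sum>k\<in>K. F k x) (p / q) \<partial>lborel) \<le> (\<integral>\<^sup>+x. ennpowr (ennreal c * (\<Sum>j\<in>L. Y j x)) (p / q) \<partial>lborel)"
        using p q by (intro nn_integral_mono ennpowr_mono sumF) auto
      also have "\<dots> = ennreal (c powr (p / q)) * (\<integral>\<^sup>+x. ennpowr (\<Sum>j\<in>L. Y j x) (p / q) \<partial>lborel)"
        using p q c Ym2 by (simp add: ennpowr_mult ennpowr_ennreal nn_integral_cmult)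
      also have "\<dots> \<le> ennreal (c powr (p / q)) * (ennreal V * (\<integral>\<^sup>+x. ennpowr (\<Sum>j\<in>L. ennreal ((t j powr \<alpha> * g j x) powr q)) (p / q) \<partial>lborel))"
        unfolding Y_def using L t fg0 by (intro mult_left_mono V) auto
      also have "(\<lambda>x. \<Sum>j\<in>L. ennreal ((t j powr \<alpha> * g j x) powr q)) = (\<lambda>x. \<Sum>j\<in>L. G j x)"
        using fg0 by (simp add: G_def powr_mult powr_powr)
      also have "(\<integral>\<^sup>+x. ennpowr (\<Sum>j\<in>L. G j x) (p / q) \<partial>lborel) \<le> (\<integral>\<^sup>+x. ennpowr (\<Sum>\<^sub>\<infinity>j. G j x) (p / q) \<partial>lborel)"
        using p q by (intro nn_integral_mono ennpowr_mono sum_le_infsum_ennreal L) auto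
      finally show ?thesis using V(1) by (simp add: ennreal_mult mult.assoc mult_left_mono)
    qed
    have "(\<integral>\<^sup>+x. ennpowr (\<Sum>\<^sub>\<infinity>k. F k x) (p / q) \<partial>lborel) = (\<integral>\<^sup>+x. (SUP l::nat. ennpowr (\<Sum>k\<in>{- int l..int l}. F k x) (p / q)) \<partial>lborel)"
      using p q by (simp add: infsum_int_SUP ennpowr_SUP)
    also have "\<dots> = (SUP l::nat. \<integral>\<^sup>+x. ennpowr (\<Sum>k\<in>{- int l..int l}. F k x) (p / q) \<partial>lborel)"
    proof (rule nn_integral_monotone_convergence_SUP)
      show "incseq (\<lambda>l x. ennpowr (\<Sum>k\<in>{- int l..int l}. F k x) (p / q))"
        using p q unfolding incseq_def le_fun_def by (intro allI impI ennpowr_mono sum_mono2) auto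
      show "(\<lambda>x. ennpowr (\<Sum>k\<in>{- int l..int l}. F k x) (p / q)) \<in> borel_measurable lborel" for l
        unfolding F_def by measurable
    qed
    also have "\<dots> \<le> ennreal (c powr (p / q) * V) * (\<integral>\<^sup>+x. ennpowr (\<Sum>\<^sub>\<infinity>j. G j x) (p / q) \<partial>lborel)"
      by (intro SUP_least finite_bound) simp
    finally have "ennpowr (\<integral>\<^sup>+x. ennpowr (\<Sum>\<^sub>\<infinity>k. F k x) (p / q) \<partial>lborel) (1 / p)
      \<le> ennpowr (ennreal (c powr (p / q) * V) * (\<integral>\<^sup>+x. ennpowr (\<Sum>\<^sub>\<infinity>j. G j x) (p / q) \<partial>lborel)) (1 / p)"
      using p by (intro ennpowr_mono[of "1 / p"]) auto
    also have "\<dots> = ennreal ((c powr (p / q) * V) powr (1 / p)) * ennpowr (\<integral>\<^sup>+x. ennpowr (\<Sum>\<^sub>\<infinity>j. G j x) (p / q) \<partial>lborel) (1 / p)"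
      using p V(1) by (simp add: ennpowr_mult[of "1 / p"] ennpowr_ennreal[of "c powr (p / q) * V"] del: ennreal_mult')
    also have "\<dots> \<le> ennreal C * ennpowr (\<integral>\<^sup>+x. ennpowr (\<Sum>\<^sub>\<infinity>j. G j x) (p / q) \<partial>lborel) (1 / p)"
      by (intro mult_right_mono ennreal_leI) (auto simp: C_def)
    finally show ?thesis
      using p by (simp add: system_norm_eq F_def G_def f_def g_def)
  qed
  ultimately show ?thesis by (rule that)
qed

section \<open>Step multipliers and dyadic dilates as frequency systems\<close>

lemma bounded_int_set_card:
  fixes S :: "int set"
  assumes "\<And>j k. j \<in> S \<Longrightarrow> k \<in> S \<Longrightarrow> j \<le> k \<Longrightarrow> k - j \<le> int M"
  shows "finite S \<and> card S \<le> 2 * M + 1"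
proof (cases "S = {}")
  case False
  then obtain i where i: "i \<in> S" by blast
  have S: "S \<subseteq> {i - int M..i + int M}"
  proof
    fix k assume k: "k \<in> S"
    show "k \<in> {i - int M..i + int M}"
      using assms[OF i k] assms[OF k i] by (cases "i \<le> k") auto
  qed
  then have "card S \<le> card {i - int M..i + int M}" by (intro card_mono) auto
  then show ?thesis using finite_subset[OF S] by simp
qed auto

text \<open>Two members within a factor \<open>l\<close> of the same \<open>r\<close> differ by at
  most the factor \<open>l * l\<close>, while \<open>k - j\<close> steps of the sequence multiply by
  at least \<open>b ^ nat (k - j)\<close>; this bounds the spread of the indices.\<close>

lemma lacunary_count:
  fixes a :: "int \<Rightarrow> real"
  assumes pos: "\<And>k. 0 < a k" and b: "1 < b" "\<And>k. b \<le> a (k + 1) / a k"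
  shows "\<exists>N. \<forall>r>0. finite {k. a k \<le> l * r \<and> r \<le> l * a k} \<and> card {k. a k \<le> l * r \<and> r \<le> l * a k} \<le> N"
proof -
  obtain M where M: "l * l < b ^ M" using real_arch_pow[OF b(1)] by blast
  have "finite {k. a k \<le> l * r \<and> r \<le> l * a k} \<and> card {k. a k \<le> l * r \<and> r \<le> l * a k} \<le> 2 * M + 1" if "0 < r" for r
  proof (rule bounded_int_set_card)
    fix j k assume "j \<in> {k. a k \<le> l * r \<and> r \<le> l * a k}" "k \<in> {k. a k \<le> l * r \<and> r \<le> l * a k}" "j \<le> k"
    then have jk: "r \<le> l * a j" "a k \<le> l * r" "j \<le> k" by auto
    \<comment> \<open>\<open>l\<close> is an arbitrary real number; its positivity is forced by the
      presence of an index in the set.\<close>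
    have "0 < l * r" using jk(2) pos[of k] by linarith
    then have l: "0 < l" using that by (simp add: zero_less_mult_iff)
    have "a j * b ^ nat (k - j) \<le> a (j + int (nat (k - j)))" using b by (intro lacunary_mult_power_le pos) auto
    also have "\<dots> \<le> l * r" using jk by simp
    also have "\<dots> \<le> l * (l * a j)" using jk(1) l by (intro mult_left_mono) auto
    finally have "a j * b ^ nat (k - j) \<le> a j * (l * l)" by (simp add: mult_ac)
    then have "b ^ nat (k - j) < b ^ M" using pos[of j] M by simp
    then have "nat (k - j) < M" using b(1) by simp
    then show "k - j \<le> int M" by simp
  qed
  then show ?thesis by blast
qed

context lacunary
begin

text \<open>The upper bound \<open>C\<close> puts both ends of the support, \<open>a (k - 1)\<close>
  and \<open>a (k + 1)\<close>, within a factor \<open>C\<close> of the scale \<open>a k\<close>. As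
  the kernel of a dilated cutoff is a dilated kernel, one decay constant serves all scales.\<close>

lemma frequency_system_step:
  assumes C: "\<And>k. a (k + 1) / a k \<le> C"
  shows "frequency_system a (step_multiplier b a :: int \<Rightarrow> real ^ 'n::finite \<Rightarrow> complex)"
  unfolding frequency_system_def
proof (intro conjI allI impI)
  have c: "\<And>k. a k \<le> a k" "\<And>k. b * a k \<le> a (k + 1)" using ratio_mult by auto
  have aC: "a (k + 1) \<le> C * a k" for k using C[of k] pos[of k] by (simp add: pos_divide_le_eq)
  have C1: "1 \<le> C" using ratio[of 0] C[of 0] b by linarith
  show "0 < a k" for k by (rule pos)
  show "test_function (step_multiplier b a k)" for k by (rule test_function_step[OF c])
  show "\<exists>A\<ge>1. \<forall>k \<xi>. step_multiplier b a k (\<xi> :: real ^ 'n) \<noteq> 0 \<longrightarrow> a k \<le> A * norm \<xi> \<and> norm \<xi> \<le> A * a k"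
  proof (rule exI[of _ C], intro conjI allI impI C1)
    fix k and \<xi> :: "real ^ 'n" assume "step_multiplier b a k \<xi> \<noteq> 0"
    from step_support[OF c this] have \<xi>: "a (k - 1) \<le> norm \<xi>" "norm \<xi> \<le> a (k + 1)" .
    have "a k \<le> C * a (k - 1)" using aC[of "k - 1"] by simp
    also have "\<dots> \<le> C * norm \<xi>" using \<xi>(1) C1 by (intro mult_left_mono) auto
    finally show "a k \<le> C * norm \<xi>" .
    show "norm \<xi> \<le> C * a k" using \<xi>(2) aC[of k] by simp
  qed
  show "((\<lambda>k. step_multiplier b a k \<xi>) has_sum 1) UNIV" if "\<xi> \<noteq> 0" for \<xi> :: "real ^ 'n" by (rule step_has_sum[OF c that])
  show "\<exists>D\<ge>0. \<forall>k x. norm (inv_fourier (step_multiplier b a k) (x :: real ^ 'n)) \<le> D * decay_kernel (a k) x"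
  proof -
    let ?\<theta> = "\<lambda>\<xi>::real ^ 'n. complex_of_real (cutoff b \<xi>)"
    have \<theta>: "test_function ?\<theta>" by (rule test_function_cutoff[OF b])
    have "schwartz (inv_fourier ?\<theta>)" by (rule schwartz_inv_fourier[OF \<theta>])
    then obtain D where D: "\<And>x. (1 + norm x) ^ (CARD('n) + 1) * norm (partials [] (inv_fourier ?\<theta>) x) \<le> D"
      using schwartz_decay by blast
    have D0: "0 \<le> D" using order.trans[OF _ D[of 0]] by simp
    have k1: "norm (inv_fourier (scaled_cutoff b s) x) \<le> D * decay_kernel s x" if s: "0 < s" for s and x :: "real ^ 'n"
    proof -
      have p: "0 < (1 + s * norm x) ^ (CARD('n) + 1)" using s by (intro zero_less_power add_pos_nonneg) auto
      have "inv_fourier (scaled_cutoff b s) x = of_real (s ^ CARD('n)) * inv_fourier ?\<theta> (s *\<^sub>R x)"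
        using inv_fourier_dilate[OF rapid_integrable[OF test_function_rapid[OF \<theta>]] s, of x]
        by (simp only: scaled_cutoff_def[abs_def])
      then have "norm (inv_fourier (scaled_cutoff b s) x) = s ^ CARD('n) * norm (inv_fourier ?\<theta> (s *\<^sub>R x))"
        using s by (simp add: norm_mult norm_power)
      also have "norm (inv_fourier ?\<theta> (s *\<^sub>R x)) \<le> D / (1 + s * norm x) ^ (CARD('n) + 1)"
        using D[of "s *\<^sub>R x"] s p by (simp add: pos_le_divide_eq mult.commute)
      finally show ?thesis using s by (simp add: decay_kernel_def mult_left_mono mult.commute)
    qed
    \<comment> \<open>The second term is the price of moving the kernel of the lower cutoff from the
      scale \<open>a (k - 1)\<close> to \<open>a k\<close>.\<close>
    define E where "E = D + D * C ^ (2 * CARD('n) + 1)"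
    have "norm (inv_fourier (step_multiplier b a k) x) \<le> E * decay_kernel (a k) x" for k and x :: "real ^ 'n"
    proof -
      have "inv_fourier (step_multiplier b a k) x = inv_fourier (scaled_cutoff b (a k)) x + inv_fourier (\<lambda>\<xi>. (-1) * scaled_cutoff b (a (k - 1)) \<xi>) x"
        using inv_fourier_add[OF test_function_scaled_cutoff[OF b pos[of k]] test_function_cmult[OF test_function_scaled_cutoff[OF b pos[of "k - 1"]], of "-1"], of x]
        by (simp add: step_multiplier_def[abs_def])
      then have "norm (inv_fourier (step_multiplier b a k) x) \<le> norm (inv_fourier (scaled_cutoff b (a k)) x) + norm (inv_fourier (scaled_cutoff b (a (k - 1))) x)"
        unfolding inv_fourier_cmult by (metis norm_triangle_ineq norm_minus_cancel mult_minus1)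
      also have "\<dots> \<le> D * decay_kernel (a k) x + D * decay_kernel (a (k - 1)) x" by (intro add_mono k1 pos)
      also have "decay_kernel (a (k - 1)) x \<le> C ^ (2 * DIM(real ^ 'n) + 1) * decay_kernel (a k) x"
      proof (rule decay_kernel_comparable[OF pos pos C1])
        have "1 * a k \<le> C * a k" using C1 pos[of k] by (intro mult_right_mono) auto
        then show "a (k - 1) \<le> C * a k" using mono[of "k - 1" k] by simp
        show "a k \<le> C * a (k - 1)" using aC[of "k - 1"] by simp
      qed
      finally show ?thesis using D0 by (simp add: E_def distrib_right mult.assoc mult_left_mono)
    qed
    moreover have "0 \<le> E" unfolding E_def using D0 C1 by simp
    ultimately show ?thesis by blast
  qed
  show "\<exists>N. \<forall>r>0. finite {k. a k \<le> l * r \<and> r \<le> l * a k} \<and> card {k. a k \<le> l * r \<and> r \<le> l * a k} \<le> N" for l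
    by (rule lacunary_count[where a=a and b=b, OF pos b ratio])
qed

end

lemma frequency_system_dyadic:
  fixes \<phi> :: "real ^ 'n::finite \<Rightarrow> complex"
  assumes \<phi>: "dyadic_generator \<phi>"
  shows "frequency_system (\<lambda>j. 2 powr real_of_int j) (\<lambda>j \<xi>. \<phi> ((2 powi (- j)) *\<^sub>R \<xi>))"
  unfolding frequency_system_def
proof (intro conjI allI impI)
  obtain r R where r: "0 < r" "r < R" "closure (support_on UNIV \<phi>) \<subseteq> annulus r R" and sm: "smooth \<phi>"
    using \<phi> unfolding dyadic_generator_def by blast
  have supp: "r \<le> norm \<xi> \<and> norm \<xi> \<le> R" if "\<phi> \<xi> \<noteq> 0" for \<xi>
  proof -
    have "\<xi> \<in> closure (support_on UNIV \<phi>)" using that closure_subset by (fastforce simp: support_on_def)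
    then show ?thesis using r(3) by (auto simp: annulus_def)
  qed
  have test: "test_function \<phi>"
    unfolding test_function_def using sm supp by (intro conjI exI[of _ R] allI impI) fastforce+
  have pw: "2 powi (- j) = 1 / (2 powr real_of_int j :: real)" for j
    by (simp add: powr_real_of_int' power_int_minus inverse_eq_divide)
  show "0 < (2::real) powr real_of_int j" for j by simp
  have dil: "test_function (\<lambda>\<xi>. \<phi> (c *\<^sub>R \<xi>))" if c: "0 < c" for c
  proof -
    have "smooth (\<lambda>\<xi>. \<phi> (c *\<^sub>R \<xi>))" using smooth_affine_comp[OF sm, of c 0] by simp
    moreover have "\<phi> (c *\<^sub>R \<xi>) = 0" if "R / c < norm \<xi>" for \<xi>
      using supp[of "c *\<^sub>R \<xi>"] that c by (auto simp: pos_divide_less_eq mult.commute)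
    ultimately show ?thesis unfolding test_function_def by blast
  qed
  show "test_function (\<lambda>\<xi>. \<phi> ((2 powi (- j)) *\<^sub>R \<xi>))" for j by (rule dil) simp
  show "\<exists>A\<ge>1. \<forall>j \<xi>. \<phi> ((2 powi (- j)) *\<^sub>R \<xi>) \<noteq> 0 \<longrightarrow> 2 powr real_of_int j \<le> A * norm \<xi> \<and> norm \<xi> \<le> A * 2 powr real_of_int j"
  \<comment> \<open>\<open>1 / r\<close> and \<open>R\<close> stem from the inner and the outer
    radius of the annulus; the 1 makes the constant at least 1.\<close>
  proof (rule exI[of _ "1 + 1 / r + R"], intro conjI allI impI)
    show "1 \<le> 1 + 1 / r + R" using r by simp
    fix j \<xi> assume "\<phi> ((2 powi (- j)) *\<^sub>R \<xi>) \<noteq> 0"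
    from supp[OF this] have \<xi>: "r * 2 powr real_of_int j \<le> norm \<xi>" "norm \<xi> \<le> R * 2 powr real_of_int j"
      by (simp_all add: pw pos_le_divide_eq pos_divide_le_eq)
    have "2 powr real_of_int j \<le> 1 / r * norm \<xi>" using \<xi>(1) r(1) by (simp add: pos_le_divide_eq mult.commute)
    also have "\<dots> \<le> (1 + 1 / r + R) * norm \<xi>" using r by (intro mult_right_mono) auto
    finally show "2 powr real_of_int j \<le> (1 + 1 / r + R) * norm \<xi>" .
    have "R * 2 powr real_of_int j \<le> (1 + 1 / r + R) * 2 powr real_of_int j" using r by (intro mult_right_mono) auto
    then show "norm \<xi> \<le> (1 + 1 / r + R) * 2 powr real_of_int j" using \<xi>(2) by linarith
  qed
  show "((\<lambda>j. \<phi> ((2 powi (- j)) *\<^sub>R \<xi>)) has_sum 1) UNIV" if "\<xi> \<noteq> 0" for \<xi>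
    using \<phi> that unfolding dyadic_generator_def by blast
  show "\<exists>D\<ge>0. \<forall>j x. norm (inv_fourier (\<lambda>\<xi>. \<phi> ((2 powi (- j)) *\<^sub>R \<xi>)) x) \<le> D * decay_kernel (2 powr real_of_int j) x"
  proof -
    obtain D where D: "\<And>x. (1 + norm x) ^ (CARD('n) + 1) * norm (partials [] (inv_fourier \<phi>) x) \<le> D"
      using schwartz_decay[OF schwartz_inv_fourier[OF test]] by blast
    have D0: "0 \<le> D" using order.trans[OF _ D[of 0]] by simp
    have "norm (inv_fourier (\<lambda>\<xi>. \<phi> ((2 powi (- j)) *\<^sub>R \<xi>)) x) \<le> D * decay_kernel (2 powr real_of_int j) x" for j x
    proof -
      define s :: real where "s = 2 powr real_of_int j"
      have s: "0 < s" by (simp add: s_def)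
      have p: "0 < (1 + s * norm x) ^ (CARD('n) + 1)" using s by (intro zero_less_power add_pos_nonneg) auto
      have "inv_fourier (\<lambda>\<xi>. \<phi> ((2 powi (- j)) *\<^sub>R \<xi>)) x = of_real (s ^ CARD('n)) * inv_fourier \<phi> (s *\<^sub>R x)"
        unfolding pw s_def[symmetric] by (rule inv_fourier_dilate[OF rapid_integrable[OF test_function_rapid[OF test]] s])
      then have "norm (inv_fourier (\<lambda>\<xi>. \<phi> ((2 powi (- j)) *\<^sub>R \<xi>)) x) = s ^ CARD('n) * norm (inv_fourier \<phi> (s *\<^sub>R x))"
        using s by (simp add: norm_mult norm_power)
      also have "norm (inv_fourier \<phi> (s *\<^sub>R x)) \<le> D / (1 + s * norm x) ^ (CARD('n) + 1)"
        using D[of "s *\<^sub>R x"] s p by (simp add: pos_le_divide_eq mult.commute)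
      finally show ?thesis using s by (simp add: decay_kernel_def mult_left_mono mult.commute s_def)
    qed
    then show ?thesis using D0 by blast
  qed
  show "\<exists>N. \<forall>r>0. finite {k. 2 powr real_of_int k \<le> l * r \<and> r \<le> l * 2 powr real_of_int k} \<and>
      card {k. 2 powr real_of_int k \<le> l * r \<and> r \<le> l * 2 powr real_of_int k} \<le> N" for l
    by (rule lacunary_count[where b=2]) (auto simp: powr_add)
qed

text \<open>After \<open>function_of_multiplier\<close> has replaced the representing functions by
  convolutions, the two expressions differ only in how the power of 2 is written.\<close>

lemma TL_dist_norm_eq_system_norm:
  assumes \<phi>: "dyadic_generator \<phi>" and u: "tempered u"
  shows "TL_dist_norm \<alpha> p q \<phi> u = system_norm \<alpha> p q (\<lambda>j. 2 powr real_of_int j) (\<lambda>j \<xi>. \<phi> ((2 powi (- j)) *\<^sub>R \<xi>)) u"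
proof -
  have m: "test_function (\<lambda>\<xi>. \<phi> ((2 powi (- j)) *\<^sub>R \<xi>))" for j
    using frequency_system_dyadic[OF \<phi>] unfolding frequency_system_def by blast
  have e: "norm ((2 powr (\<alpha> * real_of_int j)) *\<^sub>R z) powr q = (2 powr real_of_int j) powr (\<alpha> * q) * norm z powr q" for j :: int and z :: complex
    by (simp add: powr_mult powr_powr mult_ac)
  show ?thesis
    unfolding TL_dist_norm_def system_norm_def function_of_multiplier[OF u m] e ..
qed

lemma equivalent_norms_trans:
  assumes "equivalent_norms X N1 N2" "equivalent_norms X N2 N3"
  shows "equivalent_norms X N1 N3"
proof -
  have *: "\<exists>C>0. \<forall>f\<in>X. N f \<le> ennreal C * N'' f"
    if "\<exists>C>0. \<forall>f\<in>X. N f \<le> ennreal C * N' f" "\<exists>C>0. \<forall>f\<in>X. N' f \<le> ennreal C * N'' f" for N N' N'' :: "'a \<Rightarrow> ennreal"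
  proof -
    obtain C D where C: "0 < C" "\<And>f. f \<in> X \<Longrightarrow> N f \<le> ennreal C * N' f" and D: "0 < D" "\<And>f. f \<in> X \<Longrightarrow> N' f \<le> ennreal D * N'' f"
      using \<open>\<exists>C>0. \<forall>f\<in>X. N f \<le> ennreal C * N' f\<close> \<open>\<exists>C>0. \<forall>f\<in>X. N' f \<le> ennreal C * N'' f\<close> by blast
    have "N f \<le> ennreal (C * D) * N'' f" if "f \<in> X" for f
      using order.trans[OF C(2)[OF that] mult_left_mono[OF D(2)[OF that], of "ennreal C"]] C(1) D(1)
      by (simp add: ennreal_mult mult.assoc)
    then show ?thesis using C(1) D(1) by (intro exI[of _ "C * D"]) auto
  qed
  show ?thesis using assms *[of N1 N2 N3] *[of N3 N2 N1] unfolding equivalent_norms_def by blast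
qed

theorem proposition1:
  fixes \<alpha> p q b :: real and a :: "int \<Rightarrow> real"
  assumes "\<alpha> \<noteq> 0"
    and "1 < p" and "1 < q"
    and "\<And>k. 0 < a k"
    and "1 < b"
    and "\<And>k. b \<le> a (k + 1) / a k"
    and "\<And>\<Phi> \<Psi> :: int \<Rightarrow> real ^ 'n::finite \<Rightarrow> complex.
           adapted_partition a \<Phi> \<Longrightarrow> adapted_partition a \<Psi> \<Longrightarrow>
           equivalent_norms tempered_mod_poly
             (adapted_TL_norm \<alpha> p q a \<Phi>) (adapted_TL_norm \<alpha> p q a \<Psi>)"
  shows "(\<exists>C\<^sub>0>b. \<forall>k. a (k + 1) / a k \<le> C\<^sub>0) \<and>
         (\<forall>(\<Phi> :: int \<Rightarrow> real ^ 'n \<Rightarrow> complex) \<phi>\<^sub>0.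
            adapted_partition a \<Phi> \<longrightarrow> dyadic_generator \<phi>\<^sub>0 \<longrightarrow>
            equivalent_norms tempered_mod_poly
              (adapted_TL_norm \<alpha> p q a \<Phi>) (TL_norm \<alpha> p q \<phi>\<^sub>0))"
proof -
  interpret lacunary a b by standard (rule assms)+
  have ex: "\<exists>C\<^sub>0>b. \<forall>k. a (k + 1) / a k \<le> C\<^sub>0" by (rule ratio_bounded[OF assms(1-3,7)])
  then obtain C where C: "\<And>k. a (k + 1) / a k \<le> C" by blast
  have c: "\<And>k. a k \<le> a k" "\<And>k. b * a k \<le> a (k + 1)" using ratio_mult by auto
  define \<Psi> where "\<Psi> = (\<lambda>k. inv_fourier (step_multiplier b a k) :: real ^ 'n \<Rightarrow> complex)"
  have \<Psi>: "adapted_partition a \<Psi>" unfolding \<Psi>_def by (rule adapted_partition_step[OF c])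
  have "equivalent_norms tempered_mod_poly (adapted_TL_norm \<alpha> p q a \<Phi>) (TL_norm \<alpha> p q \<phi>\<^sub>0)"
    if \<Phi>: "adapted_partition a \<Phi>" and \<phi>: "dyadic_generator \<phi>\<^sub>0" for \<Phi> and \<phi>\<^sub>0 :: "real ^ 'n \<Rightarrow> complex"
  proof (rule equivalent_norms_trans[OF assms(7)[OF \<Phi> \<Psi>]])
    let ?t = "\<lambda>j. 2 powr real_of_int j" and ?\<nu> = "\<lambda>j \<xi>. \<phi>\<^sub>0 ((2 powi (- j)) *\<^sub>R \<xi>)"
    have s1: "frequency_system a (step_multiplier b a :: int \<Rightarrow> real ^ 'n \<Rightarrow> complex)" by (rule frequency_system_step[OF C])
    have s2: "frequency_system ?t ?\<nu>" by (rule frequency_system_dyadic[OF \<phi>])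
    \<comment> \<open>Both norms evaluate the same representative \<open>SOME u. u \<in> f\<close>,
      so inequalities for single tempered distributions pass to classes directly.\<close>
    have N1: "adapted_TL_norm \<alpha> p q a \<Psi> f = system_norm \<alpha> p q a (step_multiplier b a) (SOME u. u \<in> f)" for f
      by (simp add: adapted_TL_norm_def adapted_TL_dist_norm_def system_norm_def \<Psi>_def)
    have N2: "TL_norm \<alpha> p q \<phi>\<^sub>0 f = system_norm \<alpha> p q ?t ?\<nu> (SOME u. u \<in> f)" if "f \<in> tempered_mod_poly" for f
      unfolding TL_norm_def by (rule TL_dist_norm_eq_system_norm[OF \<phi> class_representative[OF that]])
    obtain D where D: "0 < D" "\<And>u. tempered u \<Longrightarrow> system_norm \<alpha> p q a (step_multiplier b a) u \<le> ennreal D * system_norm \<alpha> p q ?t ?\<nu> u"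
      using system_norm_le[OF s1 s2 assms(2,3)] by metis
    obtain E where E: "0 < E" "\<And>u. tempered u \<Longrightarrow> system_norm \<alpha> p q ?t ?\<nu> u \<le> ennreal E * system_norm \<alpha> p q a (step_multiplier b a) u"
      using system_norm_le[OF s2 s1 assms(2,3)] by metis
    show "equivalent_norms tempered_mod_poly (adapted_TL_norm \<alpha> p q a \<Psi>) (TL_norm \<alpha> p q \<phi>\<^sub>0)"
      unfolding equivalent_norms_def
    proof (intro conjI)
      show "\<exists>C>0. \<forall>f\<in>tempered_mod_poly. adapted_TL_norm \<alpha> p q a \<Psi> f \<le> ennreal C * TL_norm \<alpha> p q \<phi>\<^sub>0 f"
        using D by (intro exI[of _ D]) (simp add: N1 N2 class_representative)
      show "\<exists>C>0. \<forall>f\<in>tempered_mod_poly. TL_norm \<alpha> p q \<phi>\<^sub>0 f \<le> ennreal C * adapted_TL_norm \<alpha> p q a \<Psi> f"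
        using E by (intro exI[of _ E]) (simp add: N1 N2 class_representative)
    qed
  qed
  with ex show ?thesis by blast
qed

end
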